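(* Let $n\ge1$, $N=2^n$, let $U$ be Haar-distributed on $\mathrm{U}(2N)$, $A$ its upper-left $N\times N$ block and $\mathfrak H=A^\dagger A$. Let $f(x)=\sum_{q=0}^d c_qP_q(2x-1)$ be a complex polynomial of degree $d$ written in shifted Legendre polynomials ($c_q\in\mathbb C$). For $1\le\ell$ with $2\ell\le N$ define $$\mathcal H_\ell:=\int_{[0,1]^{2\ell}}\mathbb P^{(2\ell)}_{\mathrm{eig}}(\lambda_1,\dots,\lambda_{2\ell})\prod_{j=1}^{\ell}f(\lambda_j)\prod_{j=1}^{\ell}\overline{f(\lambda_{\ell+j})}\,d\lambda_1\cdots d\lambda_{2\ell}.$$ Then $$\mathcal H_\ell=\frac{(N-2\ell)!}{N!}\sum_{k_1=0}^{N-1}\cdots\sum_{k_{2\ell}=0}^{N-1}\ \sum_{\varsigma\in\mathsf S_{2\ell}}\operatorname{sgn}(\varsigma)\prod_{j=1}^{2\ell}\Big((2k_j+1)\sum_{q=0}^dC_q^{(j)}F_{q,k_j,k_{\varsigma^{-1}(j)}}\Big),$$ where $C_q^{(j)}=c_q$ if $j\le\ell$ and $C_q^{(j)}=\overline{c_q}$ if $j>\ell$, $\mathsf S_{2\ell}$ is the symmetric group, and $$F_{i,j,k}:=\frac12\int_{-1}^1P_i(x)P_j(x)P_k(x)\,dx=\begin{cases}\dfrac{(2s-2i)!(2s-2j)!(2s-2k)!}{(2s+1)!}\left(\dfrac{s!}{(s-i)!(s-j)!(s-k)!}\right)^2,& \text{if } i+j+k=2s\text{ is even and }|i-j|\le k\le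 i+j,\\[2mm] 0,&\text{otherwise.}\end{cases}$$
   Context: $P_i$ is the $i$-th Legendre polynomial. $\mathbb P^{(\ell)}_{\mathrm{eig}}$ denotes the $\ell$-point marginal density on $[0,1]^\ell$ of the joint density of the $N$ eigenvalues of $\mathfrak H$ listed in uniformly random order (the symmetrized joint eigenvalue density). *)

theory Defs
  imports "HOL-Probability.Probability" "HOL-Combinatorics.Permutations" "HOL-Library.Multiset"
begin

text \<open>Legendre polynomials via Bonnet's recursion: P_0 = 1, P_1 = x,
  (n+2) P_(n+2) = (2n+3) x P_(n+1) - (n+1) P_n.\<close>
fun legendreP :: "nat \<Rightarrow> real \<Rightarrow> real" where
  "legendreP 0 x = 1"
| "legendreP (Suc 0) x = x"
| "legendreP (Suc (Suc n)) x =
     ((2 * real n + 3) * x * legendreP (Suc n) x - (real n + 1) * legendreP n x) / (real n + 2)"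

definition legF :: "nat \<Rightarrow> nat \<Rightarrow> nat \<Rightarrow> real" where
  "legF i j k = (1/2) * integral {-1..1} (\<lambda>x. legendreP i x * legendreP j x * legendreP k x)"

definition mat_adj :: "complex^'m^'m \<Rightarrow> complex^'m^'m" where
  "mat_adj A = (\<chi> i j. cnj (A $ j $ i))"

definition is_unitary_mat :: "complex^'m^'m \<Rightarrow> bool" where
  "is_unitary_mat U \<longleftrightarrow> mat_adj U ** U = mat 1"

definition haar_unitary :: "(complex^'m^'m) measure" where
  "haar_unitary = (THE \<mu>. prob_space \<mu> \<and> sets \<mu> = sets borel
      \<and> emeasure \<mu> {U. is_unitary_mat U} = 1
      \<and> (\<forall>V. is_unitary_mat V \<longrightarrow> distr \<mu> borel (\<lambda>U. V ** U) = \<mu>))"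

definition eig_mset :: "complex^'n::finite^'n \<Rightarrow> complex multiset" where
  "eig_mset H = (THE M. size M = CARD('n) \<and>
      (\<forall>x. det (mat x - H) = (\<Prod>e\<in>#M. x - e)))"

definition ul_block :: "complex^('n+'n)^('n+'n) \<Rightarrow> complex^'n^'n" where
  "ul_block U = (\<chi> i j. U $ Inl i $ Inl j)"

definition eig_list :: "complex^('n::finite+'n)^('n+'n) \<Rightarrow> real list" where
  "eig_list U = sorted_list_of_multiset
      (image_mset Re (eig_mset (mat_adj (ul_block U) ** ul_block U)))"

definition eig_sym_law :: "'n::finite itself \<Rightarrow> (nat \<Rightarrow> real) measure" where
  "eig_sym_law _ = distr
      ((haar_unitary :: (complex^('n+'n)^('n+'n)) measure)
         \<Otimes>\<^sub>M uniform_count_measure {\<sigma>. \<sigma> permutes {..<CARD('n)}})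
      (PiM {..<CARD('n)} (\<lambda>_. borel))
      (\<lambda>(U, \<sigma>). \<lambda>i\<in>{..<CARD('n)}. eig_list U ! \<sigma> i)"

definition eig_marginal :: "'n::finite itself \<Rightarrow> nat \<Rightarrow> (nat \<Rightarrow> real) measure" where
  "eig_marginal t m = distr (eig_sym_law t) (PiM {..<m} (\<lambda>_. borel)) (\<lambda>x. restrict x {..<m})"

definition eig_density :: "'n::finite itself \<Rightarrow> nat \<Rightarrow> (nat \<Rightarrow> real) \<Rightarrow> ennreal" where
  "eig_density t m = RN_deriv (PiM {..<m} (\<lambda>_. lborel)) (eig_marginal t m)"

end

(*
Differentiating Haar integrals along right translations gives loop equations for the power sums of
the eigenvalues of A^* A. Together they say that E (L G) = 0 for every symmetric polynomial G, where
L is the radial Jacobi operator, and conjugation by the Vandermonde determinant V diagonalizes L: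
Alt (P_(k_1)(2 x_1 - 1) ... P_(k_N)(2 x_N - 1)) / V is an eigenfunction, with eigenvalue 0 only for
constants. Applying 1 - L / eps for the nonzero eigenvalues eps occurring in G leaves its constant
component, which is therefore E G; the same component is the mean of G under V^2 on the cube. Moments
determine measures on the cube, so V^2, normalized, is the joint eigenvalue density. Expanding both
factors V into Legendre polynomials and integrating out N - 2 l variables by orthogonality yields the
sum over permutations. Adams' formula for the triple integrals follows from the three-term recurrence.
*)
theory Submission
  imports Defs "HOL-Computational_Algebra.Fundamental_Theorem_Algebra"
begin

subsection \<open>Shifted Legendre polynomials\<close>

text \<open>The block is exactly half of the unitary matrix. This makes the Jacobi weight x^a (1 -
  x)^b flat, which is why Legendre polynomials occur; in the loop equations it enters as trace 1 = 2
  trace P. There is no change of variables to singular values and no Jacobian. Traces of powers are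
  polynomials in the entries of U and their conjugates, so Haar calculus deals only with such
  functions, and eigenvalues enter through power sums. The price is that means are controlled on
  symmetric polynomials only. This is enough because the law is symmetrized: a monomial averaged
  over all permutations is symmetric. The eigenvalue 0 belongs only to constants because a nonzero
  alternant has distinct indices, and then the sum of k_j (k_j + 1) is least precisely for 0, ..., N
  - 1. The quotients 1 / (x_i - x_j) in the Laplacian make sense off the diagonals only; identities
  are extended across them by polynomiality along lines. Haar measure is given by a definite
  description, so it has to be constructed and shown unique; right invariance comes from invariance
  under the adjoint.\<close>

fun legp :: "nat \<Rightarrow> real poly" where
  "legp 0 = 1"
| "legp (Suc 0) = [:-1, 2:]"
| "legp (Suc (Suc n)) = smult (1 / (real n + 2))
     (smult (2 * real n + 3) ([:-1, 2:] * legp (Suc n)) - smult (real n + 1) (legp n))"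

lemma poly_legp: "poly (legp n) s = legendreP n (2 * s - 1)"
proof (induction n rule: legp.induct)
  case (3 n)
  have "real n + 2 \<noteq> 0" by linarith
  then show ?case by (simp add: 3 field_simps)
qed simp_all

lemma degree_legp: "degree (legp n) \<le> n"
proof (induction n rule: legp.induct)
  case (3 n)
  have "degree ([:-1, 2:] * legp (Suc n)) \<le> Suc (Suc n)"
    by (rule order_trans[OF degree_mult_le]) (use 3 in simp)
  moreover have "degree (legp n) \<le> Suc (Suc n)" using 3 by simp
  ultimately show ?case
    unfolding legp.simps by (intro order_trans[OF degree_smult_le] degree_diff_le) auto
qed auto

lemma legp_bonnet:
  "(real n + 2) * poly (legp (Suc (Suc n))) s =
     (2 * real n + 3) * (2 * s - 1) * poly (legp (Suc n)) s - (real n + 1) * poly (legp n) s"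
proof -
  have "real n + 2 \<noteq> 0" by linarith
  then show ?thesis by (simp add: field_simps)
qed

lemma pderiv_legp_bonnet:
  "(real n + 2) * poly (pderiv (legp (Suc (Suc n)))) s =
     (2 * real n + 3) * (2 * poly (legp (Suc n)) s + (2 * s - 1) * poly (pderiv (legp (Suc n))) s)
     - (real n + 1) * poly (pderiv (legp n)) s"
proof -
  have "real n + 2 \<noteq> 0" by linarith
  then show ?thesis
    by (simp add: pderiv_smult pderiv_diff pderiv_mult pderiv_pCons pderiv_add field_simps)
qed

text \<open>The induction step uses both relations, hence the conjunction. They are P_(n+1)' = y
  P_n' + (n+1) P_n and y P_(n+1)' - P_n' = (n+1) P_(n+1) with y = 2 s - 1; the factors 2 come from
  the chain rule.\<close>

lemma pderiv_legp_ladder: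
  "poly (pderiv (legp (Suc n))) s
     = (2 * s - 1) * poly (pderiv (legp n)) s + 2 * (real n + 1) * poly (legp n) s \<and>
   (2 * s - 1) * poly (pderiv (legp (Suc n))) s - poly (pderiv (legp n)) s
     = 2 * (real n + 1) * poly (legp (Suc n)) s"
proof (induction n)
  case 0
  then show ?case by (simp add: pderiv_pCons algebra_simps)
next
  case (Suc n)
  define y p0 p1 p2 d0 d1 d2 where defs: "y = 2 * s - 1"
    "p0 = poly (legp n) s" "p1 = poly (legp (Suc n)) s" "p2 = poly (legp (Suc (Suc n))) s"
    "d0 = poly (pderiv (legp n)) s" "d1 = poly (pderiv (legp (Suc n))) s"
    "d2 = poly (pderiv (legp (Suc (Suc n)))) s"
  define r where "r = real n"
  have r: "r + 2 \<noteq> 0" unfolding r_def by linarith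
  have A: "d1 = y * d0 + 2 * (r + 1) * p0" and C: "y * d1 - d0 = 2 * (r + 1) * p1"
    using Suc unfolding defs r_def by auto
  have B: "(r + 2) * p2 = (2 * r + 3) * y * p1 - (r + 1) * p0"
    using legp_bonnet[of n s] unfolding defs r_def by simp
  have D: "(r + 2) * d2 = (2 * r + 3) * (2 * p1 + y * d1) - (r + 1) * d0"
    using pderiv_legp_bonnet[of n s] unfolding defs r_def by simp
  have d0: "d0 = y * d1 - 2 * (r + 1) * p1" using C by simp
  have "(r + 2) * d2 = (r + 2) * (y * d1 + 2 * (r + 2) * p1)"
    unfolding D d0 by (simp add: algebra_simps)
  then have A': "d2 = y * d1 + 2 * (r + 2) * p1" using r by simp
  \<comment> \<open>\<open>d0\<close> is eliminated between \<open>A\<close> and \<open>C\<close>.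
    With (y^2 - 1) \<open>d1\<close> replaced, Bonnet's recursion closes the second
    relation.\<close>
  have E: "(y * y - 1) * d1 = 2 * (r + 1) * (y * p1 - p0)"
  proof -
    have "y * (y * d1) = y * d0 + 2 * (r + 1) * (y * p1)" unfolding d0 by (simp add: algebra_simps)
    then show ?thesis using A by (simp add: algebra_simps)
  qed
  have "y * d2 - d1 = (y * y - 1) * d1 + 2 * (r + 2) * (y * p1)"
    unfolding A' by (simp add: algebra_simps)
  also have "\<dots> = 2 * ((2 * r + 3) * y * p1 - (r + 1) * p0)" unfolding E by (simp add: algebra_simps)
  also have "\<dots> = 2 * (r + 2) * p2" unfolding B[symmetric] by simp
  finally have "y * d2 - d1 = 2 * (r + 2) * p2" .
  with A' show ?case unfolding defs r_def by (simp add: algebra_simps)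
qed

text \<open>Eliminating P_(n-1)' from the ladder relations expresses s (1 - s) P_n' through y P_n
  and P_(n-1); differentiating that combination brings in the second ladder relation again.
  \<open>[:0, 1, -1:]\<close> is s (1 - s).\<close>

lemma legp_ode: "pderiv ([:0, 1, -1:] * pderiv (legp n)) = smult (- (real n * (real n + 1))) (legp n)"
proof (cases n)
  case 0 then show ?thesis by simp
next
  case (Suc m)
  have "[:0, 1, -1:] * pderiv (legp (Suc m))
      = smult (- (real m + 1) / 2) ([:-1, 2:] * legp (Suc m) - legp m)"
  proof (rule poly_ext)
    fix s :: real
    define r where "r = real m"
    have A: "poly (pderiv (legp (Suc m))) s
         = (2 * s - 1) * poly (pderiv (legp m)) s + 2 * (r + 1) * poly (legp m) s"
      and C: "(2 * s - 1) * poly (pderiv (legp (Suc m))) s - poly (pderiv (legp m)) s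
         = 2 * (r + 1) * poly (legp (Suc m)) s"
      using pderiv_legp_ladder[of m s] unfolding r_def by auto
    have d0: "poly (pderiv (legp m)) s = (2 * s - 1) * poly (pderiv (legp (Suc m))) s - 2 * (r + 1) * poly (legp (Suc m)) s"
      using C by simp
    have "4 * (s * (1 - s)) * poly (pderiv (legp (Suc m))) s
       = - 2 * (r + 1) * ((2 * s - 1) * poly (legp (Suc m)) s - poly (legp m) s)"
      using A unfolding d0 by (simp add: algebra_simps)
    then show "poly ([:0, 1, -1:] * pderiv (legp (Suc m))) s
       = poly (smult (- (real m + 1) / 2) ([:-1, 2:] * legp (Suc m) - legp m)) s"
      unfolding r_def by (simp add: field_simps)
  qed
  then have "pderiv ([:0, 1, -1:] * pderiv (legp (Suc m)))
      = smult (- (real m + 1) / 2) (pderiv ([:-1, 2:] * legp (Suc m) - legp m))"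
    by (simp only: pderiv_smult)
  also have "\<dots> = smult (- (real n * (real n + 1))) (legp (Suc m))"
  proof (rule poly_ext)
    fix s :: real
    have C: "(2 * s - 1) * poly (pderiv (legp (Suc m))) s - poly (pderiv (legp m)) s
         = 2 * (real m + 1) * poly (legp (Suc m)) s"
      using pderiv_legp_ladder[of m s] by auto
    have "poly (pderiv ([:-1, 2:] * legp (Suc m) - legp m)) s
      = 2 * poly (legp (Suc m)) s + ((2 * s - 1) * poly (pderiv (legp (Suc m))) s - poly (pderiv (legp m)) s)"
      by (simp add: pderiv_diff pderiv_mult pderiv_pCons pderiv_smult pderiv_add algebra_simps)
    also have "\<dots> = 2 * (real m + 2) * poly (legp (Suc m)) s" unfolding C by (simp add: algebra_simps)
    finally show "poly (smult (- (real m + 1) / 2) (pderiv ([:-1, 2:] * legp (Suc m) - legp m))) s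
      = poly (smult (- (real n * (real n + 1))) (legp (Suc m))) s"
      unfolding Suc by (simp add: field_simps)
  qed
  finally show ?thesis using Suc by simp
qed

definition int01 :: "real poly \<Rightarrow> real" where
  "int01 p = integral {0..1} (poly p)"

lemma poly_integrable_on: "poly (p::real poly) integrable_on {a..b}"
  by (intro integrable_continuous_real continuous_intros) 

lemma int01_add: "int01 (p + q) = int01 p + int01 q"
  unfolding int01_def
  by (subst integral_add[symmetric]) (auto simp: poly_integrable_on intro!: integral_cong)

lemma int01_smult: "int01 (smult c p) = c * int01 p"
proof -
  have "poly (smult c p) = (\<lambda>x. c * poly p x)" by (simp add: fun_eq_iff)
  then show ?thesis by (simp add: int01_def)
qed

lemma int01_pderiv: "int01 (pderiv p) = poly p 1 - poly p 0"
  unfolding int01_def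
  by (intro integral_unique fundamental_theorem_of_calculus)
     (auto intro!: has_real_derivative_iff_has_vector_derivative[THEN iffD1] DERIV_subset[OF poly_DERIV])

text \<open>For n > 0 integrate the Legendre equation: the boundary terms vanish because s (1 - s)
  is 0 at both ends.\<close>

lemma int01_legp: "int01 (legp n) = (if n = 0 then 1 else 0)"
proof (cases "n = 0")
  case True
  then show ?thesis using int01_pderiv[of "[:0, 1:]"] by (simp add: pderiv_pCons one_pCons)
next
  case False
  have "- (real n * (real n + 1)) * int01 (legp n) = 0"
    using int01_pderiv[of "[:0, 1, -1:] * pderiv (legp n)"] unfolding legp_ode int01_smult by simp
  then show ?thesis using False by (auto simp: add_eq_0_iff)
qed

text \<open>At n = 0 the truncated \<open>n - 1\<close> is harmless, its coefficient being 0, so one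
  formula covers every n.\<close>

lemma legp_times_var:
  "smult (2 * real n + 1) ([:-1, 2:] * legp n)
     = smult (real n + 1) (legp (Suc n)) + smult (real n) (legp (n - 1))"
proof (cases n)
  case (Suc m)
  have "real m + 2 \<noteq> 0" by linarith
  then show ?thesis unfolding Suc by (simp add: add.commute)
qed simp

declare legp.simps(3) [simp del]

text \<open>Multiplication by 2 s - 1 can be attached to either factor. With \<open>q = 1\<close>
  this yields orthogonality, with \<open>q = legp k\<close> the recurrence of the triple
  integrals.\<close>

lemma int01_recurrence:
  "(2 * real j + 1) * ((real i + 1) * int01 (legp (Suc i) * legp j * q) + real i * int01 (legp (i - 1) * legp j * q))
   = (2 * real i + 1) * ((real j + 1) * int01 (legp i * legp (Suc j) * q) + real j * int01 (legp i * legp (j - 1) * q))"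
proof -
  have *: "(real i + 1) * int01 (legp (Suc i) * r) + real i * int01 (legp (i - 1) * r)
     = (2 * real i + 1) * int01 ([:-1, 2:] * legp i * r)" for i r
  proof -
    have "(real i + 1) * int01 (legp (Suc i) * r) + real i * int01 (legp (i - 1) * r)
      = int01 ((smult (real i + 1) (legp (Suc i)) + smult (real i) (legp (i - 1))) * r)"
      by (simp add: int01_add[symmetric] int01_smult[symmetric] distrib_right)
    also have "\<dots> = (2 * real i + 1) * int01 ([:-1, 2:] * legp i * r)"
      unfolding legp_times_var[symmetric] by (simp only: mult_smult_left int01_smult)
    finally show ?thesis .
  qed
  have 1: "legp a * legp j * q = legp a * (legp j * q)" "legp i * legp a * q = legp a * (legp i * q)" for a
    by (simp_all only: mult_ac)
  have 2: "[:-1, 2:] * legp j * (legp i * q) = [:-1, 2:] * legp i * (legp j * q)"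
    by (simp only: mult_ac)
  show ?thesis
    unfolding 1 *[of i "legp j * q"] *[of j "legp i * q"] 2 by simp
qed

text \<open>\<open>int01_recurrence\<close> with \<open>q = 1\<close> raises \<open>i\<close> by one
  from integrals known by induction; the start is \<open>int01_legp\<close>.\<close>

lemma int01_legp_legp: "int01 (legp i * legp j) = (if i = j then 1 / (2 * real i + 1) else 0)"
proof (induction i arbitrary: j rule: less_induct)
  case (less i)
  show ?case
  proof (cases i)
    case 0 then show ?thesis using int01_legp[of j] by simp
  next
    case (Suc m)
    have R: "(2 * real j + 1) * ((real m + 1) * int01 (legp (Suc m) * legp j) + real m * int01 (legp (m - 1) * legp j))
      = (2 * real m + 1) * ((real j + 1) * int01 (legp m * legp (Suc j)) + real j * int01 (legp m * legp (j - 1)))"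
      using int01_recurrence[of j m 1] by simp
    have m: "int01 (legp m * legp k) = (if m = k then 1 / (2 * real m + 1) else 0)" for k
      using less Suc by simp
    have m1: "real m * int01 (legp (m - 1) * legp j) = (if m = Suc j then real m / (2 * real (m - 1) + 1) else 0)"
      using less[of "m - 1" j] Suc by (cases m) auto
    have nz: "2 * real j + 1 \<noteq> 0" "2 * real m + 1 \<noteq> 0" by linarith+
    have Y: "(2 * real j + 1) * (real m * int01 (legp (m - 1) * legp j)) = (if m = Suc j then real m else 0)"
      using m1 nz by auto
    have Z: "(2 * real m + 1) * ((real j + 1) * int01 (legp m * legp (Suc j)) + real j * int01 (legp m * legp (j - 1)))
       = (if m = Suc j then real j + 1 else 0) + (if Suc m = j then real j else 0)"
      unfolding m using nz by (cases j) auto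
    have "(real m + 1) * ((2 * real j + 1) * int01 (legp (Suc m) * legp j))
       = (2 * real j + 1) * ((real m + 1) * int01 (legp (Suc m) * legp j))"
      by (rule mult.left_commute)
    also have "\<dots> = (if Suc m = j then real m + 1 else 0)"
    proof -
      have "A = (if Suc m = j then real m + 1 else 0)"
        if "A + B = C" "C = (if m = Suc j then real j + 1 else 0) + (if Suc m = j then real j else 0)"
          "B = (if m = Suc j then real m else 0)" for A B C :: real
        using that by (auto split: if_splits)
      from this[OF R[unfolded distrib_left[of "2 * real j + 1"]] Z Y] show ?thesis .
    qed
    also have "\<dots> = (real m + 1) * (if Suc m = j then 1 else 0)" by simp
    finally have "(real m + 1) * ((2 * real j + 1) * int01 (legp (Suc m) * legp j))
       = (real m + 1) * (if Suc m = j then 1 else 0)" .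
    moreover have "real m + 1 \<noteq> 0" by linarith
    ultimately have "int01 (legp (Suc m) * legp j) * (2 * real j + 1) = (if Suc m = j then 1 else 0)"
      by (simp only: mult_cancel_left simp_thms mult.commute)
    then have "int01 (legp (Suc m) * legp j) = (if Suc m = j then 1 else 0) / (2 * real j + 1)"
      by (rule eq_divide_imp[OF nz(1)])
    then show ?thesis unfolding Suc by (cases "Suc m = j") simp_all
  qed
qed

subsection \<open>Integrals of three Legendre polynomials\<close>

lemma integral_affine01:
  fixes p :: "real poly"
  shows "(1/2) * integral {-1..1} (poly p) = integral {0..1} (\<lambda>x. poly p (2 * x - 1))"
proof -
  have "((\<lambda>x. poly p (2 * x + (-1))) has_integral (1 / \<bar>2\<bar>) * integral (cbox (-1) 1) (poly p)) ((\<lambda>x. (1 / 2) * x + -((1/2) * (-1))) ` cbox (-1) 1)"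
    using has_integral_affinity[OF integrable_integral[OF poly_integrable_on[of p "-1" 1], folded cbox_interval], of 2 "-1"]
    by simp
  moreover have "(\<lambda>x::real. (1 / 2) * x + -((1/2) * (-1))) ` cbox (-1) 1 = {0..1}"
    by (simp add: image_affinity_atLeastAtMost_div)
  ultimately show ?thesis by (simp add: integral_unique)
qed

text \<open>The unshifted polynomials as elements of \<open>real poly\<close>, so that the integrand
  of \<open>legF\<close> is a polynomial to which the substitution x = 2 s - 1 applies.\<close>

fun legq :: "nat \<Rightarrow> real poly" where
  "legq 0 = 1"
| "legq (Suc 0) = [:0, 1:]"
| "legq (Suc (Suc n)) = smult (1 / (real n + 2))
     (smult (2 * real n + 3) ([:0, 1:] * legq (Suc n)) - smult (real n + 1) (legq n))"

lemma poly_legq: "poly (legq n) s = legendreP n s"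
proof (induction n rule: legq.induct)
  case (3 n)
  have "real n + 2 \<noteq> 0" by linarith
  then show ?case by (simp add: 3 field_simps)
qed simp_all

lemma legF_int01: "legF i j k = int01 (legp i * legp j * legp k)"
proof -
  have *: "(\<lambda>x. legendreP i x * legendreP j x * legendreP k x) = poly (legq i * legq j * legq k)"
    by (simp add: poly_legq fun_eq_iff)
  show ?thesis
    unfolding legF_def * integral_affine01 int01_def
    by (intro arg_cong[where f = "integral {0..1}"]) (simp add: fun_eq_iff poly_legq poly_legp)
qed

lemma legF_recurrence:
  "(2 * real j + 1) * ((real i + 1) * legF (Suc i) j k + real i * legF (i - 1) j k)
   = (2 * real i + 1) * ((real j + 1) * legF i (Suc j) k + real j * legF i (j - 1) k)"
  unfolding legF_int01 by (rule int01_recurrence)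

text \<open>Adams' formula in central binomial coefficients \<open>c\<close> reads
  \<open>c (s - i) c (s - j) c (s - k) / ((2 s + 1) c s)\<close>. Setting \<open>c n = 0\<close> for \<open>n < 0\<close>
  makes the triangle condition automatic.\<close>

definition central_binom :: "int \<Rightarrow> real" where
  "central_binom n = (if n < 0 then 0 else fact (2 * nat n) / (fact (nat n))\<^sup>2)"

text \<open>Read downwards, the recursion of central binomials holds at every integer: at 0 the
  factor n kills the right-hand side, below 0 both sides vanish. Hence the recurrence of
  \<open>adams\<close> has no case split at the edge of the triangle.\<close>

lemma central_binom_down: "central_binom (n - 1) = of_int n * central_binom n / (2 * (2 * of_int n - 1))"
proof -
  consider "n < 0" | "n = 0" | m where "n = int (Suc m)"
    by (metis int_nat_eq nat_0_iff not_less not_less_iff_gr_or_eq of_nat_0_less_iff gr0_implies_Suc zero_less_imp_eq_int)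
  then show ?thesis
  proof cases
    case 3
    have "n - 1 = int m" "nat n = Suc m" using 3 by auto
    moreover have "fact (2 * Suc m) = (2 * real m + 2) * (2 * real m + 1) * fact (2 * m)"
      by (simp add: algebra_simps)
    moreover have "fact (Suc m) = (real m + 1) * fact m" by (simp add: algebra_simps)
    moreover have "f / g\<^sup>2 = (r + 1) * ((2 * r + 2) * (2 * r + 1) * f / ((r + 1) * g)\<^sup>2) / (2 * (2 * (r + 1) - 1))"
      if "g \<noteq> 0" "2 * r + 1 \<noteq> 0" "r + 1 \<noteq> 0" for f g r :: real
      using that by (simp add: divide_simps power2_eq_square) (simp add: algebra_simps)
    from this[of "fact m" "real m" "fact (2 * m)"]
    have "fact (2 * m) / (fact m)\<^sup>2 = (real m + 1) * ((2 * real m + 2) * (2 * real m + 1) * fact (2 * m) / ((real m + 1) * fact m)\<^sup>2) / (2 * (2 * (real m + 1) - 1))"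
      by simp
    moreover have "real_of_int n = real m + 1" using 3 by simp
    ultimately show ?thesis unfolding central_binom_def
      by (simp only: nat_int 3 if_False of_nat_less_0_iff)
  qed (auto simp: central_binom_def)
qed

definition adams :: "int \<Rightarrow> int \<Rightarrow> int \<Rightarrow> real" where
  "adams i j k = (if even (i + j + k) then
      (let s = (i + j + k) div 2 in central_binom (s - i) * central_binom (s - j) * central_binom (s - k) / ((2 * of_int s + 1) * central_binom s))
    else 0)"

lemma central_binom_nz: "n \<ge> 0 \<Longrightarrow> central_binom n \<noteq> 0"
  unfolding central_binom_def by auto

lemma odd_nz: "2 * real_of_int n - 1 \<noteq> 0" "2 * real_of_int n + 1 \<noteq> 0"
proof -
  have "2 * n - 1 \<noteq> 0" "2 * n + 1 \<noteq> 0" by presburger+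
  then have "real_of_int (2 * n - 1) \<noteq> 0" "real_of_int (2 * n + 1) \<noteq> 0" by (simp_all only: of_int_eq_0_iff not_False_eq_True)
  then show "2 * real_of_int n - 1 \<noteq> 0" "2 * real_of_int n + 1 \<noteq> 0" by simp_all
qed

text \<open>The same recurrence as in \<open>legF_recurrence\<close>, so formula and integral agree
  once they agree at i = 0. A common product of central binomials factors out and leaves an identity
  between rational functions of a, b, c.\<close>

lemma adams_recurrence:
  fixes i j k :: int
  assumes "i \<ge> 0" "j \<ge> 0" "k \<ge> 0"
  shows "(2 * of_int j + 1) * ((of_int i + 1) * adams (i + 1) j k + of_int i * adams (i - 1) j k)
   = (2 * of_int i + 1) * ((of_int j + 1) * adams i (j + 1) k + of_int j * adams i (j - 1) k)"
proof (cases "even (i + 1 + j + k)")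
  case False
  then have "odd (i + 1 + j + k)" "odd (i - 1 + j + k)" "odd (i + (j + 1) + k)" "odd (i + (j - 1) + k)" by presburger+
  then show ?thesis unfolding adams_def by simp
next
  case True
  then obtain s where s: "i + 1 + j + k = 2 * s" by (rule evenE)
  have s1: "s \<ge> 1" using s assms by presburger
  define a b c where abc: "a = s - (i + 1)" "b = s - j" "c = s - k"
  have sv: "s = a + b + c" "i = b + c - 1" "j = a + c" "k = a + b" using s abc by auto
  have e: "even (i + 1 + j + k)" "even (i - 1 + j + k)" "even (i + (j + 1) + k)" "even (i + (j - 1) + k)"
    using s by presburger+
  have d: "(i + 1 + j + k) div 2 = s" "(i - 1 + j + k) div 2 = s - 1" "(i + (j + 1) + k) div 2 = s"
     "(i + (j - 1) + k) div 2 = s - 1" using s by presburger+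
  have ar: "s - (i + 1) = a" "s - j = b" "s - k = c" "s - 1 - (i - 1) = a + 1" "s - 1 - j = b - 1" "s - 1 - k = c - 1"
    "s - i = a + 1" "s - (j + 1) = b - 1" "s - 1 - i = a" "s - 1 - (j - 1) = b"
    "2 * real_of_int (s - 1) + 1 = 2 * real_of_int s - 1"
    by (simp_all add: abc)
  have A: "adams (i + 1) j k = central_binom a * central_binom b * central_binom c / ((2 * of_int s + 1) * central_binom s)"
    "adams (i - 1) j k = central_binom (a + 1) * central_binom (b - 1) * central_binom (c - 1) / ((2 * of_int s - 1) * central_binom (s - 1))"
    "adams i (j + 1) k = central_binom (a + 1) * central_binom (b - 1) * central_binom c / ((2 * of_int s + 1) * central_binom s)"
    "adams i (j - 1) k = central_binom a * central_binom b * central_binom (c - 1) / ((2 * of_int s - 1) * central_binom (s - 1))"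
    unfolding adams_def if_P[OF e(1)] if_P[OF e(2)] if_P[OF e(3)] if_P[OF e(4)] d Let_def
    by (simp_all only: ar)
  define ra rb rc rs where r: "ra = real_of_int a" "rb = real_of_int b" "rc = real_of_int c" "rs = real_of_int s"
  \<comment> \<open>These sit at the upper indices a + 1, b, c, s. Every other value that occurs is
    one step lower and is rewritten by \<open>central_binom_down\<close>, so all four terms share
    the factor \<open>X * B * C / S\<close>.\<close>
  define X B C S where X: "X = central_binom (a + 1)" "B = central_binom b" "C = central_binom c" "S = central_binom s"
  have low: "central_binom a = (ra + 1) * X / (2 * (2 * ra + 1))" "central_binom (b - 1) = rb * B / (2 * (2 * rb - 1))"
    "central_binom (c - 1) = rc * C / (2 * (2 * rc - 1))" "central_binom (s - 1) = rs * S / (2 * (2 * rs - 1))"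
    using central_binom_down[of "a + 1"] central_binom_down[of b] central_binom_down[of c] central_binom_down[of s] unfolding X r
    by (simp_all add: algebra_simps)
  have nz: "2 * ra + 1 \<noteq> 0" "2 * rb - 1 \<noteq> 0" "2 * rc - 1 \<noteq> 0" "2 * rs - 1 \<noteq> 0" "2 * rs + 1 \<noteq> 0" "rs \<noteq> 0" "S \<noteq> 0"
    unfolding r X using odd_nz s1 central_binom_nz[of s] by auto
  have A': "adams (i + 1) j k = (X * B * C / S) * ((ra + 1) / (2 * (2 * ra + 1) * (2 * rs + 1)))"
    "adams (i - 1) j k = (X * B * C / S) * (rb * rc / (2 * (2 * rb - 1) * (2 * rc - 1) * rs))"
    "adams i (j + 1) k = (X * B * C / S) * (rb / (2 * (2 * rb - 1) * (2 * rs + 1)))"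
    "adams i (j - 1) k = (X * B * C / S) * ((ra + 1) * rc / (2 * (2 * ra + 1) * (2 * rc - 1) * rs))"
    unfolding A low unfolding X(2)[symmetric] X(3)[symmetric] X(4)[symmetric] X(1)[symmetric] r(4)[symmetric]
    using nz(1-7) by (simp_all add: divide_simps) (simp_all add: algebra_simps)
  have ri: "real_of_int i = rb + rc - 1" "real_of_int j = ra + rc" and rs: "rs = ra + rb + rc"
    using sv unfolding r by simp_all
  have key: "(2 * (ra + rc) + 1) * ((rb + rc) * ((ra + 1) / (2 * (2 * ra + 1) * (2 * rs + 1)))
        + (rb + rc - 1) * (rb * rc / (2 * (2 * rb - 1) * (2 * rc - 1) * rs)))
     = (2 * (rb + rc - 1) + 1) * ((ra + rc + 1) * (rb / (2 * (2 * rb - 1) * (2 * rs + 1)))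
        + (ra + rc) * ((ra + 1) * rc / (2 * (2 * ra + 1) * (2 * rc - 1) * rs)))"
    using nz(1-6) by (simp add: divide_simps) (simp add: rs algebra_simps)
  have "(2 * of_int j + 1) * ((of_int i + 1) * adams (i + 1) j k + of_int i * adams (i - 1) j k)
     = (X * B * C / S) * ((2 * (ra + rc) + 1) * ((rb + rc) * ((ra + 1) / (2 * (2 * ra + 1) * (2 * rs + 1)))
        + (rb + rc - 1) * (rb * rc / (2 * (2 * rb - 1) * (2 * rc - 1) * rs))))"
    unfolding A' ri by (simp only: distrib_left mult_ac diff_add_cancel)
  also have "\<dots> = (X * B * C / S) * ((2 * (rb + rc - 1) + 1) * ((ra + rc + 1) * (rb / (2 * (2 * rb - 1) * (2 * rs + 1)))
        + (ra + rc) * ((ra + 1) * rc / (2 * (2 * ra + 1) * (2 * rc - 1) * rs))))"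
    unfolding key ..
  also have "\<dots> = (2 * of_int i + 1) * ((of_int j + 1) * adams i (j + 1) k + of_int j * adams i (j - 1) k)"
    unfolding A' ri by (simp only: distrib_left mult_ac)
  finally show ?thesis .
qed

lemma legF_0: "legF 0 j k = adams 0 (int j) (int k)"
proof -
  have "legF 0 j k = (if j = k then 1 / (2 * real j + 1) else 0)"
    unfolding legF_int01 using int01_legp_legp[of j k] by simp
  moreover have "adams 0 (int j) (int k) = (if j = k then 1 / (2 * real j + 1) else 0)"
  proof (cases "j = k")
    case True
    have "central_binom (int k) \<noteq> 0" by (simp add: central_binom_nz)
    then show ?thesis using True by (simp add: adams_def central_binom_def)
  next
    case False
    have "adams 0 (int j) (int k) = 0"
    proof (cases "even (int j + int k)")
      case True
      then obtain s where s: "int j + int k = 2 * s" by (rule evenE)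
      then have "s - int j < 0 \<or> s - int k < 0" using False by linarith
      moreover have "(int j + int k) div 2 = s" using s by simp
      ultimately show ?thesis using True by (auto simp: adams_def Let_def central_binom_def)
    qed (simp add: adams_def)
    then show ?thesis using False by simp
  qed
  ultimately show ?thesis by simp
qed

lemma legF_adams: "legF i j k = adams (int i) (int j) (int k)"
proof (induction i arbitrary: j rule: less_induct)
  case (less i)
  show ?case
  proof (cases i)
    case 0 then show ?thesis using legF_0 by simp
  next
    case (Suc m)
    have 1: "legF m (Suc j) k = adams (int m) (int j + 1) (int k)" using less[of m "Suc j"] Suc by (simp add: add.commute)
    \<comment> \<open>For j = 0 the truncated \<open>j - 1\<close> and the integer -1 are different
      arguments, but both sides carry the factor 0. The same happens with \<open>m - 1\<close>
      below.\<close>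
    have 2: "real j * legF m (j - 1) k = real j * adams (int m) (int j - 1) (int k)"
      using less[of m "j - 1"] Suc by (cases j) auto
    have 3: "real m * legF (m - 1) j k = real m * adams (int m - 1) (int j) (int k)"
      using less[of "m - 1" j] Suc by (cases m) auto
    have "(2 * real j + 1) * ((real m + 1) * legF (Suc m) j k + real m * adams (int m - 1) (int j) (int k))
      = (2 * real j + 1) * ((real m + 1) * adams (int m + 1) (int j) (int k) + real m * adams (int m - 1) (int j) (int k))"
      using legF_recurrence[of j m k] adams_recurrence[of "int m" "int j" "int k"] unfolding 1 2 3 by simp
    moreover have "2 * real j + 1 \<noteq> 0" "real m + 1 \<noteq> 0" by linarith+
    ultimately have "legF (Suc m) j k = adams (int m + 1) (int j) (int k)" by simp
    then show ?thesis using Suc by (simp add: add.commute)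
  qed
qed

lemma legF_formula:
  assumes "i + j + k = 2 * s" "\<bar>int i - int j\<bar> \<le> int k" "k \<le> i + j"
  shows "legF i j k = fact (2 * s - 2 * i) * fact (2 * s - 2 * j) * fact (2 * s - 2 * k) / fact (2 * s + 1)
               * (fact s / (fact (s - i) * fact (s - j) * fact (s - k))) ^ 2"
proof -
  have le: "i \<le> s" "j \<le> s" "k \<le> s" using assms by linarith+
  have c: "central_binom (int s - int i) = fact (2 * s - 2 * i) / (fact (s - i))\<^sup>2" if "i \<le> s" for i
    using that unfolding central_binom_def by (simp add: nat_diff_distrib diff_mult_distrib2)
  have "(int i + int j + int k) div 2 = int s" "even (int i + int j + int k)" using assms(1) by presburger+
  then have "legF i j k = central_binom (int s - int i) * central_binom (int s - int j) * central_binom (int s - int k) / ((2 * real s + 1) * central_binom (int s))"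
    unfolding legF_adams adams_def by (simp add: Let_def)
  also have "(2 * real s + 1) * central_binom (int s) = fact (2 * s + 1) / (fact s)\<^sup>2"
    by (simp add: central_binom_def)
  finally show ?thesis unfolding c[OF le(1)] c[OF le(2)] c[OF le(3)]
    by (simp add: power_divide power_mult_distrib del: fact_Suc)
qed

lemma legF_zero:
  assumes "\<not> (even (i + j + k) \<and> \<bar>int i - int j\<bar> \<le> int k \<and> k \<le> i + j)"
  shows "legF i j k = 0"
proof (cases "even (i + j + k)")
  case False
  then have "odd (int i + int j + int k)" by presburger
  then show ?thesis unfolding legF_adams adams_def by simp
next
  case True
  then obtain s where s: "i + j + k = 2 * s" by (rule evenE)
  have "(int i + int j + int k) div 2 = int s" using s by presburger
  moreover have "int s - int i < 0 \<or> int s - int j < 0 \<or> int s - int k < 0" using s assms True by linarith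
  ultimately show ?thesis unfolding legF_adams adams_def by (auto simp: Let_def central_binom_def)
qed

subsection \<open>Power sums and alternants\<close>

definition psum :: "nat \<Rightarrow> nat \<Rightarrow> (nat \<Rightarrow> real) \<Rightarrow> real" where
  "psum N a x = (\<Sum>i<N. x i ^ a)"

definition pprod :: "nat \<Rightarrow> nat list \<Rightarrow> (nat \<Rightarrow> real) \<Rightarrow> real" where
  "pprod N as x = (\<Prod>a\<leftarrow>as. psum N a x)"

lemma pprod_simps [simp]: "pprod N [] x = 1" "pprod N (a # as) x = psum N a x * pprod N as x"
  "pprod N (as @ bs) x = pprod N as x * pprod N bs x"
  by (simp_all add: pprod_def)

text \<open>Linear combinations of words in the power sums. Derivations and loop equations are
  defined on words, and induction over this set extends statements about them to symmetric
  polynomials. Having the scalar inside \<open>mono\<close> keeps the induction at two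
  cases.\<close>

inductive_set symalg :: "nat \<Rightarrow> ((nat \<Rightarrow> real) \<Rightarrow> real) set" for N where
  mono: "(\<lambda>x. c * pprod N as x) \<in> symalg N"
| add: "G \<in> symalg N \<Longrightarrow> H \<in> symalg N \<Longrightarrow> (\<lambda>x. G x + H x) \<in> symalg N"

lemma symalg_const: "(\<lambda>x. c) \<in> symalg N"
  using symalg.mono[of c N "[]"] by simp

lemma symalg_psum: "psum N a \<in> symalg N"
  using symalg.mono[of 1 N "[a]"] by (simp add: eta_contract_eq)

lemma symalg_mult:
  assumes "G \<in> symalg N" "H \<in> symalg N"
  shows "(\<lambda>x. G x * H x) \<in> symalg N"
  using assms
proof (induction G)
  case (mono c as)
  from mono show ?case
  proof (induction H)
    case (mono d bs)
    show ?case using symalg.mono[of "c * d" N "as @ bs"] by (simp add: mult_ac)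
  next
    case (add H K)
    then show ?case using symalg.add[of "\<lambda>x. c * pprod N as x * H x" N] by (simp add: distrib_left)
  qed
next
  case (add G K)
  then show ?case using symalg.add[of "\<lambda>x. G x * H x" N] by (simp add: distrib_right)
qed

lemma symalg_scale: "G \<in> symalg N \<Longrightarrow> (\<lambda>x. c * G x) \<in> symalg N"
  by (rule symalg_mult[OF symalg_const])

lemma symalg_pprod: "pprod N as \<in> symalg N"
  using symalg.mono[of 1 N as] by (simp add: eta_contract_eq)

lemma symalg_diff: "G \<in> symalg N \<Longrightarrow> H \<in> symalg N \<Longrightarrow> (\<lambda>x. G x - H x) \<in> symalg N"
  using symalg.add[OF _ symalg_scale[of H N "-1"], of G] by simp

lemma symalg_sum: "(\<And>i. i \<in> A \<Longrightarrow> G i \<in> symalg N) \<Longrightarrow> (\<lambda>x. \<Sum>i\<in>A. G i x) \<in> symalg N"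
  by (induction A rule: infinite_finite_induct) (auto intro: symalg_const symalg.add)

text \<open>\<open>ldot N \<delta> as\<close> is the derivation with \<open>psum N a \<mapsto> \<delta> a\<close> applied to \<open>pprod N as\<close>.
  The loop equations of the eigenvalues say that \<open>loopf N k as\<close> has expectation 0 for \<open>k \<ge> 1\<close>;
  \<open>lapf\<close> combines them into the radial Laplacian of \<open>pprod N as\<close>.\<close>

fun ldot :: "nat \<Rightarrow> (nat \<Rightarrow> real) \<Rightarrow> nat list \<Rightarrow> (nat \<Rightarrow> real) \<Rightarrow> real" where
  "ldot N \<delta> [] x = 0"
| "ldot N \<delta> (a # as) x = \<delta> a * pprod N as x + psum N a x * ldot N \<delta> as x"

definition loopf :: "nat \<Rightarrow> nat \<Rightarrow> nat list \<Rightarrow> (nat \<Rightarrow> real) \<Rightarrow> real" where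
  "loopf N k as x =
     ((\<Sum>m<k. psum N m x * psum N (k - 1 - m) x) - (\<Sum>m<Suc k. psum N m x * psum N (k - m) x)) * pprod N as x
     + ldot N (\<lambda>a. real a * (psum N (k + a - 1) x - psum N (k + a) x)) as x"

fun lapf :: "nat \<Rightarrow> nat list \<Rightarrow> nat list \<Rightarrow> (nat \<Rightarrow> real) \<Rightarrow> real" where
  "lapf N pre [] x = 0"
| "lapf N pre (a # as) x = real a * loopf N a (pre @ as) x + lapf N (a # pre) as x"

lemma symalg_ldot:
  "(\<And>a. (\<lambda>x. \<delta> a x) \<in> symalg N) \<Longrightarrow> (\<lambda>x. ldot N (\<lambda>a. \<delta> a x) as x) \<in> symalg N"
  by (induction as) (auto intro!: symalg_const symalg.add symalg_mult symalg_pprod symalg_psum)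

lemma symalg_loopf: "loopf N k as \<in> symalg N"
  unfolding loopf_def[abs_def]
  by (intro symalg.add symalg_mult symalg_diff symalg_sum symalg_psum symalg_pprod symalg_ldot symalg_const)

lemma symalg_lapf: "lapf N pre as \<in> symalg N"
proof (induction as arbitrary: pre)
  case Nil
  then show ?case using symalg_const[of 0] by (simp add: fun_eq_iff[symmetric] lapf.simps(1)[abs_def])
next
  case (Cons a as)
  have "(\<lambda>x. real a * loopf N a (pre @ as) x + lapf N (a # pre) as x) \<in> symalg N"
    by (intro symalg.add symalg_scale symalg_loopf Cons)
  then show ?case by (simp add: lapf.simps(2)[abs_def])
qed

section \<open>Products of Legendre polynomials and their alternants\<close>

definition leg_prod :: "nat \<Rightarrow> (nat \<Rightarrow> nat) \<Rightarrow> (nat \<Rightarrow> real) \<Rightarrow> real" where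
  "leg_prod N k x = (\<Prod>j<N. poly (legp (k j)) (x j))"

definition altp :: "nat \<Rightarrow> (nat \<Rightarrow> nat) \<Rightarrow> (nat \<Rightarrow> real) \<Rightarrow> real" where
  "altp N k x = (\<Sum>\<tau> | \<tau> permutes {..<N}. of_int (sign \<tau>) * leg_prod N k (x \<circ> \<tau>))"

text \<open>Since \<open>legp k\<close> has degree \<open>k\<close>, this is a nonzero multiple of the Vandermonde determinant.\<close>

abbreviation "vdm N \<equiv> altp N id"

lemma leg_prod_reindex:
  assumes "\<sigma> permutes {..<N}"
  shows "leg_prod N (k \<circ> \<sigma>) x = leg_prod N k (x \<circ> inv \<sigma>)"
proof -
  have "leg_prod N k (x \<circ> inv \<sigma>) = (\<Prod>j<N. poly (legp (k (\<sigma> j))) (x (inv \<sigma> (\<sigma> j))))"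
    unfolding leg_prod_def o_def by (rule prod.reindex_bij_betw[OF permutes_imp_bij[OF assms], symmetric])
  then show ?thesis using permutes_inverses[OF assms] by (simp add: leg_prod_def)
qed

lemma finite_perms: "finite {\<sigma>. \<sigma> permutes {..<N::nat}}"
  by (simp add: finite_permutations)

lemma altp_perm_index:
  assumes s: "\<sigma> permutes {..<N}"
  shows "altp N (k \<circ> \<sigma>) x = of_int (sign \<sigma>) * altp N k x"
proof -
  have "altp N k x = (\<Sum>\<tau> | \<tau> permutes {..<N}. of_int (sign (\<tau> \<circ> inv \<sigma>)) * leg_prod N k (x \<circ> (\<tau> \<circ> inv \<sigma>)))"
    unfolding altp_def by (rule sum_permutations_compose_right[OF permutes_inv[OF s]])
  also have "\<dots> = (\<Sum>\<tau> | \<tau> permutes {..<N}. of_int (sign \<sigma>) * (of_int (sign \<tau>) * leg_prod N (k \<circ> \<sigma>) (x \<circ> \<tau>)))"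
  proof (rule sum.cong)
    fix \<tau> assume "\<tau> \<in> {\<tau>. \<tau> permutes {..<N}}"
    then have "permutation \<tau>" "permutation (inv \<sigma>)" "permutation \<sigma>"
      using s permutes_inv[OF s] by (auto simp: permutation_permutes)
    then have "sign (\<tau> \<circ> inv \<sigma>) = sign \<sigma> * sign \<tau>" by (simp add: sign_compose sign_inverse)
    then show "of_int (sign (\<tau> \<circ> inv \<sigma>)) * leg_prod N k (x \<circ> (\<tau> \<circ> inv \<sigma>))
      = of_int (sign \<sigma>) * (of_int (sign \<tau>) * leg_prod N (k \<circ> \<sigma>) (x \<circ> \<tau>))"
      unfolding leg_prod_reindex[OF s] by (simp add: o_assoc)
  qed simp
  finally have "altp N k x = of_int (sign \<sigma>) * altp N (k \<circ> \<sigma>) x"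
    by (simp add: altp_def sum_distrib_left)
  then show ?thesis by (simp add: sign_def)
qed

lemma altp_perm_arg:
  assumes s: "\<sigma> permutes {..<N}"
  shows "altp N k (x \<circ> \<sigma>) = of_int (sign \<sigma>) * altp N k x"
proof -
  have "altp N k x = (\<Sum>\<tau> | \<tau> permutes {..<N}. of_int (sign (\<sigma> \<circ> \<tau>)) * leg_prod N k (x \<circ> (\<sigma> \<circ> \<tau>)))"
    unfolding altp_def by (rule setum_permutations_compose_left[OF s])
  also have "\<dots> = (\<Sum>\<tau> | \<tau> permutes {..<N}. of_int (sign \<sigma>) * (of_int (sign \<tau>) * leg_prod N k (x \<circ> \<sigma> \<circ> \<tau>)))"
  proof (rule sum.cong)
    fix \<tau> assume "\<tau> \<in> {\<tau>. \<tau> permutes {..<N}}"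
    then have "permutation \<tau>" "permutation \<sigma>"
      using s by (auto simp: permutation_permutes)
    then show "of_int (sign (\<sigma> \<circ> \<tau>)) * leg_prod N k (x \<circ> (\<sigma> \<circ> \<tau>))
      = of_int (sign \<sigma>) * (of_int (sign \<tau>) * leg_prod N k (x \<circ> \<sigma> \<circ> \<tau>))"
      by (simp add: o_assoc sign_compose)
  qed simp
  finally have "altp N k x = of_int (sign \<sigma>) * altp N k (x \<circ> \<sigma>)"
    by (simp add: altp_def sum_distrib_left)
  then show ?thesis by (simp add: sign_def)
qed

text \<open>The transposition of two equal indices fixes \<open>k\<close> and reverses the
  sign.\<close>

lemma altp_noninj:
  assumes "\<not> inj_on k {..<N}" shows "altp N k x = 0"
proof -
  obtain i j where ij: "i < N" "j < N" "i \<noteq> j" "k i = k j" using assms by (auto simp: inj_on_def)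
  have "Transposition.transpose i j permutes {..<N}" using ij by (intro permutes_swap_id) auto
  moreover have "k \<circ> Transposition.transpose i j = k" using ij by (auto simp: fun_eq_iff Transposition.transpose_def)
  ultimately show ?thesis using altp_perm_index[of "Transposition.transpose i j" N k x] ij by (simp add: sign_swap_id)
qed

text \<open>The same argument for two equal coordinates; it supplies the roots of
  \<open>vslice\<close>.\<close>

lemma vdm_noninj:
  assumes "i < N" "j < N" "i \<noteq> j" "x i = x j" shows "vdm N x = 0"
proof -
  have "Transposition.transpose i j permutes {..<N}" using assms by (intro permutes_swap_id) auto
  moreover have "x \<circ> Transposition.transpose i j = x" using assms by (auto simp: fun_eq_iff Transposition.transpose_def)
  ultimately show ?thesis using altp_perm_arg[of "Transposition.transpose i j" N id x] assms by (simp add: sign_swap_id)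
qed

text \<open>Inverting the permutation moves it from the arguments to the indices, which exhibits
  \<open>vdm\<close> as a combination of Legendre products whose indices permute 0, ..., N -
  1.\<close>

lemma vdm_expand: "vdm N x = (\<Sum>\<sigma> | \<sigma> permutes {..<N}. of_int (sign \<sigma>) * leg_prod N \<sigma> x)"
proof -
  have "(\<Sum>\<sigma> | \<sigma> permutes {..<N}. of_int (sign \<sigma>) * leg_prod N \<sigma> x)
     = (\<Sum>\<sigma> | \<sigma> permutes {..<N}. of_int (sign (inv \<sigma>)) * leg_prod N (inv \<sigma>) x)"
    by (rule sum_permutations_inverse)
  also have "\<dots> = vdm N x" unfolding altp_def
  proof (rule sum.cong)
    fix \<sigma> assume "\<sigma> \<in> {\<sigma>. \<sigma> permutes {..<N}}"
    then have s: "\<sigma> permutes {..<N}" by simp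
    then have "permutation \<sigma>" by (auto simp: permutation_permutes)
    then show "of_int (sign (inv \<sigma>)) * leg_prod N (inv \<sigma>) x = of_int (sign \<sigma>) * leg_prod N id (x \<circ> \<sigma>)"
      using leg_prod_reindex[OF permutes_inv[OF s], of id x] by (simp add: sign_inverse permutes_inv_inv[OF s])
  qed simp
  finally show ?thesis by simp
qed

text \<open>Identities between functions that are polynomial along every line may be checked off the diagonals.\<close>

definition linepoly :: "((nat \<Rightarrow> real) \<Rightarrow> real) \<Rightarrow> bool" where
  "linepoly F \<longleftrightarrow> (\<forall>x y. \<exists>p. \<forall>s. F (\<lambda>i. x i + s * y i) = poly p s)"

lemma linepoly_const: "linepoly (\<lambda>x. c)"
  unfolding linepoly_def by (auto intro: exI[of _ "[:c:]"])

lemma linepoly_var: "linepoly (\<lambda>x. x i)"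
  unfolding linepoly_def
proof (intro allI)
  fix x y :: "nat \<Rightarrow> real"
  show "\<exists>p. \<forall>s. x i + s * y i = poly p s" by (rule exI[of _ "[:x i, y i:]"]) simp
qed

lemma linepoly_add: assumes "linepoly F" "linepoly G" shows "linepoly (\<lambda>x. F x + G x)"
  unfolding linepoly_def
proof (intro allI)
  fix x y :: "nat \<Rightarrow> real"
  obtain p q where "\<forall>s. F (\<lambda>i. x i + s * y i) = poly p s" "\<forall>s. G (\<lambda>i. x i + s * y i) = poly q s"
    using assms unfolding linepoly_def by meson
  then show "\<exists>p. \<forall>s. F (\<lambda>i. x i + s * y i) + G (\<lambda>i. x i + s * y i) = poly p s"
    by (intro exI[of _ "p + q"]) simp
qed

lemma linepoly_mult: assumes "linepoly F" "linepoly G" shows "linepoly (\<lambda>x. F x * G x)"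
  unfolding linepoly_def
proof (intro allI)
  fix x y :: "nat \<Rightarrow> real"
  obtain p q where "\<forall>s. F (\<lambda>i. x i + s * y i) = poly p s" "\<forall>s. G (\<lambda>i. x i + s * y i) = poly q s"
    using assms unfolding linepoly_def by meson
  then show "\<exists>p. \<forall>s. F (\<lambda>i. x i + s * y i) * G (\<lambda>i. x i + s * y i) = poly p s"
    by (intro exI[of _ "p * q"]) simp
qed

lemma linepoly_sum: "(\<And>i. i \<in> A \<Longrightarrow> linepoly (F i)) \<Longrightarrow> linepoly (\<lambda>x. \<Sum>i\<in>A. F i x)"
  by (induction A rule: infinite_finite_induct) (auto intro: linepoly_const linepoly_add)

lemma linepoly_prod: "(\<And>i. i \<in> A \<Longrightarrow> linepoly (F i)) \<Longrightarrow> linepoly (\<lambda>x. \<Prod>i\<in>A. F i x)"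
  by (induction A rule: infinite_finite_induct) (auto intro: linepoly_const linepoly_mult)

lemma linepoly_power: "linepoly F \<Longrightarrow> linepoly (\<lambda>x. F x ^ n)"
  by (induction n) (auto intro: linepoly_const linepoly_mult)

lemma linepoly_poly: "linepoly F \<Longrightarrow> linepoly (\<lambda>x. poly p (F x))"
  by (induction p) (auto intro!: linepoly_const linepoly_mult linepoly_add)

lemma linepoly_symalg: "G \<in> symalg N \<Longrightarrow> linepoly G"
proof (induction G rule: symalg.induct)
  case (mono c as)
  have "linepoly (pprod N as)"
  proof (induction as)
    case Nil then show ?case using linepoly_const[of 1] by (simp add: pprod_def[abs_def])
  next
    case (Cons a as)
    have "linepoly (\<lambda>x. psum N a x * pprod N as x)"
      unfolding psum_def by (intro linepoly_mult Cons linepoly_sum linepoly_power linepoly_var)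
    then show ?case by (simp add: pprod_def[abs_def])
  qed
  then show ?case by (intro linepoly_mult linepoly_const) (simp add: eta_contract_eq)
qed (rule linepoly_add)

lemma linepoly_leg_prod: "linepoly (leg_prod N k)"
  unfolding leg_prod_def[abs_def] by (intro linepoly_prod linepoly_poly linepoly_var)

lemma linepoly_vdm: "linepoly (vdm N)"
  unfolding vdm_expand[abs_def]
  by (intro linepoly_sum linepoly_mult linepoly_const) (simp add: linepoly_leg_prod eta_contract_eq)

text \<open>The line through x in the direction (0, 1, 2, ...) meets each diagonal x_i = x_j at most
  once, because the direction has distinct entries. So two polynomials in s agree for all but
  finitely many s, hence also at s = 0.\<close>

lemma linepoly_eqI:
  assumes F: "linepoly F" and G: "linepoly G"
    and eq: "\<And>x. inj_on x {..<N} \<Longrightarrow> F x = G x"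
  shows "F x = G x"
proof -
  let ?l = "\<lambda>s i. x i + s * real i"
  obtain p where p: "\<And>s. F (?l s) = poly p s"
    using F[unfolded linepoly_def, rule_format, of x real] by blast
  obtain q where q: "\<And>s. G (?l s) = poly q s"
    using G[unfolded linepoly_def, rule_format, of x real] by blast
  have "{s. \<not> inj_on (?l s) {..<N}} \<subseteq> (\<lambda>(i, j). (x j - x i) / (real i - real j)) ` ({..<N} \<times> {..<N})"
  proof
    fix s assume "s \<in> {s. \<not> inj_on (?l s) {..<N}}"
    then obtain i j where "i < N" "j < N" "i \<noteq> j" "x i + s * real i = x j + s * real j"
      by (auto simp: inj_on_def)
    then have "s = (x j - x i) / (real i - real j)" by (simp add: field_simps)
    then show "s \<in> (\<lambda>(i, j). (x j - x i) / (real i - real j)) ` ({..<N} \<times> {..<N})"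
      using \<open>i < N\<close> \<open>j < N\<close> by force
  qed
  then have fin: "finite {s. \<not> inj_on (?l s) {..<N}}" by (rule finite_subset) simp
  have "p - q = 0"
  proof (rule ccontr)
    assume "p - q \<noteq> 0"
    then have "finite {s. poly (p - q) s = 0}" by (rule poly_roots_finite)
    moreover have "UNIV \<subseteq> {s. poly (p - q) s = 0} \<union> {s. \<not> inj_on (?l s) {..<N}}"
      using eq p q by fastforce
    ultimately have "finite (UNIV :: real set)" using fin finite_subset[OF _ finite_UnI] by blast
    then show False using infinite_UNIV_char_0 by blast
  qed
  then show ?thesis using p[of 0] q[of 0] by simp
qed

text \<open>On the line from x to y both factors become polynomials in s, and the second is nonzero
  at s = 1. Polynomials have no zero divisors, so the first vanishes, in particular at s =
  0.\<close>

lemma linepoly_cancel: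
  assumes F: "linepoly F" and B: "linepoly B" and z: "\<And>x. F x * B x = 0" and y: "B y \<noteq> 0"
  shows "F x = 0"
proof -
  let ?l = "\<lambda>s i. x i + s * (y i - x i)"
  obtain p where p: "\<And>s. F (?l s) = poly p s"
    using F[unfolded linepoly_def, rule_format, of x "\<lambda>i. y i - x i"] by blast
  obtain q where q: "\<And>s. B (?l s) = poly q s"
    using B[unfolded linepoly_def, rule_format, of x "\<lambda>i. y i - x i"] by blast
  have "p * q = 0" by (intro poly_ext) (simp add: p[symmetric] q[symmetric] z)
  moreover have "poly q 1 \<noteq> 0" using q[of 1] y by simp
  ultimately have "p = 0" by auto
  then show ?thesis using p[of 0] by simp
qed

text \<open>Finite expansions are kept as explicit coefficient families, because the radial
  Laplacian multiplies the coefficient at \<open>k\<close> by a number. They are not unique: indices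
  that differ only beyond \<open>N\<close> give the same product.\<close>

definition leg_span :: "nat \<Rightarrow> ((nat \<Rightarrow> real) \<Rightarrow> real) \<Rightarrow> bool" where
  "leg_span N F \<longleftrightarrow> (\<exists>S c. finite S \<and> (\<forall>x. F x = (\<Sum>k\<in>S. c k * leg_prod N k x)))"

lemma leg_span_leg_prod: "leg_span N (leg_prod N k)"
  unfolding leg_span_def by (rule exI[of _ "{k}"], rule exI[of _ "\<lambda>_. 1"]) simp

lemma leg_span_scale: assumes "leg_span N F" shows "leg_span N (\<lambda>x. r * F x)"
proof -
  obtain S c where "finite S" "\<forall>x. F x = (\<Sum>k\<in>S. c k * leg_prod N k x)"
    using assms unfolding leg_span_def by blast
  then show ?thesis unfolding leg_span_def
    by (intro exI[of _ S] exI[of _ "\<lambda>k. r * c k"]) (simp add: sum_distrib_left mult.assoc)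
qed

lemma leg_span_add: assumes "leg_span N F" "leg_span N G" shows "leg_span N (\<lambda>x. F x + G x)"
proof -
  obtain S c where S: "finite S" "\<forall>x. F x = (\<Sum>k\<in>S. c k * leg_prod N k x)"
    using assms unfolding leg_span_def by blast
  obtain S' c' where S': "finite S'" "\<forall>x. G x = (\<Sum>k\<in>S'. c' k * leg_prod N k x)"
    using assms unfolding leg_span_def by blast
  let ?d = "\<lambda>k. (if k \<in> S then c k else 0) + (if k \<in> S' then c' k else 0)"
  have "F x + G x = (\<Sum>k\<in>S \<union> S'. ?d k * leg_prod N k x)" for x
  proof -
    have "(\<Sum>k\<in>S. c k * leg_prod N k x) = (\<Sum>k\<in>S \<union> S'. (if k \<in> S then c k else 0) * leg_prod N k x)"
      using S(1) S'(1) by (intro sum.mono_neutral_cong_left) auto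
    moreover have "(\<Sum>k\<in>S'. c' k * leg_prod N k x) = (\<Sum>k\<in>S \<union> S'. (if k \<in> S' then c' k else 0) * leg_prod N k x)"
      using S(1) S'(1) by (intro sum.mono_neutral_cong_left) auto
    ultimately show ?thesis using S S' by (simp add: sum.distrib distrib_right)
  qed
  then show ?thesis unfolding leg_span_def using S(1) S'(1) by (intro exI[of _ "S \<union> S'"] exI[of _ ?d]) simp
qed

lemma leg_span_0: "leg_span N (\<lambda>x. 0)"
  using leg_span_scale[OF leg_span_leg_prod, where r = 0] by simp

lemma leg_span_sum: "(\<And>i. i \<in> A \<Longrightarrow> leg_span N (F i)) \<Longrightarrow> leg_span N (\<lambda>x. \<Sum>i\<in>A. F i x)"
  by (induction A rule: infinite_finite_induct) (auto intro: leg_span_add leg_span_0)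

lemma leg_prod_upd:
  assumes "j < N"
  shows "leg_prod N (k(j := m)) x = (\<Prod>i\<in>{..<N} - {j}. poly (legp (k i)) (x i)) * poly (legp m) (x j)"
proof -
  have "leg_prod N (k(j := m)) x = poly (legp m) (x j) * (\<Prod>i\<in>{..<N} - {j}. poly (legp ((k(j := m)) i)) (x i))"
    unfolding leg_prod_def using assms by (subst prod.remove[of _ j]) auto
  also have "(\<Prod>i\<in>{..<N} - {j}. poly (legp ((k(j := m)) i)) (x i)) = (\<Prod>i\<in>{..<N} - {j}. poly (legp (k i)) (x i))"
    by (intro prod.cong) auto
  finally show ?thesis by (simp only: mult.commute)
qed

text \<open>Write x_j = 1/2 + (2 x_j - 1)/2 and use the three-term recurrence in the single index
  \<open>k j\<close>.\<close>

lemma leg_span_var_leg_prod: assumes j: "j < N" shows "leg_span N (\<lambda>x. x j * leg_prod N k x)"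
proof -
  let ?a = "real (k j)"
  have nz: "2 * ?a + 1 \<noteq> 0" by linarith
  have "x j * leg_prod N k x = (1/2) * leg_prod N k x + ((?a + 1) / (2 * (2 * ?a + 1))) * leg_prod N (k(j := Suc (k j))) x
     + (?a / (2 * (2 * ?a + 1))) * leg_prod N (k(j := k j - 1)) x" for x
  proof -
    have "poly (smult (2 * ?a + 1) ([:-1, 2:] * legp (k j))) (x j)
      = poly (smult (?a + 1) (legp (Suc (k j))) + smult ?a (legp (k j - 1))) (x j)"
      by (simp only: legp_times_var)
    then have r: "(2 * ?a + 1) * ((2 * x j - 1) * poly (legp (k j)) (x j))
      = (?a + 1) * poly (legp (Suc (k j))) (x j) + ?a * poly (legp (k j - 1)) (x j)" by (simp add: algebra_simps)
    have dl: "(1 / d) * (A * p + B * q) = (A / d) * p + (B / d) * q" for d A B p q :: real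
      by (simp add: add_divide_distrib distrib_left)
    have "x j * poly (legp (k j)) (x j) = (1/2) * poly (legp (k j)) (x j)
      + (1 / (2 * (2 * ?a + 1))) * ((2 * ?a + 1) * ((2 * x j - 1) * poly (legp (k j)) (x j)))"
      using nz by (simp add: field_simps)
    also have "\<dots> = (1/2) * poly (legp (k j)) (x j) + ((?a + 1) / (2 * (2 * ?a + 1))) * poly (legp (Suc (k j))) (x j)
     + (?a / (2 * (2 * ?a + 1))) * poly (legp (k j - 1)) (x j)"
      by (simp only: r dl add.assoc)
    finally have e: "x j * poly (legp (k j)) (x j) = \<dots>" .
    have k: "leg_prod N k x = (\<Prod>i\<in>{..<N} - {j}. poly (legp (k i)) (x i)) * poly (legp (k j)) (x j)"
      using leg_prod_upd[OF j, of k "k j"] by simp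
    have "x j * leg_prod N k x = (\<Prod>i\<in>{..<N} - {j}. poly (legp (k i)) (x i)) * (x j * poly (legp (k j)) (x j))"
      unfolding k by simp
    then show ?thesis unfolding e leg_prod_upd[OF j] k by (simp add: algebra_simps)
  qed
  then show ?thesis by (simp only:) (intro leg_span_add leg_span_scale leg_span_leg_prod)
qed

lemma leg_span_var: assumes "j < N" "leg_span N F" shows "leg_span N (\<lambda>x. x j * F x)"
proof -
  obtain S c where "finite S" "\<forall>x. F x = (\<Sum>k\<in>S. c k * leg_prod N k x)"
    using assms unfolding leg_span_def by blast
  then have "(\<lambda>x. x j * F x) = (\<lambda>x. \<Sum>k\<in>S. c k * (x j * leg_prod N k x))"
    by (simp add: sum_distrib_left fun_eq_iff algebra_simps)
  then show ?thesis by (simp only:) (intro leg_span_sum leg_span_scale leg_span_var_leg_prod assms)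
qed

lemma leg_span_power: "j < N \<Longrightarrow> leg_span N F \<Longrightarrow> leg_span N (\<lambda>x. x j ^ a * F x)"
proof (induction a)
  case (Suc a)
  then show ?case using leg_span_var[of j N "\<lambda>x. x j ^ a * F x"] by (simp add: mult.assoc)
qed (simp add: eta_contract_eq)

lemma leg_span_psum: "leg_span N F \<Longrightarrow> leg_span N (\<lambda>x. psum N a x * F x)"
  unfolding psum_def sum_distrib_right by (intro leg_span_sum leg_span_power) auto

text \<open>Multiplication by a coordinate preserves finite expansions. With
  \<open>F = vdm N\<close> this gives the expansion on which the Laplacian acts diagonally.\<close>

lemma leg_span_symalg: assumes "G \<in> symalg N" "leg_span N F" shows "leg_span N (\<lambda>x. G x * F x)"
  using assms
proof (induction G rule: symalg.induct)
  case (mono c as)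
  have "leg_span N (\<lambda>x. pprod N as x * F x)"
  proof (induction as)
    case Nil show ?case using mono by (simp add: eta_contract_eq)
  next
    case (Cons a as)
    then show ?case using leg_span_psum[of N "\<lambda>x. pprod N as x * F x" a] by (simp add: mult.assoc)
  qed
  then show ?case using leg_span_scale[of N "\<lambda>x. pprod N as x * F x" c] by (simp add: mult.assoc)
next
  case (add G H)
  then show ?case using leg_span_add[of N "\<lambda>x. G x * F x" "\<lambda>x. H x * F x"] by (simp add: distrib_right)
qed

lemma leg_span_vdm: "leg_span N (vdm N)"
proof -
  have "vdm N = (\<lambda>x. \<Sum>\<sigma> | \<sigma> permutes {..<N}. of_int (sign \<sigma>) * leg_prod N \<sigma> x)"
    by (rule ext) (rule vdm_expand)
  then show ?thesis by (simp only:) (intro leg_span_sum leg_span_scale leg_span_leg_prod)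
qed

subsection \<open>The cube integral\<close>

lemma indicator_poly_lborel:
  fixes p :: "real poly"
  shows "integrable lborel (\<lambda>t. indicator {0..1} t * poly p t)"
    and "(LINT t|lborel. indicator {0..1} t * poly p t) = int01 p"
proof -
  have "set_integrable lborel {0..1} (poly p)"
    unfolding set_integrable_def by (intro borel_integrable_compact continuous_intros) auto
  then show "integrable lborel (\<lambda>t. indicator {0..1} t * poly p t)"
    "(LINT t|lborel. indicator {0..1} t * poly p t) = int01 p"
    using set_borel_integral_eq_integral(2)[of "{0..1}" "poly p"]
    unfolding set_integrable_def set_lebesgue_integral_def int01_def by simp_all
qed

text \<open>The cube is cut out by a product of indicators on the whole space, so that integrals of
  products factor over the coordinates of \<open>PiM\<close>.\<close>

definition cubemap :: "nat \<Rightarrow> ((nat \<Rightarrow> real) \<Rightarrow> real) \<Rightarrow> (nat \<Rightarrow> real) \<Rightarrow> real" where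
  "cubemap N F x = (\<Prod>j<N. indicator {0..1} (x j)) * F x"

definition cube_integral :: "nat \<Rightarrow> ((nat \<Rightarrow> real) \<Rightarrow> real) \<Rightarrow> real" where
  "cube_integral N F = (LINT x|PiM {..<N} (\<lambda>_. lborel). cubemap N F x)"

definition cube_integrable :: "nat \<Rightarrow> ((nat \<Rightarrow> real) \<Rightarrow> real) \<Rightarrow> bool" where
  "cube_integrable N F \<longleftrightarrow> integrable (PiM {..<N} (\<lambda>_. lborel)) (cubemap N F)"

lemma cube_integrable_scale: "cube_integrable N F \<Longrightarrow> cube_integrable N (\<lambda>x. r * F x)"
  and cube_integral_scale: "cube_integral N (\<lambda>x. r * F x) = r * cube_integral N F"
proof -
  have e: "cubemap N (\<lambda>x. r * F x) = (\<lambda>x. r * cubemap N F x)" by (auto simp: cubemap_def)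
  show "cube_integrable N F \<Longrightarrow> cube_integrable N (\<lambda>x. r * F x)" unfolding cube_integrable_def e by simp
  show "cube_integral N (\<lambda>x. r * F x) = r * cube_integral N F" unfolding cube_integral_def e by simp
qed

lemma cube_integral_add: "cube_integrable N F \<Longrightarrow> cube_integrable N G \<Longrightarrow> cube_integral N (\<lambda>x. F x + G x) = cube_integral N F + cube_integral N G"
proof -
  have e: "cubemap N (\<lambda>x. F x + G x) = (\<lambda>x. cubemap N F x + cubemap N G x)"
    by (auto simp: cubemap_def distrib_left)
  show "cube_integrable N F \<Longrightarrow> cube_integrable N G \<Longrightarrow> cube_integral N (\<lambda>x. F x + G x) = cube_integral N F + cube_integral N G"
    unfolding cube_integral_def cube_integrable_def e by simp
qed

lemma cube_integrable_sum: "(\<And>i. i \<in> A \<Longrightarrow> cube_integrable N (F i)) \<Longrightarrow> cube_integrable N (\<lambda>x. \<Sum>i\<in>A. F i x)"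
  and cube_integral_sum: "(\<And>i. i \<in> A \<Longrightarrow> cube_integrable N (F i)) \<Longrightarrow> cube_integral N (\<lambda>x. \<Sum>i\<in>A. F i x) = (\<Sum>i\<in>A. cube_integral N (F i))"
proof -
  have e: "cubemap N (\<lambda>x. \<Sum>i\<in>A. F i x) = (\<lambda>x. \<Sum>i\<in>A. cubemap N (F i) x)"
    by (auto simp: cubemap_def sum_distrib_left)
  show "(\<And>i. i \<in> A \<Longrightarrow> cube_integrable N (F i)) \<Longrightarrow> cube_integrable N (\<lambda>x. \<Sum>i\<in>A. F i x)" unfolding cube_integrable_def e by simp
  show "(\<And>i. i \<in> A \<Longrightarrow> cube_integrable N (F i)) \<Longrightarrow> cube_integral N (\<lambda>x. \<Sum>i\<in>A. F i x) = (\<Sum>i\<in>A. cube_integral N (F i))"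
    unfolding cube_integral_def cube_integrable_def e by simp
qed

interpretation lborel_prod: product_sigma_finite "\<lambda>_::nat. lborel :: real measure" ..

lemma cube_integrable_prod: "cube_integrable N (\<lambda>x. \<Prod>j<N. poly (q j) (x j))"
  and cube_integral_prod: "cube_integral N (\<lambda>x. \<Prod>j<N. poly (q j) (x j)) = (\<Prod>j<N. int01 (q j))"
proof -
  have e: "cubemap N (\<lambda>x. \<Prod>j<N. poly (q j) (x j)) = (\<lambda>x. \<Prod>j<N. indicator {0..1} (x j) * poly (q j) (x j))"
    by (auto simp: cubemap_def prod.distrib)
  show "cube_integrable N (\<lambda>x. \<Prod>j<N. poly (q j) (x j))" unfolding cube_integrable_def e
    by (intro lborel_prod.product_integrable_prod indicator_poly_lborel) auto
  show "cube_integral N (\<lambda>x. \<Prod>j<N. poly (q j) (x j)) = (\<Prod>j<N. int01 (q j))" unfolding cube_integral_def e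
    by (subst lborel_prod.product_integral_prod) (auto intro: indicator_poly_lborel simp: indicator_poly_lborel(2))
qed

lemma cube_integrable_leg_prod_leg_prod: "cube_integrable N (\<lambda>x. leg_prod N k x * leg_prod N l x)"
  and cube_integral_leg_prod_leg_prod: "cube_integral N (\<lambda>x. leg_prod N k x * leg_prod N l x) = (\<Prod>j<N. int01 (legp (k j) * legp (l j)))"
  using cube_integrable_prod[of N "\<lambda>j. legp (k j) * legp (l j)"] cube_integral_prod[of N "\<lambda>j. legp (k j) * legp (l j)"]
  by (simp_all add: leg_prod_def prod.distrib)

lemma cube_integrable_leg_prod_leg_span: assumes "leg_span N G" shows "cube_integrable N (\<lambda>x. leg_prod N k x * G x)"
proof -
  obtain S c where "finite S" "\<forall>x. G x = (\<Sum>k\<in>S. c k * leg_prod N k x)" using assms unfolding leg_span_def by blast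
  then have "(\<lambda>x. leg_prod N k x * G x) = (\<lambda>x. \<Sum>l\<in>S. c l * (leg_prod N k x * leg_prod N l x))"
    by (simp add: sum_distrib_left fun_eq_iff algebra_simps)
  then show ?thesis by (simp only:) (intro cube_integrable_sum cube_integrable_scale cube_integrable_leg_prod_leg_prod)
qed

lemma cube_integrable_leg_span: assumes "leg_span N F" "leg_span N G" shows "cube_integrable N (\<lambda>x. F x * G x)"
proof -
  obtain S c where "finite S" "\<forall>x. F x = (\<Sum>k\<in>S. c k * leg_prod N k x)" using assms unfolding leg_span_def by blast
  then have "(\<lambda>x. F x * G x) = (\<lambda>x. \<Sum>l\<in>S. c l * (leg_prod N l x * G x))"
    by (simp add: sum_distrib_right fun_eq_iff mult.assoc)
  then show ?thesis by (simp only:) (intro cube_integrable_sum cube_integrable_scale cube_integrable_leg_prod_leg_span assms)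
qed

text \<open>Up to sign, the eigenvalue of \<open>leg_prod N k\<close> under the sum of the Legendre
  operators in all coordinates.\<close>

definition lam :: "nat \<Rightarrow> (nat \<Rightarrow> nat) \<Rightarrow> real" where
  "lam N k = (\<Sum>j<N. real (k j) * (real (k j) + 1))"

lemma lam_perm: "\<sigma> permutes {..<N} \<Longrightarrow> lam N \<sigma> = lam N id"
  unfolding lam_def using sum.permute[of \<sigma> "{..<N}" "\<lambda>j. real j * (real j + 1)"] by (simp add: o_def)

text \<open>Every term of \<open>vdm_expand\<close> has the value \<open>lam N id\<close>. An index
  family with another value differs from each permutation at some coordinate below \<open>N\<close>,
  and the factor there is 0 by orthogonality.\<close>

lemma cube_integral_leg_prod_vdm:
  assumes "lam N k \<noteq> lam N id"
  shows "cube_integral N (\<lambda>x. leg_prod N k x * vdm N x) = 0"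
proof -
  have e: "(\<lambda>x. leg_prod N k x * vdm N x) = (\<lambda>x. \<Sum>\<sigma> | \<sigma> permutes {..<N}. of_int (sign \<sigma>) * (leg_prod N k x * leg_prod N \<sigma> x))"
    by (simp add: vdm_expand sum_distrib_left fun_eq_iff mult.left_commute)
  have "cube_integral N (\<lambda>x. leg_prod N k x * leg_prod N \<sigma> x) = 0" if "\<sigma> permutes {..<N}" for \<sigma>
  proof -
    have "\<exists>j<N. k j \<noteq> \<sigma> j" using assms lam_perm[OF that] unfolding lam_def by (metis (no_types, lifting) lessThan_iff sum.cong)
    then show ?thesis unfolding cube_integral_leg_prod_leg_prod by (auto simp: int01_legp_legp)
  qed
  then show ?thesis unfolding e by (subst cube_integral_sum) (auto simp: cube_integral_scale intro!: cube_integrable_scale cube_integrable_leg_prod_leg_prod)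
qed

definition vnorm :: "nat \<Rightarrow> real" where
  "vnorm N = cube_integral N (\<lambda>x. vdm N x * vdm N x)"

text \<open>Two permutations contribute only if they coincide, and each of the \<open>fact N\<close>
  diagonal terms is the same product of squared norms.\<close>

lemma vnorm_eq: "vnorm N = fact N * (\<Prod>j<N. 1 / (2 * real j + 1))"
proof -
  have e: "(\<lambda>x. vdm N x * vdm N x) = (\<lambda>x. \<Sum>\<tau> | \<tau> permutes {..<N}. of_int (sign \<tau>) * (\<Sum>\<sigma> | \<sigma> permutes {..<N}. of_int (sign \<sigma>) * (leg_prod N \<tau> x * leg_prod N \<sigma> x)))"
    by (simp add: vdm_expand sum_distrib_left sum_distrib_right fun_eq_iff mult_ac)
  have o: "cube_integral N (\<lambda>x. leg_prod N \<tau> x * leg_prod N \<sigma> x) = (if \<tau> = \<sigma> then (\<Prod>j<N. 1 / (2 * real j + 1)) else 0)"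
    if "\<sigma> permutes {..<N}" "\<tau> permutes {..<N}" for \<sigma> \<tau>
  proof (cases "\<tau> = \<sigma>")
    case True
    have "(\<Prod>j<N. 1 / (2 * real (\<sigma> j) + 1)) = (\<Prod>j<N. 1 / (2 * real j + 1))"
      using prod.permute[OF that(1), of "\<lambda>j. 1 / (2 * real j + 1)"] by (simp add: o_def)
    then show ?thesis using True unfolding cube_integral_leg_prod_leg_prod by (simp add: int01_legp_legp)
  next
    case False
    then obtain j where "\<tau> j \<noteq> \<sigma> j" by (auto simp: fun_eq_iff)
    moreover from this have "j < N" using that by (metis lessThan_iff permutes_not_in)
    ultimately show ?thesis using False unfolding cube_integral_leg_prod_leg_prod by (auto simp: int01_legp_legp)
  qed
  have "vnorm N = (\<Sum>\<tau> | \<tau> permutes {..<N}. of_int (sign \<tau>) * (\<Sum>\<sigma> | \<sigma> permutes {..<N}. of_int (sign \<sigma>) * cube_integral N (\<lambda>x. leg_prod N \<tau> x * leg_prod N \<sigma> x)))"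
    unfolding vnorm_def e
    by (subst cube_integral_sum; (subst cube_integral_scale)?; (subst cube_integral_sum)?) (auto simp: cube_integral_scale intro!: cube_integrable_sum cube_integrable_scale cube_integrable_leg_prod_leg_prod)
  also have "\<dots> = (\<Sum>\<tau> | \<tau> permutes {..<N}. (\<Prod>j<N. 1 / (2 * real j + 1)))"
  proof (rule sum.cong)
    fix \<tau> assume t: "\<tau> \<in> {\<tau>. \<tau> permutes {..<N}}"
    have "(\<Sum>\<sigma> | \<sigma> permutes {..<N}. of_int (sign \<sigma>) * cube_integral N (\<lambda>x. leg_prod N \<tau> x * leg_prod N \<sigma> x))
      = (\<Sum>\<sigma> | \<sigma> permutes {..<N}. if \<tau> = \<sigma> then of_int (sign \<sigma>) * (\<Prod>j<N. 1 / (2 * real j + 1)) else 0)"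
      using t by (intro sum.cong) (auto simp: o)
    also have "\<dots> = of_int (sign \<tau>) * (\<Prod>j<N. 1 / (2 * real j + 1))"
      using t by (simp add: finite_perms)
    finally show "of_int (sign \<tau>) * (\<Sum>\<sigma> | \<sigma> permutes {..<N}. of_int (sign \<sigma>) * cube_integral N (\<lambda>x. leg_prod N \<tau> x * leg_prod N \<sigma> x))
       = (\<Prod>j<N. 1 / (2 * real j + 1))" by (simp add: sign_def)
  qed simp
  also have "\<dots> = fact N * (\<Prod>j<N. 1 / (2 * real j + 1))"
    by (simp add: card_permutations)
  finally show ?thesis .
qed

lemma vnorm_pos: "vnorm N > 0"
  unfolding vnorm_eq by (intro mult_pos_pos prod_pos) auto

lemma vdm_nz: "\<exists>y. vdm N y \<noteq> 0"
proof (rule ccontr)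
  assume "\<not> ?thesis"
  then have "(\<lambda>x. vdm N x * vdm N x) = (\<lambda>x. 0 * 1)" by auto
  then have "vnorm N = 0 * cube_integral N (\<lambda>x. 1)" unfolding vnorm_def by (simp only: cube_integral_scale)
  then show False using vnorm_pos[of N] by simp
qed

text \<open>The values outside \<open>{..<N}\<close> exceed N - 1 and replace equally many missing
  ones, each at most N - 1; so any exchange strictly increases the sum of j (j + 1). This confines
  the eigenvalue 0 to constants.\<close>

lemma lam_minimal:
  assumes inj: "inj_on k {..<N}" and eq: "lam N k = lam N id"
  shows "k ` {..<N} = {..<N}"
proof (rule ccontr)
  let ?f = "\<lambda>j. real j * (real j + 1)"
  have mono: "?f a < ?f b" if "a < b" for a b using that by (intro mult_strict_mono) auto
  let ?A = "k ` {..<N}" and ?I = "{..<N}"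
  assume ne: "?A \<noteq> ?I"
  have card: "card ?A = card ?I" using inj by (simp add: card_image)
  have "card (?A - ?I) = card (?I - ?A)"
    using card card_Un_Int[of ?A ?I] by (simp add: card_Diff_subset_Int Int_commute)
  moreover have ne': "?A - ?I \<noteq> {}" using ne card by (metis Diff_eq_empty_iff card_subset_eq finite_lessThan)
  ultimately have c: "card (?A - ?I) = card (?I - ?A)" "card (?A - ?I) > 0"
    by (blast, subst card_gt_0_iff, use ne' in simp)
  have N: "N > 0" using c by (auto simp: card_gt_0_iff)
  have "sum ?f (?I - ?A) \<le> (\<Sum>j\<in>?I - ?A. ?f (N - 1))"
  proof (intro sum_mono)
    fix j assume "j \<in> ?I - ?A"
    then have "j \<le> N - 1" by auto
    then show "?f j \<le> ?f (N - 1)" by (intro mult_mono) auto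
  qed
  also have "\<dots> = (\<Sum>j\<in>?A - ?I. ?f (N - 1))" by (simp only: sum_constant c(1))
  also have "\<dots> < sum ?f (?A - ?I)"
  proof (rule sum_strict_mono)
    show "?A - ?I \<noteq> {}" by (rule ne')
    fix x assume "x \<in> ?A - ?I"
    then have "N - 1 < x" using N by auto
    then show "?f (N - 1) < ?f x" by (rule mono)
  qed simp
  finally have "sum ?f (?I - ?A) < sum ?f (?A - ?I)" .
  moreover have "sum ?f ?A = sum ?f (?A - ?I) + sum ?f (?A \<inter> ?I)" "sum ?f ?I = sum ?f (?I - ?A) + sum ?f (?I \<inter> ?A)"
    by (subst sum.union_disjoint[symmetric]; auto intro!: sum.cong)+
  moreover have "sum ?f ?A = lam N k" "sum ?f ?I = lam N id"
    unfolding lam_def by (simp_all add: sum.reindex[OF inj] o_def)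
  ultimately show False using eq by (simp add: Int_commute)
qed

lemma altp_lam:
  assumes "lam N k = lam N id"
  shows "\<exists>r. \<forall>x. altp N k x = r * vdm N x"
proof (cases "inj_on k {..<N}")
  case False
  then show ?thesis by (intro exI[of _ 0]) (simp add: altp_noninj)
next
  case True
  \<comment> \<open>Only the values below \<open>N\<close> matter; continuing them by the identity
    gives a permutation in the sense of \<open>permutes\<close>.\<close>
  define \<sigma> where "\<sigma> = (\<lambda>j. if j < N then k j else j)"
  have "bij_betw k {..<N} {..<N}" using True lam_minimal[OF True assms] by (auto simp: bij_betw_def)
  then have "bij_betw \<sigma> {..<N} {..<N}" by (rule bij_betw_cong[THEN iffD1, rotated]) (simp add: \<sigma>_def)
  then have s: "\<sigma> permutes {..<N}" by (rule bij_imp_permutes) (simp add: \<sigma>_def)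
  have "leg_prod N k x = leg_prod N (id \<circ> \<sigma>) x" for x unfolding leg_prod_def by (intro prod.cong) (auto simp: \<sigma>_def)
  then have "altp N k x = altp N (id \<circ> \<sigma>) x" for x unfolding altp_def by simp
  then show ?thesis by (intro exI[of _ "of_int (sign \<sigma>)"] allI) (simp only: altp_perm_index[OF s])
qed

subsection \<open>The radial Laplacian\<close>

definition Dp :: "real poly \<Rightarrow> real poly" where
  "Dp q = pderiv ([:0, 1, -1:] * pderiv q)"

lemma Dp_add: "Dp (p + q) = Dp p + Dp q"
  by (simp add: Dp_def pderiv_add distrib_left del: mult_pCons_left)

lemma Dp_smult: "Dp (smult c q) = smult c (Dp q)"
  by (simp add: Dp_def pderiv_smult mult_smult_right del: mult_pCons_left)

lemma Dp_sum: "Dp (\<Sum>i\<in>A. q i) = (\<Sum>i\<in>A. Dp (q i))"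
  by (induction A rule: infinite_finite_induct) (auto simp: Dp_add, simp_all add: Dp_def)

lemma Dp_mult:
  "Dp (g * p) = g * Dp p + pderiv ([:0, 1, -1:] * pderiv g) * p + 2 * ([:0, 1, -1:] * pderiv g) * pderiv p"
proof -
  have "pderiv (w * pderiv (g * p)) = g * pderiv (w * pderiv p) + pderiv (w * pderiv g) * p + 2 * (w * pderiv g) * pderiv p" for w
    by (simp add: pderiv_mult pderiv_add algebra_simps)
  then show ?thesis unfolding Dp_def .
qed

lemma Dp_legp: "Dp (legp n) = smult (- (real n * (real n + 1))) (legp n)"
  unfolding Dp_def by (rule legp_ode)

text \<open>With all coordinates but the i-th frozen at x, a Legendre product is a polynomial in one
  variable. Such slices, here and in \<open>vslice\<close> and \<open>pslice\<close>, replace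
  partial derivatives by \<open>pderiv\<close>.\<close>

definition eslice :: "nat \<Rightarrow> (nat \<Rightarrow> nat) \<Rightarrow> (nat \<Rightarrow> real) \<Rightarrow> nat \<Rightarrow> real poly" where
  "eslice N k x i = smult (\<Prod>j\<in>{..<N} - {i}. poly (legp (k j)) (x j)) (legp (k i))"

lemma poly_eslice: "i < N \<Longrightarrow> poly (eslice N k x i) s = leg_prod N k (x(i := s))"
  unfolding leg_prod_def eslice_def by (subst prod.remove[of "{..<N}" i]) (auto simp: mult.commute intro!: prod.cong)

lemma Dp_eslice: "Dp (eslice N k x i) = smult (- (real (k i) * (real (k i) + 1))) (eslice N k x i)"
  unfolding eslice_def Dp_smult by (simp add: Dp_legp mult.commute)

definition vslice :: "nat \<Rightarrow> (nat \<Rightarrow> real) \<Rightarrow> nat \<Rightarrow> real poly" where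
  "vslice N x i = (\<Sum>\<sigma> | \<sigma> permutes {..<N}. smult (of_int (sign \<sigma>)) (eslice N \<sigma> x i))"

lemma poly_vslice: "i < N \<Longrightarrow> poly (vslice N x i) s = vdm N (x(i := s))"
  by (simp add: vslice_def vdm_expand poly_sum poly_eslice)

lemma poly_vslice_self: "i < N \<Longrightarrow> poly (vslice N x i) (x i) = vdm N x"
  by (simp add: poly_vslice)

text \<open>Each Legendre product in \<open>vdm_expand\<close> is an eigenfunction in every
  coordinate, and permuting the indices does not change the sum of the eigenvalues.\<close>

lemma Dp_vslice_sum: "(\<Sum>i<N. poly (Dp (vslice N x i)) (x i)) = - lam N id * vdm N x"
proof -
  have "(\<Sum>i<N. poly (Dp (vslice N x i)) (x i))
    = (\<Sum>i<N. \<Sum>\<sigma> | \<sigma> permutes {..<N}. of_int (sign \<sigma>) * (- (real (\<sigma> i) * (real (\<sigma> i) + 1)) * leg_prod N \<sigma> x))"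
    unfolding vslice_def Dp_sum Dp_smult Dp_eslice by (auto intro!: sum.cong simp: poly_sum poly_eslice)
  also have "\<dots> = (\<Sum>\<sigma> | \<sigma> permutes {..<N}. \<Sum>i<N. of_int (sign \<sigma>) * (- (real (\<sigma> i) * (real (\<sigma> i) + 1)) * leg_prod N \<sigma> x))"
    by (rule sum.swap)
  also have "\<dots> = (\<Sum>\<sigma> | \<sigma> permutes {..<N}. of_int (sign \<sigma>) * (- lam N \<sigma> * leg_prod N \<sigma> x))"
    unfolding lam_def by (simp only: sum_distrib_left sum_distrib_right sum_negf[symmetric])
  also have "\<dots> = (\<Sum>\<sigma> | \<sigma> permutes {..<N}. - lam N id * (of_int (sign \<sigma>) * leg_prod N \<sigma> x))"
    by (rule sum.cong[OF refl]) (drule CollectD, drule lam_perm, simp)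
  also have "\<dots> = - lam N id * vdm N x"
    by (simp add: vdm_expand sum_distrib_left)
  finally show ?thesis .
qed

lemma poly_factor_roots:
  fixes p :: "real poly"
  assumes "finite J" "inj_on x J" "degree p \<le> card J" "\<And>j. j \<in> J \<Longrightarrow> poly p (x j) = 0"
  shows "\<exists>c. p = smult c (\<Prod>j\<in>J. [:- x j, 1:])"
  using assms
proof (induction J arbitrary: p rule: finite_induct)
  case empty
  then show ?case by (auto elim!: degree_eq_zeroE)
next
  case (insert a J)
  from insert.prems have "[:- x a, 1:] dvd p" by (simp add: poly_eq_0_iff_dvd)
  then obtain q where q: "p = [:- x a, 1:] * q" by (auto elim: dvdE)
  have "degree q \<le> card J"
  proof (cases "q = 0")
    case False
    then have "degree p = Suc (degree q)" unfolding q by (subst degree_mult_eq) auto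
    then show ?thesis using insert by simp
  qed simp
  moreover have "poly q (x j) = 0" if "j \<in> J" for j
  proof -
    have "x j \<noteq> x a" using insert that by (auto simp: inj_on_def)
    then show ?thesis using insert.prems(3)[of j] that unfolding q by auto
  qed
  ultimately obtain c where "q = smult c (\<Prod>j\<in>J. [:- x j, 1:])"
    using insert.IH[of q] insert.prems(1) by auto
  then show ?case unfolding q using insert(1,2) by (intro exI[of _ c]) simp
qed

definition rsum :: "nat \<Rightarrow> (nat \<Rightarrow> real) \<Rightarrow> nat \<Rightarrow> real" where
  "rsum N x i = (\<Sum>j\<in>{..<N} - {i}. 1 / (x i - x j))"

text \<open>Logarithmic derivative of the Vandermonde determinant. In the i-th variable it has
  degree at most N - 1 and vanishes at the other N - 1 coordinates, so it is a constant times the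
  product of the linear factors.\<close>

lemma pderiv_vslice:
  assumes inj: "inj_on x {..<N}" and i: "i < N"
  shows "poly (pderiv (vslice N x i)) (x i) = vdm N x * rsum N x i"
proof -
  let ?J = "{..<N} - {i}"
  have "degree (vslice N x i) \<le> N - 1" unfolding vslice_def
  proof (intro degree_sum_le)
    show "finite {\<sigma>. \<sigma> permutes {..<N}}" by (rule finite_perms)
    fix \<sigma> assume "\<sigma> \<in> {\<sigma>. \<sigma> permutes {..<N}}"
    then have "\<sigma> i < N" using i permutes_in_image[of \<sigma> "{..<N}" i] by simp
    moreover have "degree (smult (of_int (sign \<sigma>)) (eslice N \<sigma> x i)) \<le> degree (legp (\<sigma> i))"
      unfolding eslice_def by (intro order_trans[OF degree_smult_le]) simp
    ultimately show "degree (smult (of_int (sign \<sigma>)) (eslice N \<sigma> x i)) \<le> N - 1"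
      using degree_legp[of "\<sigma> i"] by linarith
  qed
  moreover have "poly (vslice N x i) (x j) = 0" if "j \<in> ?J" for j
    using that i by (subst poly_vslice) (auto intro!: vdm_noninj[of i N j])
  ultimately obtain c where c: "vslice N x i = smult c (\<Prod>j\<in>?J. [:- x j, 1:])"
    using poly_factor_roots[of ?J x "vslice N x i"] inj_on_subset[OF inj, of ?J] i by auto
  have v: "vdm N x = c * (\<Prod>j\<in>?J. (x i - x j))"
    using poly_vslice_self[OF i, of x] by (simp add: c poly_prod)
  have "poly (pderiv (vslice N x i)) (x i) = c * (\<Sum>a\<in>?J. \<Prod>j\<in>?J - {a}. (x i - x j))"
    by (simp add: c pderiv_smult pderiv_prod poly_sum poly_prod pderiv_pCons)
  also have "\<dots> = c * (\<Sum>a\<in>?J. (\<Prod>j\<in>?J. (x i - x j)) * (1 / (x i - x a)))"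
  proof (intro arg_cong[where f = "\<lambda>t. c * t"] sum.cong refl)
    fix a assume a: "a \<in> ?J"
    then have "x i - x a \<noteq> 0" using inj i by (auto simp: inj_on_def)
    then show "(\<Prod>j\<in>?J - {a}. (x i - x j)) = (\<Prod>j\<in>?J. (x i - x j)) * (1 / (x i - x a))"
      using prod.remove[of ?J a "\<lambda>j. x i - x j"] a by (simp add: field_simps)
  qed
  also have "\<dots> = vdm N x * rsum N x i"
    by (simp add: v rsum_def sum_distrib_left mult.assoc)
  finally show ?thesis .
qed

text \<open>Divergence with respect to the weight vdm^2: by \<open>pderiv_vslice\<close>, twice
  \<open>rsum\<close> is the i-th logarithmic derivative of vdm^2. The i-th component of the field
  is given by its slice in the i-th variable.\<close>

definition xdiv :: "nat \<Rightarrow> (nat \<Rightarrow> real) \<Rightarrow> (nat \<Rightarrow> real poly) \<Rightarrow> real" where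
  "xdiv N x v = (\<Sum>i<N. poly (pderiv (v i)) (x i) + 2 * poly (v i) (x i) * rsum N x i)"

lemma xdiv_add: "xdiv N x (\<lambda>i. u i + v i) = xdiv N x u + xdiv N x v"
  by (simp add: xdiv_def pderiv_add algebra_simps sum.distrib)

lemma xdiv_smult: "xdiv N x (\<lambda>i. smult c (v i)) = c * xdiv N x v"
  by (simp add: xdiv_def pderiv_smult algebra_simps sum_distrib_left sum.distrib)

lemma xdiv_cong: "(\<And>i. i < N \<Longrightarrow> u i = v i) \<Longrightarrow> xdiv N x u = xdiv N x v"
  by (simp add: xdiv_def)

definition pslice :: "nat \<Rightarrow> (nat \<Rightarrow> real) \<Rightarrow> nat list \<Rightarrow> nat \<Rightarrow> real poly" where
  "pslice N x as i = (\<Prod>a\<leftarrow>as. monom 1 a + [:\<Sum>j\<in>{..<N} - {i}. x j ^ a:])"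

lemma pslice_simps [simp]:
  "pslice N x [] i = 1"
  "pslice N x (a # as) i = (monom 1 a + [:\<Sum>j\<in>{..<N} - {i}. x j ^ a:]) * pslice N x as i"
  "pslice N x (as @ bs) i = pslice N x as i * pslice N x bs i"
  by (simp_all add: pslice_def)

lemma poly_psum_slice: "i < N \<Longrightarrow> poly (monom 1 a + [:\<Sum>j\<in>{..<N} - {i}. x j ^ a:]) s = psum N a (x(i := s))"
  unfolding psum_def by (subst (2) sum.remove[of _ i]) (auto simp: poly_monom intro!: sum.cong)

lemma poly_pslice: "i < N \<Longrightarrow> poly (pslice N x as i) s = pprod N as (x(i := s))"
proof (induction as)
  case (Cons a as)
  then show ?case using poly_psum_slice[of i N a x s] by (simp del: poly_add fun_upd_apply)
qed simp

lemma poly_pslice_self: "i < N \<Longrightarrow> poly (pslice N x as i) (x i) = pprod N as x"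
  by (simp add: poly_pslice)

text \<open>Pairing (i, j) with (j, i) turns the fractions into (x_i^k - x_j^k) / (x_i - x_j), a sum
  of monomials; the terms k x_i^(k - 1) are the values of that sum at i = j.\<close>

lemma monom_rsum:
  assumes "inj_on x {..<N}"
  shows "(\<Sum>i<N. real k * x i ^ (k - 1) + 2 * x i ^ k * rsum N x i) = (\<Sum>m<k. psum N m x * psum N (k - 1 - m) x)"
proof -
  let ?h = "\<lambda>i j. \<Sum>m<k. x i ^ m * x j ^ (k - 1 - m)"
  have dq: "(x i ^ k - x j ^ k) * (1 / (x i - x j)) = ?h i j" if "i < N" "j < N" "i \<noteq> j" for i j
  proof (cases k)
    case (Suc n)
    have "x i - x j \<noteq> 0" using that assms by (auto simp: inj_on_def)
    then show ?thesis unfolding Suc diff_power_eq_sum by simp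
  qed simp
  have dg: "?h i i = real k * x i ^ (k - 1)" for i
  proof -
    have "?h i i = (\<Sum>m<k. x i ^ (k - 1))"
      by (intro sum.cong) (auto simp: power_add[symmetric])
    then show ?thesis by simp
  qed
  let ?O = "SIGMA i:{..<N}. {..<N} - {i}"
  have sw: "(\<Sum>i<N. \<Sum>j\<in>{..<N} - {i}. g i j) = (\<Sum>i<N. \<Sum>j\<in>{..<N} - {i}. g j i)" for g :: "nat \<Rightarrow> nat \<Rightarrow> real"
  proof -
    have "(\<Sum>i<N. \<Sum>j\<in>{..<N} - {i}. g i j) = (\<Sum>i<N. \<Sum>j<N. if j = i then 0 else g i j)"
      by (intro sum.cong refl sum.mono_neutral_cong_left) auto
    also have "\<dots> = (\<Sum>j<N. \<Sum>i<N. if j = i then 0 else g i j)" by (rule sum.swap)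
    also have "\<dots> = (\<Sum>j<N. \<Sum>i\<in>{..<N} - {j}. g i j)"
      by (intro sum.cong refl sum.mono_neutral_cong_right) auto
    finally show ?thesis .
  qed
  have "(\<Sum>i<N. 2 * x i ^ k * rsum N x i) = (\<Sum>i<N. \<Sum>j\<in>{..<N} - {i}. x i ^ k * (1 / (x i - x j))) + (\<Sum>i<N. \<Sum>j\<in>{..<N} - {i}. x i ^ k * (1 / (x i - x j)))"
    by (simp add: rsum_def sum_distrib_left sum.distrib[symmetric])
  also have "(\<Sum>i<N. \<Sum>j\<in>{..<N} - {i}. x i ^ k * (1 / (x i - x j))) + (\<Sum>i<N. \<Sum>j\<in>{..<N} - {i}. x i ^ k * (1 / (x i - x j)))
     = (\<Sum>i<N. \<Sum>j\<in>{..<N} - {i}. x i ^ k * (1 / (x i - x j))) + (\<Sum>i<N. \<Sum>j\<in>{..<N} - {i}. x j ^ k * (1 / (x j - x i)))"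
    by (subst (2) sw) simp
  also have "\<dots> = (\<Sum>i<N. \<Sum>j\<in>{..<N} - {i}. ?h i j)"
    unfolding sum.distrib[symmetric]
  proof (intro sum.cong refl)
    fix i j assume ij: "i \<in> {..<N}" "j \<in> {..<N} - {i}"
    have "1 / (x j - x i) = - (1 / (x i - x j))" using minus_divide_right[of 1 "x i - x j"] by simp
    then show "x i ^ k * (1 / (x i - x j)) + x j ^ k * (1 / (x j - x i)) = ?h i j"
      using dq[of i j] ij by (simp only: left_diff_distrib) auto
  qed
  finally have "(\<Sum>i<N. real k * x i ^ (k - 1) + 2 * x i ^ k * rsum N x i)
     = (\<Sum>i<N. ?h i i + (\<Sum>j\<in>{..<N} - {i}. ?h i j))"
    unfolding dg by (simp only: sum.distrib)
  also have "\<dots> = (\<Sum>i<N. \<Sum>j<N. ?h i j)"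
    by (intro sum.cong refl) (simp add: sum.remove)
  also have "\<dots> = (\<Sum>i<N. \<Sum>m<k. \<Sum>j<N. x i ^ m * x j ^ (k - 1 - m))"
    by (intro sum.cong refl sum.swap)
  also have "\<dots> = (\<Sum>m<k. \<Sum>i<N. \<Sum>j<N. x i ^ m * x j ^ (k - 1 - m))"
    by (rule sum.swap)
  also have "\<dots> = (\<Sum>m<k. psum N m x * psum N (k - 1 - m) x)"
    by (simp add: psum_def sum_product)
  finally show ?thesis .
qed

text \<open>For k >= 1 the component x_i^k (1 - x_i) vanishes at both ends of [0, 1], so integration
  by parts against vdm^2 predicts mean 0 for this divergence. The quadratic sums come from
  \<open>monom_rsum\<close> at k and k + 1, the \<open>ldot\<close> part from differentiating the
  word.\<close>

lemma xdiv_loopf: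
  assumes "inj_on x {..<N}" "k \<ge> 1"
  shows "xdiv N x (\<lambda>i. (monom 1 k - monom 1 (Suc k)) * pslice N x as i) = loopf N k as x"
proof -
  let ?v = "monom 1 k - monom 1 (Suc k) :: real poly"
  let ?b = "\<lambda>a. real a * (psum N (k + a - 1) x - psum N (k + a) x)"
  have L: "(\<Sum>i<N. poly ?v (x i) * poly (pderiv (pslice N x as i)) (x i)) = ldot N ?b as x"
  proof (induction as)
    case (Cons a as)
    have p: "poly (monom 1 a + [:\<Sum>j\<in>{..<N} - {i}. x j ^ a:]) (x i) = psum N a x" if "i < N" for i
      using poly_psum_slice[OF that, of a x "x i"] by simp
    have "(\<Sum>i<N. poly ?v (x i) * poly (pderiv (pslice N x (a # as) i)) (x i))
       = (\<Sum>i<N. pprod N as x * (real a * (x i ^ (k + a - 1) - x i ^ (k + a)))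
            + psum N a x * (poly ?v (x i) * poly (pderiv (pslice N x as i)) (x i)))"
    proof (intro sum.cong refl)
      fix i assume "i \<in> {..<N}"
      then have i: "i < N" by simp
      have m: "real a * ((x i ^ k - x i ^ Suc k) * x i ^ (a - 1)) = real a * (x i ^ (k + a - 1) - x i ^ (k + a))"
        by (cases a) (simp_all add: power_add algebra_simps)
      define M :: "real poly" where "M = monom 1 a + [:\<Sum>j\<in>{..<N} - {i}. x j ^ a:]"
      have M: "poly M (x i) = psum N a x" "poly (pderiv M) (x i) = real a * x i ^ (a - 1)"
        unfolding M_def by (rule p[OF i]) (simp add: pderiv_add pderiv_monom poly_monom pderiv_pCons)
      have "poly (pderiv (M * pslice N x as i)) (x i)
         = psum N a x * poly (pderiv (pslice N x as i)) (x i) + pprod N as x * (real a * x i ^ (a - 1))"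
        unfolding pderiv_mult poly_add poly_mult M poly_pslice_self[OF i] ..
      then have "poly (pderiv (pslice N x (a # as) i)) (x i)
         = psum N a x * poly (pderiv (pslice N x as i)) (x i) + pprod N as x * (real a * x i ^ (a - 1))"
        unfolding M_def pslice_simps .
      then show "poly ?v (x i) * poly (pderiv (pslice N x (a # as) i)) (x i)
         = pprod N as x * (real a * (x i ^ (k + a - 1) - x i ^ (k + a)))
            + psum N a x * (poly ?v (x i) * poly (pderiv (pslice N x as i)) (x i))"
        unfolding m[symmetric] by (simp add: poly_monom algebra_simps)
    qed
    also have "\<dots> = pprod N as x * ?b a + psum N a x * ldot N ?b as x"
      unfolding Cons.IH[symmetric] by (simp add: sum.distrib sum_distrib_left[symmetric] psum_def sum_subtractf)
    finally show ?case by simp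
  qed simp
  have mono: "(\<Sum>i<N. poly (pderiv (monom 1 l)) (x i) + 2 * poly (monom 1 l) (x i) * rsum N x i)
      = (\<Sum>m<l. psum N m x * psum N (l - 1 - m) x)" for l
    using monom_rsum[OF assms(1), of l] by (simp add: pderiv_monom poly_monom)
  have "xdiv N x (\<lambda>i. ?v * pslice N x as i)
    = (\<Sum>i<N. pprod N as x * (poly (pderiv (monom 1 k)) (x i) + 2 * poly (monom 1 k) (x i) * rsum N x i)
       - pprod N as x * (poly (pderiv (monom 1 (Suc k))) (x i) + 2 * poly (monom 1 (Suc k)) (x i) * rsum N x i)
       + poly ?v (x i) * poly (pderiv (pslice N x as i)) (x i))"
    unfolding xdiv_def
  proof (intro sum.cong refl)
    fix i assume "i \<in> {..<N}"
    then have i: "i < N" by simp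
    show "poly (pderiv (?v * pslice N x as i)) (x i) + 2 * poly (?v * pslice N x as i) (x i) * rsum N x i
      = pprod N as x * (poly (pderiv (monom 1 k)) (x i) + 2 * poly (monom 1 k) (x i) * rsum N x i)
       - pprod N as x * (poly (pderiv (monom 1 (Suc k))) (x i) + 2 * poly (monom 1 (Suc k)) (x i) * rsum N x i)
       + poly ?v (x i) * poly (pderiv (pslice N x as i)) (x i)"
      unfolding pderiv_mult poly_add poly_mult poly_pslice_self[OF i] pderiv_diff poly_diff
      by (simp add: algebra_simps)
  qed
  also have "\<dots> = loopf N k as x"
    unfolding sum.distrib[of _ "\<lambda>i. poly ?v (x i) * poly (pderiv (pslice N x as i)) (x i)"] L sum_subtractf
      sum_distrib_left[symmetric] mono loopf_def
    by (simp add: algebra_simps)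
  finally show ?thesis .
qed

text \<open>Leibniz rule along the word: x (1 - x) times the derivative of x^a is a (x^a - x^(a +
  1)), the field of \<open>xdiv_loopf\<close>. Factors already passed are collected in
  \<open>pre\<close>.\<close>

lemma xdiv_lapf:
  assumes "inj_on x {..<N}"
  shows "xdiv N x (\<lambda>i. [:0, 1, -1:] * (pslice N x pre i * pderiv (pslice N x as i))) = lapf N pre as x"
proof (induction as arbitrary: pre)
  case Nil
  then show ?case by (simp add: xdiv_def)
next
  case (Cons a as)
  have "[:0, 1, -1:] * (pslice N x pre i * pderiv (pslice N x (a # as) i))
    = smult (real a) ((monom 1 a - monom 1 (Suc a)) * pslice N x (pre @ as) i)
      + [:0, 1, -1:] * (pslice N x (a # pre) i * pderiv (pslice N x as i))" for i
  proof -
    have sm: "smult (real a) (monom 1 a - monom 1 (Suc a)) = [:0, 1, -1:] * pderiv (monom 1 a :: real poly)"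
      by (cases a) (simp_all add: pderiv_monom smult_monom smult_diff_right monom_Suc[symmetric] algebra_simps,
          simp add: monom_Suc algebra_simps, simp add: add_monom)
    have m: "smult (real a) ((monom 1 a - monom 1 (Suc a)) * q) = [:0, 1, -1:] * pderiv (monom 1 a :: real poly) * q" for q
      by (simp only: mult_smult_left[symmetric] sm)
    show ?thesis unfolding m pslice_simps pderiv_mult
      by (simp add: pderiv_add pderiv_pCons algebra_simps del: mult_pCons_left mult_pCons_right)
  qed
  then have "xdiv N x (\<lambda>i. [:0, 1, -1:] * (pslice N x pre i * pderiv (pslice N x (a # as) i)))
    = real a * xdiv N x (\<lambda>i. (monom 1 a - monom 1 (Suc a)) * pslice N x (pre @ as) i)
      + xdiv N x (\<lambda>i. [:0, 1, -1:] * (pslice N x (a # pre) i * pderiv (pslice N x as i)))"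
    by (simp only: xdiv_add xdiv_smult)
  \<comment> \<open>For a = 0 the prefactor is 0; otherwise the index satisfies the bound in
    \<open>xdiv_loopf\<close>.\<close>
  also have "\<dots> = real a * loopf N a (pre @ as) x + lapf N (a # pre) as x"
    unfolding Cons.IH using xdiv_loopf[OF assms, of a "pre @ as"] by (cases "a = 0") auto
  finally show ?case by simp
qed

text \<open>Conjugation by the Vandermonde determinant: in \<open>Dp_mult\<close> the cross term
  becomes the \<open>rsum\<close> part of \<open>xdiv\<close>, and the operators falling on
  \<open>vdm\<close> alone sum to -\<open>lam N id\<close>. What remains is the radial Laplacian in
  divergence form.\<close>

lemma xdiv_Dp:
  assumes x: "inj_on x {..<N}" and g: "\<And>i. i < N \<Longrightarrow> poly (g i) (x i) = G"
  shows "(\<Sum>i<N. poly (Dp (g i * vslice N x i)) (x i))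
     = vdm N x * (xdiv N x (\<lambda>i. [:0, 1, -1:] * pderiv (g i)) - lam N id * G)"
proof -
  have "(\<Sum>i<N. poly (Dp (g i * vslice N x i)) (x i))
     = (\<Sum>i<N. G * poly (Dp (vslice N x i)) (x i)
        + vdm N x * (poly (pderiv ([:0, 1, -1:] * pderiv (g i))) (x i)
           + 2 * poly ([:0, 1, -1:] * pderiv (g i)) (x i) * rsum N x i))"
  proof (intro sum.cong refl)
    fix i assume "i \<in> {..<N}"
    then have i: "i < N" by simp
    show "poly (Dp (g i * vslice N x i)) (x i) = G * poly (Dp (vslice N x i)) (x i)
        + vdm N x * (poly (pderiv ([:0, 1, -1:] * pderiv (g i))) (x i)
           + 2 * poly ([:0, 1, -1:] * pderiv (g i)) (x i) * rsum N x i)"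
      unfolding Dp_mult poly_add poly_mult g[OF i] poly_vslice_self[OF i] pderiv_vslice[OF x i]
      by (simp add: algebra_simps del: mult_pCons_left)
  qed
  also have "\<dots> = G * (- lam N id * vdm N x) + vdm N x * xdiv N x (\<lambda>i. [:0, 1, -1:] * pderiv (g i))"
    unfolding sum.distrib sum_distrib_left[symmetric] Dp_vslice_sum xdiv_def ..
  finally show ?thesis by (simp add: algebra_simps)
qed

lemma symalg_perm: "G \<in> symalg N \<Longrightarrow> \<sigma> permutes {..<N} \<Longrightarrow> G (x \<circ> \<sigma>) = G x"
proof (induction G rule: symalg.induct)
  case (mono c as)
  have "psum N a (x \<circ> \<sigma>) = psum N a x" for a
    unfolding psum_def o_def using sum.permute[OF mono, of "\<lambda>i. x i ^ a"] by (simp add: o_def)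
  then show ?case by (simp only: pprod_def)
qed simp

text \<open>Antisymmetrize the expansion. The left side is already alternating and is multiplied by
  \<open>fact N\<close>; on the right each surviving product becomes an alternant, a multiple of
  \<open>vdm\<close> by \<open>altp_lam\<close>. Then cancel \<open>vdm\<close>.\<close>

lemma alternating_component:
  assumes "finite S" and G: "G \<in> symalg N"
    and eq: "\<And>x. G x * vdm N x = (\<Sum>k\<in>S. c k * leg_prod N k x)"
    and c: "\<And>k. k \<in> S \<Longrightarrow> lam N k \<noteq> lam N id \<Longrightarrow> c k = 0"
  shows "\<exists>r. \<forall>x. G x = r"
proof -
  have "\<exists>r. \<forall>x. c k * altp N k x = r * vdm N x" if "k \<in> S" for k
  proof (cases "lam N k = lam N id")
    case True
    then obtain r where "\<forall>x. altp N k x = r * vdm N x" using altp_lam by blast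
    then show ?thesis by (intro exI[of _ "c k * r"]) simp
  next
    case False
    then show ?thesis using c[OF that] by (intro exI[of _ 0]) simp
  qed
  then obtain r where r: "\<And>k x. k \<in> S \<Longrightarrow> c k * altp N k x = r k * vdm N x" by metis
  have "fact N * (G x * vdm N x) = (\<Sum>k\<in>S. r k) * vdm N x" for x
  proof -
    have "fact N * (G x * vdm N x) = (\<Sum>\<tau> | \<tau> permutes {..<N}. G x * vdm N x)"
      by (simp add: card_permutations)
    also have "\<dots> = (\<Sum>\<tau> | \<tau> permutes {..<N}. of_int (sign \<tau>) * (G (x \<circ> \<tau>) * vdm N (x \<circ> \<tau>)))"
      by (intro sum.cong refl) (auto simp: symalg_perm[OF G] altp_perm_arg sign_def)
    also have "\<dots> = (\<Sum>\<tau> | \<tau> permutes {..<N}. \<Sum>k\<in>S. c k * (of_int (sign \<tau>) * leg_prod N k (x \<circ> \<tau>)))"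
      by (intro sum.cong refl) (simp add: eq sum_distrib_left mult.left_commute)
    also have "\<dots> = (\<Sum>k\<in>S. \<Sum>\<tau> | \<tau> permutes {..<N}. c k * (of_int (sign \<tau>) * leg_prod N k (x \<circ> \<tau>)))"
      by (rule sum.swap)
    also have "\<dots> = (\<Sum>k\<in>S. c k * altp N k x)"
      by (simp add: altp_def sum_distrib_left)
    also have "\<dots> = (\<Sum>k\<in>S. r k * vdm N x)" by (intro sum.cong refl r)
    finally show ?thesis by (simp add: sum_distrib_right)
  qed
  then have z: "(G x + (- (\<Sum>k\<in>S. r k) / fact N)) * vdm N x = 0" for x
    by (simp add: field_simps)
  obtain y where y: "vdm N y \<noteq> 0" using vdm_nz by blast
  have "G x + (- (\<Sum>k\<in>S. r k) / fact N) = 0" for x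
    by (rule linepoly_cancel[OF _ linepoly_vdm z y]) (intro linepoly_add linepoly_const linepoly_symalg[OF G])
  then show ?thesis by (intro exI[of _ "(\<Sum>k\<in>S. r k) / fact N"]) (simp add: add_eq_0_iff)
qed

lemma symalg_slice:
  assumes "G \<in> symalg N"
  shows "\<exists>g. \<forall>i<N. \<forall>s. poly (g i) s = G (x(i := s))"
  using assms
proof (induction G rule: symalg.induct)
  case (mono c as)
  show ?case by (rule exI[of _ "\<lambda>i. smult c (pslice N x as i)"]) (simp add: poly_pslice del: fun_upd_apply)
next
  case (add G H)
  then obtain g h where "\<forall>i<N. \<forall>s. poly (g i) s = G (x(i := s))" "\<forall>i<N. \<forall>s. poly (h i) s = H (x(i := s))"
    by blast
  then show ?case by (intro exI[of _ "\<lambda>i. g i + h i"]) (simp del: fun_upd_apply)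
qed

text \<open>Linearity on symmetric polynomials, normalization and the loop equations are all that is
  retained of the Haar mean; its values are then forced by algebra.\<close>

locale loop_functional =
  fixes N :: nat and E :: "((nat \<Rightarrow> real) \<Rightarrow> real) \<Rightarrow> real"
  assumes E_add: "G \<in> symalg N \<Longrightarrow> H \<in> symalg N \<Longrightarrow> E (\<lambda>x. G x + H x) = E G + E H"
    and E_scale: "G \<in> symalg N \<Longrightarrow> E (\<lambda>x. r * G x) = r * E G"
    and E_one: "E (\<lambda>x. 1) = 1"
    and E_loop: "k \<ge> 1 \<Longrightarrow> E (loopf N k as) = 0"
begin

lemma E_lapf: "E (lapf N pre as) = 0"
proof (induction as arbitrary: pre)
  case Nil
  have e: "lapf N pre [] = (\<lambda>x. 0 * loopf N 1 [] x)" by (simp add: fun_eq_iff)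
  show ?case unfolding e E_scale[OF symalg_loopf] by simp
next
  case (Cons a as)
  have e: "lapf N pre (a # as) = (\<lambda>x. real a * loopf N a (pre @ as) x + lapf N (a # pre) as x)"
    by (simp add: fun_eq_iff)
  have eq: "E (lapf N pre (a # as)) = real a * E (loopf N a (pre @ as)) + E (lapf N (a # pre) as)"
    unfolding e by (subst E_add) (auto simp: E_scale symalg_loopf symalg_lapf symalg_scale)
  have "real a * E (loopf N a (pre @ as)) = 0" using E_loop[of a "pre @ as"] by (cases "a = 0") auto
  then show ?case unfolding eq Cons by simp
qed

text \<open>\<open>H\<close> is L G. Different words may give the same function, so instead of
  defining L as a map, \<open>H\<close> is found along the construction of \<open>G\<close> and
  characterized pointwise through slices, which \<open>G\<close> determines. The identity is
  asserted off the diagonals, where \<open>rsum\<close> makes sense.\<close>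

lemma laplacian_exists:
  assumes "G \<in> symalg N"
  shows "\<exists>H\<in>symalg N. E H = 0 \<and> (\<forall>x g. inj_on x {..<N} \<longrightarrow> (\<forall>i<N. \<forall>s. poly (g i) s = G (x(i := s))) \<longrightarrow>
      H x * vdm N x = (\<Sum>i<N. poly (Dp (g i * vslice N x i)) (x i)) + lam N id * (G x * vdm N x))"
  using assms
proof (induction G rule: symalg.induct)
  case (mono c as)
  show ?case
  proof (intro bexI[of _ "\<lambda>x. c * lapf N [] as x"] conjI allI impI)
    show "(\<lambda>x. c * lapf N [] as x) \<in> symalg N" by (intro symalg_scale symalg_lapf)
    show "E (\<lambda>x. c * lapf N [] as x) = 0" by (simp add: E_scale symalg_lapf E_lapf)
    fix x and g :: "nat \<Rightarrow> real poly"
    assume inj: "inj_on x {..<N}" and g: "\<forall>i<N. \<forall>s. poly (g i) s = c * pprod N as (x(i := s))"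
    have gs: "g i = smult c (pslice N x as i)" if "i < N" for i
      using g that by (intro poly_ext) (simp add: poly_pslice)
    have "xdiv N x (\<lambda>i. [:0, 1, -1:] * pderiv (g i)) = xdiv N x (\<lambda>i. smult c ([:0, 1, -1:] * (pslice N x [] i * pderiv (pslice N x as i))))"
      by (intro xdiv_cong) (simp add: gs pderiv_smult del: mult_pCons_left)
    also have "\<dots> = c * lapf N [] as x" unfolding xdiv_smult xdiv_lapf[OF inj] ..
    finally have xd: "xdiv N x (\<lambda>i. [:0, 1, -1:] * pderiv (g i)) = c * lapf N [] as x" .
    have "poly (g i) (x i) = c * pprod N as x" if "i < N" for i using g that by simp
    from xdiv_Dp[OF inj this, unfolded xd]
    show "c * lapf N [] as x * vdm N x = (\<Sum>i<N. poly (Dp (g i * vslice N x i)) (x i)) + lam N id * (c * pprod N as x * vdm N x)"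
      by (simp add: algebra_simps)
  qed
next
  case (add G K)
  obtain H1 where H1: "H1 \<in> symalg N" "E H1 = 0" and h1: "\<And>x g. inj_on x {..<N} \<Longrightarrow> (\<forall>i<N. \<forall>s. poly (g i) s = G (x(i := s))) \<Longrightarrow>
      H1 x * vdm N x = (\<Sum>i<N. poly (Dp (g i * vslice N x i)) (x i)) + lam N id * (G x * vdm N x)"
    using add.IH(1) by blast
  obtain H2 where H2: "H2 \<in> symalg N" "E H2 = 0" and h2: "\<And>x g. inj_on x {..<N} \<Longrightarrow> (\<forall>i<N. \<forall>s. poly (g i) s = K (x(i := s))) \<Longrightarrow>
      H2 x * vdm N x = (\<Sum>i<N. poly (Dp (g i * vslice N x i)) (x i)) + lam N id * (K x * vdm N x)"
    using add.IH(2) by blast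
  show ?case
  proof (intro bexI[of _ "\<lambda>x. H1 x + H2 x"] conjI allI impI)
    show "(\<lambda>x. H1 x + H2 x) \<in> symalg N" by (intro symalg.add H1 H2)
    show "E (\<lambda>x. H1 x + H2 x) = 0" using H1 H2 by (simp add: E_add)
    fix x and g :: "nat \<Rightarrow> real poly"
    assume inj: "inj_on x {..<N}" and g: "\<forall>i<N. \<forall>s. poly (g i) s = G (x(i := s)) + K (x(i := s))"
    obtain u where u: "\<forall>i<N. \<forall>s. poly (u i) s = G (x(i := s))" using symalg_slice[OF add.hyps(1)] by blast
    have v: "\<forall>i<N. \<forall>s. poly (g i - u i) s = K (x(i := s))" using u g by simp
    have "Dp (g i * vslice N x i) = Dp (u i * vslice N x i) + Dp ((g i - u i) * vslice N x i)" for i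
      by (simp add: Dp_add[symmetric] algebra_simps)
    then show "(H1 x + H2 x) * vdm N x = (\<Sum>i<N. poly (Dp (g i * vslice N x i)) (x i)) + lam N id * ((G x + K x) * vdm N x)"
      using h1[OF inj u] h2[OF inj v] by (simp add: distrib_right distrib_left sum.distrib)
  qed
qed

text \<open>Inserting the expansion into the slices, every Legendre operator acts on
  \<open>leg_prod N k\<close> by a scalar, and these add up to -\<open>lam N k\<close>.
  \<open>linepoly_eqI\<close> removes the restriction to distinct coordinates.\<close>

lemma laplacian_rep:
  assumes G: "G \<in> symalg N" and S: "finite S"
    and eq: "\<And>x. G x * vdm N x = (\<Sum>k\<in>S. c k * leg_prod N k x)"
  shows "\<exists>H\<in>symalg N. E H = 0 \<and> (\<forall>x. H x * vdm N x = (\<Sum>k\<in>S. (lam N id - lam N k) * c k * leg_prod N k x))"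
proof -
  obtain H where H: "H \<in> symalg N" "E H = 0" and h: "\<And>x g. inj_on x {..<N} \<Longrightarrow> (\<forall>i<N. \<forall>s. poly (g i) s = G (x(i := s))) \<Longrightarrow>
      H x * vdm N x = (\<Sum>i<N. poly (Dp (g i * vslice N x i)) (x i)) + lam N id * (G x * vdm N x)"
    using laplacian_exists[OF G] by blast
  have "H x * vdm N x = (\<Sum>k\<in>S. (lam N id - lam N k) * c k * leg_prod N k x)" if inj: "inj_on x {..<N}" for x
  proof -
    obtain g where g: "\<forall>i<N. \<forall>s. poly (g i) s = G (x(i := s))" using symalg_slice[OF G] by blast
    have gv: "g i * vslice N x i = (\<Sum>k\<in>S. smult (c k) (eslice N k x i))" if "i < N" for i
      using that g eq by (intro poly_ext) (simp add: poly_sum poly_vslice poly_eslice del: fun_upd_apply)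
    have "(\<Sum>i<N. poly (Dp (g i * vslice N x i)) (x i))
      = (\<Sum>i<N. \<Sum>k\<in>S. - (c k * (real (k i) * (real (k i) + 1)) * leg_prod N k x))"
      by (intro sum.cong refl) (simp add: gv Dp_sum Dp_smult Dp_eslice poly_sum poly_eslice mult.assoc)
    also have "\<dots> = (\<Sum>k\<in>S. \<Sum>i<N. - (c k * (real (k i) * (real (k i) + 1)) * leg_prod N k x))"
      by (rule sum.swap)
    also have "\<dots> = (\<Sum>k\<in>S. - (c k * lam N k * leg_prod N k x))"
      by (intro sum.cong refl) (simp add: lam_def sum_distrib_left sum_distrib_right sum_negf)
    finally show ?thesis unfolding h[OF inj g] eq
      by (simp add: sum_distrib_left sum.distrib[symmetric] algebra_simps)
  qed
  then have "H x * vdm N x = (\<Sum>k\<in>S. (lam N id - lam N k) * c k * leg_prod N k x)" for x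
  proof (rule linepoly_eqI[where N = N, rotated 2])
    show "linepoly (\<lambda>x. H x * vdm N x)"
      by (intro linepoly_mult linepoly_symalg[OF H(1)] linepoly_vdm)
    show "linepoly (\<lambda>x. \<Sum>k\<in>S. (lam N id - lam N k) * c k * leg_prod N k x)"
      by (intro linepoly_sum linepoly_mult linepoly_const linepoly_leg_prod)
  qed
  then show ?thesis using H by blast
qed

text \<open>Applying \<open>1 - L / \<epsilon>\<close> removes the component with eigenvalue \<open>\<epsilon> \<noteq> 0\<close> of the radial Laplacian \<open>L\<close>
  without changing the value of the functional.\<close>

lemma kill_components:
  assumes "finite \<Lambda>" and "finite S" and "0 \<notin> \<Lambda>"
  shows "\<lbrakk>G \<in> symalg N; \<And>x. G x * vdm N x = (\<Sum>k\<in>S. c k * leg_prod N k x);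
      \<And>k. k \<in> S \<Longrightarrow> c k \<noteq> 0 \<Longrightarrow> lam N id - lam N k \<in> insert 0 \<Lambda>\<rbrakk> \<Longrightarrow>
    \<exists>H\<in>symalg N. \<exists>d. E H = E G \<and> (\<forall>x. H x * vdm N x = (\<Sum>k\<in>S. d k * leg_prod N k x)) \<and>
      (\<forall>k\<in>S. d k = (if lam N k = lam N id then c k else 0))"
  using assms(1,3)
proof (induction \<Lambda> arbitrary: G c rule: finite_induct)
  case empty
  have "c k = (if lam N k = lam N id then c k else 0)" if "k \<in> S" for k
    using empty.prems(3)[OF that] by (cases "c k = 0") (auto simp: id_def)
  then show ?case using empty.prems(1,2) by blast
next
  case (insert \<epsilon> \<Lambda>)
  then have e: "\<epsilon> \<noteq> 0" by auto
  obtain L where L: "L \<in> symalg N" "E L = 0"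
      "\<And>x. L x * vdm N x = (\<Sum>k\<in>S. (lam N id - lam N k) * c k * leg_prod N k x)"
    using laplacian_rep[OF insert.prems(1) assms(2) insert.prems(2)] by blast
  let ?G = "\<lambda>x. G x + (- 1 / \<epsilon>) * L x"
  let ?c = "\<lambda>k. c k * (1 - (lam N id - lam N k) / \<epsilon>)"
  have ih: "\<exists>H\<in>symalg N. \<exists>d. E H = E ?G \<and> (\<forall>x. H x * vdm N x = (\<Sum>k\<in>S. d k * leg_prod N k x)) \<and>
      (\<forall>k\<in>S. d k = (if lam N k = lam N id then ?c k else 0))"
  proof (rule insert.IH)
    show "?G \<in> symalg N" by (intro symalg.add symalg_scale L insert.prems)
    show "?G x * vdm N x = (\<Sum>k\<in>S. ?c k * leg_prod N k x)" for x
    proof -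
      have "?G x * vdm N x = G x * vdm N x + (- 1 / \<epsilon>) * (L x * vdm N x)" by (simp add: algebra_simps)
      also have "\<dots> = (\<Sum>k\<in>S. ?c k * leg_prod N k x)"
        unfolding L(3) insert.prems(2) sum_distrib_left sum.distrib[symmetric]
        using e by (intro sum.cong refl) (simp add: field_simps)
      finally show ?thesis .
    qed
    show "lam N id - lam N k \<in> insert 0 \<Lambda>" if "k \<in> S" "?c k \<noteq> 0" for k
      using insert.prems(3)[OF that(1)] that(2) e by (auto simp: id_def)
    show "0 \<notin> \<Lambda>" using insert by auto
  qed
  have EG: "E ?G = E G"
    using L insert.prems(1) by (simp only: E_add symalg_scale E_scale)
  have cc: "(if lam N k = lam N id then ?c k else 0) = (if lam N k = lam N id then c k else 0)" for k
    by simp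
  show ?case by (rule ih[unfolded cc EG])
qed

theorem loop_functional_unique:
  assumes G: "G \<in> symalg N"
  shows "E G = cube_integral N (\<lambda>x. G x * (vdm N x * vdm N x)) / vnorm N"
proof -
  obtain S c where S: "finite S" and eq: "\<And>x. G x * vdm N x = (\<Sum>k\<in>S. c k * leg_prod N k x)"
    using leg_span_symalg[OF G leg_span_vdm] unfolding leg_span_def by blast
  let ?\<Lambda> = "(\<lambda>k. lam N id - lam N k) ` S - {0}"
  obtain H d where H: "H \<in> symalg N" "E H = E G" "\<And>x. H x * vdm N x = (\<Sum>k\<in>S. d k * leg_prod N k x)"
    and d: "\<And>k. k \<in> S \<Longrightarrow> d k = (if lam N k = lam N id then c k else 0)"
    using kill_components[of ?\<Lambda> S G c] S G eq by auto
  obtain r where r: "\<And>x. H x = r"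
    using alternating_component[OF S H(1) H(3)] d by auto
  have val: "cube_integral N (\<lambda>x. (\<Sum>k\<in>S. b k * leg_prod N k x) * vdm N x) = (\<Sum>k\<in>S. b k * cube_integral N (\<lambda>x. leg_prod N k x * vdm N x))" for b
  proof -
    have e: "(\<lambda>x. (\<Sum>k\<in>S. b k * leg_prod N k x) * vdm N x) = (\<lambda>x. \<Sum>k\<in>S. b k * (leg_prod N k x * vdm N x))"
      by (simp add: sum_distrib_right mult.assoc)
    show ?thesis unfolding e
      by (subst cube_integral_sum) (auto simp: cube_integral_scale intro!: cube_integrable_scale cube_integrable_leg_prod_leg_span leg_span_vdm)
  qed
  have "E G = E (\<lambda>x. r * 1)" using r H(2) by (simp add: fun_eq_iff[symmetric] ext[of H "\<lambda>_. r"])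
  also have "\<dots> = r" using E_scale[OF symalg_const[of 1], of r] E_one by simp
  finally have Er: "E G = r" .
  have "cube_integral N (\<lambda>x. G x * (vdm N x * vdm N x)) = cube_integral N (\<lambda>x. (\<Sum>k\<in>S. c k * leg_prod N k x) * vdm N x)"
    by (simp add: eq[symmetric] mult.assoc)
  \<comment> \<open>Passing from \<open>c\<close> to \<open>d\<close> drops only indices with
    \<open>lam N k\<close> different from \<open>lam N id\<close>, and these are orthogonal to
    \<open>vdm\<close>.\<close>
  also have "\<dots> = cube_integral N (\<lambda>x. (\<Sum>k\<in>S. d k * leg_prod N k x) * vdm N x)"
    unfolding val by (intro sum.cong refl) (auto simp: d cube_integral_leg_prod_vdm)
  also have "\<dots> = cube_integral N (\<lambda>x. r * (vdm N x * vdm N x))"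
    by (simp add: H(3)[symmetric] r mult.assoc)
  also have "\<dots> = r * vnorm N" by (simp add: cube_integral_scale vnorm_def)
  finally show ?thesis using Er vnorm_pos[of N] by simp
qed

end

subsection \<open>Matrices\<close>

lemma bilinear_matrix_mult: "bilinear ((**) :: complex^'m^'m \<Rightarrow> complex^'m^'m \<Rightarrow> complex^'m^'m)"
  unfolding bilinear_def
  by (auto intro!: linearI simp: matrix_matrix_mult_def vec_eq_iff scaleR_sum_right
      sum.distrib[symmetric] algebra_simps)

interpretation mm: bounded_bilinear "(**) :: complex^'m^'m \<Rightarrow> complex^'m^'m \<Rightarrow> complex^'m^'m"
  using bilinear_matrix_mult by (simp add: bilinear_conv_bounded_bilinear)

lemma linear_mat_adj: "linear (mat_adj :: complex^'m^'m \<Rightarrow> complex^'m^'m)"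
  by (intro linearI) (auto simp: mat_adj_def vec_eq_iff)

lemma continuous_on_mat_adj [continuous_intros]:
  assumes "continuous_on S f" shows "continuous_on S (\<lambda>x. mat_adj (f x :: complex^'m^'m))"
proof -
  have "continuous_on UNIV (mat_adj :: complex^'m^'m \<Rightarrow> _)"
    by (rule linear_continuous_on[OF linear_mat_adj[unfolded linear_conv_bounded_linear]])
  then show ?thesis by (rule continuous_on_compose2) (use assms in auto)
qed

lemma mat_adj_mult: "mat_adj (A ** B) = mat_adj B ** mat_adj (A :: complex^'m^'m)"
  by (simp add: mat_adj_def matrix_matrix_mult_def vec_eq_iff mult.commute)

lemma mat_adj_adj [simp]: "mat_adj (mat_adj A) = A"
  by (simp add: mat_adj_def vec_eq_iff)

lemma mat_adj_1 [simp]: "mat_adj (mat 1) = (mat 1 :: complex^'m^'m)"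
  by (auto simp: mat_adj_def vec_eq_iff mat_def)

lemma unitary_right: "is_unitary_mat (U :: complex^'m^'m) \<Longrightarrow> U ** mat_adj U = mat 1"
  unfolding is_unitary_mat_def by (simp add: matrix_left_right_inverse)

lemma unitary_adj: "is_unitary_mat (U :: complex^'m^'m) \<Longrightarrow> is_unitary_mat (mat_adj U)"
  using unitary_right[of U] by (simp add: is_unitary_mat_def)

lemma unitary_mult: "is_unitary_mat U \<Longrightarrow> is_unitary_mat (V :: complex^'m^'m) \<Longrightarrow> is_unitary_mat (U ** V)"
  unfolding is_unitary_mat_def mat_adj_mult by (metis matrix_mul_assoc matrix_mul_lid)

lemma closed_unitary: "closed {U :: complex^'m^'m. is_unitary_mat U}"
  unfolding is_unitary_mat_def by (intro closed_Collect_eq mm.continuous_on continuous_intros)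

lemma borel_unitary [measurable]: "{U :: complex^'m^'m. is_unitary_mat U} \<in> sets borel"
  by (rule borel_closed[OF closed_unitary])

text \<open>The norm of the nested vector type is the Frobenius norm; in terms of
  \<open>mat_adj X ** X\<close> its invariance under left multiplication by unitary matrices is
  evident.\<close>

lemma norm_mat_sq: "(norm (X :: complex^'m^'m))\<^sup>2 = (\<Sum>j\<in>UNIV. Re ((mat_adj X ** X) $ j $ j))"
proof -
  have "(norm X)\<^sup>2 = (\<Sum>i\<in>UNIV. \<Sum>j\<in>UNIV. (cmod (X $ i $ j))\<^sup>2)"
    by (simp add: norm_vec_def L2_set_def sum_nonneg)
  also have "\<dots> = (\<Sum>j\<in>UNIV. \<Sum>i\<in>UNIV. (cmod (X $ i $ j))\<^sup>2)" by (rule sum.swap)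
  also have "\<dots> = (\<Sum>j\<in>UNIV. Re ((mat_adj X ** X) $ j $ j))"
  proof (intro sum.cong refl)
    fix j
    have rc: "Re (cnj z * z) = (cmod z)\<^sup>2" for z by (simp add: cmod_power2) (simp add: power2_eq_square)
    show "(\<Sum>i\<in>UNIV. (cmod (X $ i $ j))\<^sup>2) = Re ((mat_adj X ** X) $ j $ j)"
      by (simp only: mat_adj_def matrix_matrix_mult_def vec_lambda_beta Re_sum rc)
  qed
  finally show ?thesis .
qed

lemma norm_unitary_mult:
  assumes "is_unitary_mat V" shows "norm (V ** X) = norm (X :: complex^'m^'m)"
proof -
  have "mat_adj (V ** X) ** (V ** X) = mat_adj X ** X"
    using assms unfolding is_unitary_mat_def mat_adj_mult by (metis matrix_mul_assoc matrix_mul_lid)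
  then have "(norm (V ** X))\<^sup>2 = (norm X)\<^sup>2" by (simp add: norm_mat_sq)
  then show ?thesis by simp
qed

lemma borel_mm [measurable (raw)]:
  "f \<in> borel_measurable M \<Longrightarrow> g \<in> borel_measurable M \<Longrightarrow> (\<lambda>x. (f x :: complex^'m^'m) ** (g x :: complex^'m^'m)) \<in> borel_measurable M"
  by (rule borel_measurable_continuous_Pair[where H = "(**)"]) (auto intro!: mm.continuous_on continuous_intros)

lemma borel_mat_adj [measurable (raw)]:
  "f \<in> borel_measurable M \<Longrightarrow> (\<lambda>x. mat_adj (f x :: complex^'m^'m)) \<in> borel_measurable M"
  by (rule measurable_compose[OF _ borel_measurable_continuous_onI]) (auto intro!: continuous_intros)

subsection \<open>Haar measure on the unitary group\<close>

text \<open>Integrate the indicator of the pairs with y in A and |y - V x| < 1 in both orders. One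
  order gives the volume of A, the other that of its preimage under V, each times the volume of the
  unit ball, which is finite and positive. Only translations and reflections of
  \<open>lborel\<close> are used, no determinant.\<close>

lemma lborel_isometry:
  fixes V W :: "'a::euclidean_space \<Rightarrow> 'a"
  assumes V: "linear V" and W: "linear W" and inv: "\<And>x. V (W x) = x" and n: "\<And>x. norm (V x) = norm x"
  shows "distr lborel borel V = lborel"
proof (rule measure_eqI)
  have [measurable]: "V \<in> borel_measurable borel" "W \<in> borel_measurable borel"
    by (intro borel_measurable_continuous_onI linear_continuous_on linear_conv_bounded_linear[THEN iffD1] V W)+
  fix A assume "A \<in> sets (distr lborel borel V)"
  then have [measurable]: "A \<in> sets borel" by simp
  let ?B = "ball 0 1 :: 'a set"
  have [measurable]: "?B \<in> sets borel" by simp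
  have tr: "(\<integral>\<^sup>+x. f (a + x) \<partial>lborel) = (\<integral>\<^sup>+x. f x \<partial>lborel)" if [measurable]: "f \<in> borel_measurable borel" for f and a :: 'a
    by (subst (2) lborel_affine[of 1 a]) (auto simp: nn_integral_density nn_integral_distr one_ennreal_def[symmetric])
  have rf: "(\<integral>\<^sup>+x. f (a - x) \<partial>lborel) = (\<integral>\<^sup>+x. f x \<partial>lborel)" if [measurable]: "f \<in> borel_measurable borel" for f and a :: 'a
    by (subst (2) lborel_affine[of "-1" a]) (auto simp: nn_integral_density nn_integral_distr one_ennreal_def[symmetric])
  have B: "emeasure lborel ?B \<noteq> 0" "emeasure lborel ?B \<noteq> \<infinity>"
    by (simp_all add: emeasure_ball ennreal_eq_0_iff not_le)
  have Beq: "indicator ?B (y - V x) = (indicator ?B (W y - x) :: ennreal)" for x y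
  proof -
    have "y - V x = V (W y - x)" by (simp add: linear_diff[OF V] inv)
    then have "norm (y - V x) = norm (W y - x)" by (simp only: n)
    then show ?thesis by (simp add: indicator_def)
  qed
  have "(\<integral>\<^sup>+x. (\<integral>\<^sup>+y. indicator A y * indicator ?B (y - V x) \<partial>lborel) \<partial>lborel)
      = (\<integral>\<^sup>+y. (\<integral>\<^sup>+x. indicator A y * indicator ?B (y - V x) \<partial>lborel) \<partial>lborel)"
    by (rule lborel_pair.Fubini') measurable
  also have "\<dots> = (\<integral>\<^sup>+y. indicator A y * (\<integral>\<^sup>+x. indicator ?B (W y - x) \<partial>lborel) \<partial>lborel)"
    unfolding Beq by (intro nn_integral_cong nn_integral_cmult) measurable
  also have "\<dots> = emeasure lborel A * emeasure lborel ?B"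
    by (subst rf) (auto simp: nn_integral_multc)
  finally have 1: "(\<integral>\<^sup>+x. (\<integral>\<^sup>+y. indicator A y * indicator ?B (y - V x) \<partial>lborel) \<partial>lborel)
      = emeasure lborel A * emeasure lborel ?B" .
  have "(\<integral>\<^sup>+x. (\<integral>\<^sup>+y. indicator A y * indicator ?B (y - V x) \<partial>lborel) \<partial>lborel)
      = (\<integral>\<^sup>+x. (\<integral>\<^sup>+z. indicator A (V x + z) * indicator ?B z \<partial>lborel) \<partial>lborel)"
  proof (rule nn_integral_cong)
    fix x
    show "(\<integral>\<^sup>+y. indicator A y * indicator ?B (y - V x) \<partial>lborel) = (\<integral>\<^sup>+z. indicator A (V x + z) * indicator ?B z \<partial>lborel)"
      using tr[of "\<lambda>y. indicator A y * indicator ?B (y - V x)" "V x"] by simp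
  qed
  also have "\<dots> = (\<integral>\<^sup>+z. (\<integral>\<^sup>+x. indicator A (V x + z) * indicator ?B z \<partial>lborel) \<partial>lborel)"
    by (rule lborel_pair.Fubini') measurable
  also have "\<dots> = (\<integral>\<^sup>+z. emeasure (distr lborel borel V) A * indicator ?B z \<partial>lborel)"
  proof (rule nn_integral_cong)
    fix z
    have "V x + z = V (W z + x)" for x by (simp add: linear_add[OF V] inv)
    then have "(\<integral>\<^sup>+x. indicator A (V x + z) * indicator ?B z \<partial>lborel) = (\<integral>\<^sup>+x. indicator A (V (W z + x)) \<partial>lborel) * indicator ?B z"
      by (simp add: nn_integral_multc)
    also have "(\<integral>\<^sup>+x. indicator A (V (W z + x)) \<partial>lborel) = (\<integral>\<^sup>+x. indicator A (V x) \<partial>lborel)"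
      by (rule tr[of "\<lambda>x. indicator A (V x)"]) measurable
    also have "\<dots> = (\<integral>\<^sup>+x. indicator A x \<partial>distr lborel borel V)"
      by (subst nn_integral_distr) auto
    finally show "(\<integral>\<^sup>+x. indicator A (V x + z) * indicator ?B z \<partial>lborel) = emeasure (distr lborel borel V) A * indicator ?B z"
      by simp
  qed
  also have "\<dots> = emeasure (distr lborel borel V) A * emeasure lborel ?B"
    by (simp add: nn_integral_cmult)
  finally have "emeasure (distr lborel borel V) A * emeasure lborel ?B = emeasure lborel A * emeasure lborel ?B"
    using 1 by simp
  then show "emeasure (distr lborel borel V) A = emeasure lborel A"
    using B by (metis ennreal_mult_divide_eq infinity_ennreal_def)
qed simp

lemma lborel_unitary:
  assumes "is_unitary_mat (V :: complex^'m^'m)"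
  shows "distr lborel borel (\<lambda>X :: complex^'m^'m. V ** X) = lborel"
proof (rule lborel_isometry[where W = "\<lambda>X. mat_adj V ** X"])
  show "linear (\<lambda>X :: complex^'m^'m. V ** X)" "linear (\<lambda>X :: complex^'m^'m. mat_adj V ** X)"
    using bilinear_matrix_mult[where ?'m = 'm] by (auto simp: bilinear_def)
  show "V ** (mat_adj V ** X) = X" for X by (simp add: matrix_mul_assoc unitary_right[OF assms])
qed (rule norm_unitary_mult[OF assms])

text \<open>The inverse function theorem for \<open>(P, h) \<mapsto> (P, h P h)\<close> yields \<open>h = P\<^sup>-\<^sup>1\<^sup>/\<^sup>2\<close>.\<close>

lemma local_inverse_sqrt:
  obtains O' and h :: "complex^'m^'m \<Rightarrow> complex^'m^'m"
  where "open O'" "mat 1 \<in> O'" "continuous_on O' h"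
    "\<And>P. P \<in> O' \<Longrightarrow> h P ** P ** h P = mat 1"
    "\<And>P. P \<in> O' \<Longrightarrow> mat_adj P = P \<Longrightarrow> mat_adj (h P) = h P"
proof -
  define f :: "(complex^'m^'m) \<times> (complex^'m^'m) \<Rightarrow> (complex^'m^'m) \<times> (complex^'m^'m)"
    where "f = (\<lambda>x. (fst x, (snd x ** fst x) ** snd x))"
  define D where "D = (\<lambda>(x :: (complex^'m^'m) \<times> (complex^'m^'m)) y. (fst y :: complex^'m^'m,
      (snd x ** fst x) ** snd y + (snd x ** fst y + snd y ** fst x) ** snd x))"
  have der: "(f has_derivative D x) (at x)" for x
    unfolding f_def D_def
    by (rule has_derivative_eq_rhs) (auto intro!: derivative_eq_intros mm.FDERIV)
  have bl: "bounded_linear (D x)" for x using der has_derivative_bounded_linear by blast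
  \<comment> \<open>The derivative at (1, 1) sends (p, q) to (p, p + 2 q); this is its
    inverse.\<close>
  define E where "E = (\<lambda>y :: (complex^'m^'m) \<times> (complex^'m^'m). (fst y, (1/2) *\<^sub>R (snd y - fst y)))"
  have blE: "bounded_linear E" unfolding E_def
    by (intro bounded_linear_Pair bounded_linear_fst bounded_linear_scaleR_right[THEN bounded_linear_compose] bounded_linear_sub bounded_linear_snd)
  have c: "continuous_on UNIV (\<lambda>x. Blinfun (D x))"
  proof (rule continuous_on_blinfun_componentwise)
    fix i :: "(complex^'m^'m) \<times> (complex^'m^'m)"
    show "continuous_on UNIV (\<lambda>x. blinfun_apply (Blinfun (D x)) i)"
      unfolding bounded_linear_Blinfun_apply[OF bl] unfolding D_def
      by (intro continuous_intros mm.continuous_on)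
  qed
  have e: "Blinfun E o\<^sub>L Blinfun (D (mat 1, mat 1)) = id_blinfun"
  proof (rule blinfun_eqI)
    fix y :: "(complex^'m^'m) \<times> (complex^'m^'m)"
    have "fst y + snd y + snd y - fst y = 2 *\<^sub>R snd y" by (simp add: scaleR_2)
    then show "blinfun_apply (Blinfun E o\<^sub>L Blinfun (D (mat 1, mat 1))) y = blinfun_apply id_blinfun y"
      by (simp only: blinfun_apply_blinfun_compose bounded_linear_Blinfun_apply[OF bl] bounded_linear_Blinfun_apply[OF blE])
         (simp add: D_def E_def prod_eq_iff algebra_simps scaleR_2[symmetric])
  qed
  have d: "(f has_derivative blinfun_apply (Blinfun (D x))) (at x)" for x
    unfolding bounded_linear_Blinfun_apply[OF bl] by (rule der)
  obtain U V g where UV: "open U" "(mat 1, mat 1) \<in> U" "open V" "f (mat 1, mat 1) \<in> V" "homeomorphism U V f g"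
    by (rule inverse_function_theorem[OF open_UNIV d c UNIV_I e]) (blast intro: that)
  define h where "h P = snd (g (P, mat 1))" for P
  define O1 where "O1 = {P :: complex^'m^'m. (P, mat 1 :: complex^'m^'m) \<in> V}"
  have O1: "open O1" unfolding O1_def
  proof -
    have "continuous_on UNIV (\<lambda>P :: complex^'m^'m. (P, mat 1 :: complex^'m^'m))"
      by (intro continuous_intros)
    from open_vimage[OF UV(3) this] show "open {P :: complex^'m^'m. (P, mat 1 :: complex^'m^'m) \<in> V}"
      by (simp add: vimage_def)
  qed
  have gc: "continuous_on V g" using UV(5) by (auto simp: homeomorphism_def)
  have hc: "continuous_on O1 h" unfolding h_def
    by (intro continuous_intros continuous_on_compose2[OF gc]) (auto simp: O1_def)
  have g: "g (P, mat 1) = (P, h P)" "(P, h P) \<in> U" "h P ** P ** h P = mat 1" if "P \<in> O1" for P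
  proof -
    have "f (g (P, mat 1)) = (P, mat 1)" "g (P, mat 1) \<in> U"
      using UV(5) that by (auto simp: homeomorphism_def O1_def)
    moreover from this show e: "g (P, mat 1) = (P, h P)"
      by (simp add: f_def h_def prod_eq_iff)
    ultimately show "(P, h P) \<in> U" "h P ** P ** h P = mat 1"
      unfolding e by (simp_all add: f_def)
  qed
  have gf: "g (f y) = y" if "y \<in> U" for y using UV(5) that by (auto simp: homeomorphism_def)
  \<comment> \<open>On \<open>O2\<close> the adjoint of \<open>h P\<close> also lies where
    \<open>f\<close> is injective. For selfadjoint P it solves the same equation as
    \<open>h P\<close>, so the two coincide.\<close>
  define O2 where "O2 = {P \<in> O1. (P, mat_adj (h P)) \<in> U}"
  have "continuous_on O1 (\<lambda>P. (P, mat_adj (h P)))" by (intro continuous_intros hc)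
  then have O2: "open O2" unfolding O2_def
    using continuous_open_preimage[OF _ O1 UV(1), of "\<lambda>P. (P, mat_adj (h P))"] by (simp add: vimage_def Int_def)
  have 1: "mat 1 \<in> O1" using UV(4) by (simp add: O1_def f_def)
  have "h (mat 1) = mat 1" using gf[OF UV(2)] by (simp add: f_def h_def)
  then have 1: "mat 1 \<in> O2" using 1 UV(2) by (simp add: O2_def)
  show ?thesis
  proof (rule that[OF O2 1])
    show "continuous_on O2 h" by (rule continuous_on_subset[OF hc]) (auto simp: O2_def)
    fix P assume P: "P \<in> O2"
    then have P1: "P \<in> O1" by (simp add: O2_def)
    show "h P ** P ** h P = mat 1" by (rule g(3)[OF P1])
    assume a: "mat_adj P = P"
    have "mat_adj (h P) ** P ** mat_adj (h P) = mat_adj (h P ** P ** h P)"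
      by (simp add: mat_adj_mult a matrix_mul_assoc)
    then have "f (P, mat_adj (h P)) = (P, mat 1)" by (simp add: f_def g(3)[OF P1])
    then have "(P, mat_adj (h P)) = g (P, mat 1)" using gf[of "(P, mat_adj (h P))"] P by (simp add: O2_def)
    then show "mat_adj (h P) = h P" using g(1)[OF P1] by simp
  qed
qed

text \<open>The property in the definite description of \<open>haar_unitary\<close>, split off so
  that existence and uniqueness can be proved separately.\<close>

definition is_haar :: "(complex^'m^'m) measure \<Rightarrow> bool" where
  "is_haar \<mu> \<longleftrightarrow> prob_space \<mu> \<and> sets \<mu> = sets borel \<and> emeasure \<mu> {U. is_unitary_mat U} = 1
      \<and> (\<forall>V. is_unitary_mat V \<longrightarrow> distr \<mu> borel (\<lambda>U. V ** U) = \<mu>)"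

text \<open>Unitary matrices act on the left by isometries, and \<open>X \<mapsto> X (X\<^sup>* X)\<^sup>-\<^sup>1\<^sup>/\<^sup>2\<close> commutes with this action;
  so it pushes normalized Lebesgue measure on an invariant neighbourhood of the unitary group to a Haar measure.\<close>

lemma haar_exists: "\<exists>\<mu> :: (complex^'m^'m) measure. is_haar \<mu>"
proof -
  obtain O' and h :: "complex^'m^'m \<Rightarrow> complex^'m^'m"
    where O': "open O'" "mat 1 \<in> O'" "continuous_on O' h"
    and h: "\<And>P. P \<in> O' \<Longrightarrow> h P ** P ** h P = mat 1"
    and ha: "\<And>P. P \<in> O' \<Longrightarrow> mat_adj P = P \<Longrightarrow> mat_adj (h P) = h P"
    using local_inverse_sqrt by metis
  \<comment> \<open>Both conditions are invariant under left multiplication by unitary matrices. The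
    first places \<open>mat_adj X ** X\<close> where the inverse square root exists; the bound on
    the norm makes the volume finite.\<close>
  define S where "S = {X :: complex^'m^'m. mat_adj X ** X \<in> O' \<and> norm X < norm (mat 1 :: complex^'m^'m) + 1}"
  \<comment> \<open>The value off \<open>S\<close> is only a default that keeps the map measurable;
    the normalized measure lives on \<open>S\<close>.\<close>
  define \<phi> where "\<phi> X = (if X \<in> S then X ** h (mat_adj X ** X) else X)" for X
  have S: "open S"
  proof -
    have "open ((\<lambda>X :: complex^'m^'m. mat_adj X ** X) -` O')"
      by (intro open_vimage O' mm.continuous_on continuous_intros)
    moreover have "open {X :: complex^'m^'m. norm X < norm (mat 1 :: complex^'m^'m) + 1}"
      by (intro open_Collect_less continuous_intros)
    ultimately show ?thesis unfolding S_def by (auto simp: Collect_conj_eq vimage_def)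
  qed
  have S1: "mat 1 \<in> S" using O' by (simp add: S_def)
  have Sb[measurable]: "S \<in> sets borel" using S by simp
  have pos: "emeasure lborel S \<noteq> 0"
  proof -
    obtain e where "e > 0" "ball (mat 1) e \<subseteq> S" using S S1 open_contains_ball by blast
    then have "emeasure lborel (ball (mat 1 :: complex^'m^'m) e) \<le> emeasure lborel S"
      by (intro emeasure_mono) auto
    moreover have "emeasure lborel (ball (mat 1 :: complex^'m^'m) e) > 0"
      using \<open>e > 0\<close> unit_ball_vol_pos by (simp add: emeasure_ball)
    ultimately show ?thesis by auto
  qed
  have fin: "emeasure lborel S \<noteq> \<infinity>"
  proof -
    have "bounded S" unfolding S_def bounded_iff by (auto intro: less_imp_le)
    then show ?thesis using emeasure_bounded_finite[of S] by auto
  qed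
  have \<phi>[measurable]: "\<phi> \<in> borel_measurable borel"
    unfolding \<phi>_def
  proof (rule borel_measurable_continuous_on_if)
    show "continuous_on S (\<lambda>X. X ** h (mat_adj X ** X))"
      by (intro mm.continuous_on continuous_on_id continuous_on_compose2[OF O'(3)] continuous_intros) (auto simp: S_def)
  qed (auto intro: continuous_intros)
  let ?u = "uniform_measure lborel S"
  interpret u: prob_space ?u using pos fin by (intro prob_space_uniform_measure) auto
  have VS: "V ** X \<in> S \<longleftrightarrow> X \<in> S" if "is_unitary_mat V" for V X :: "complex^'m^'m"
  proof -
    have "mat_adj (V ** X) ** (V ** X) = mat_adj X ** X"
      using that unfolding is_unitary_mat_def mat_adj_mult by (metis matrix_mul_assoc matrix_mul_lid)
    then show ?thesis by (simp add: S_def norm_unitary_mult[OF that])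
  qed
  have \<phi>V: "\<phi> (V ** X) = V ** \<phi> X" if "is_unitary_mat V" for V X
  proof -
    have "mat_adj (V ** X) ** (V ** X) = mat_adj X ** X"
      using that unfolding is_unitary_mat_def mat_adj_mult by (metis matrix_mul_assoc matrix_mul_lid)
    then show ?thesis by (simp add: \<phi>_def VS[OF that] matrix_mul_assoc)
  qed
  have uV: "distr ?u borel (\<lambda>X. V ** X) = ?u" if V: "is_unitary_mat V" for V
  proof (rule measure_eqI)
    fix A assume "A \<in> sets (distr ?u borel (\<lambda>X. V ** X))"
    then have [measurable]: "A \<in> sets borel" by simp
    have "emeasure (distr ?u borel (\<lambda>X. V ** X)) A = emeasure ?u ((\<lambda>X. V ** X) -` A)"
      by (subst emeasure_distr) auto
    also have "\<dots> = emeasure lborel ((\<lambda>X. V ** X) -` (S \<inter> A)) / emeasure lborel S"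
      by (subst emeasure_uniform_measure) (auto intro!: measurable_sets_borel[of _ borel] arg_cong2[where f = "(/)"] arg_cong2[where f = emeasure] simp: VS[OF V])
    also have "emeasure lborel ((\<lambda>X. V ** X) -` (S \<inter> A)) = emeasure (distr lborel borel (\<lambda>X. V ** X)) (S \<inter> A)"
      by (subst emeasure_distr) auto
    also have "\<dots> = emeasure lborel (S \<inter> A)" by (simp only: lborel_unitary[OF V])
    finally show "emeasure (distr ?u borel (\<lambda>X. V ** X)) A = emeasure ?u A"
      by (simp add: emeasure_uniform_measure)
  qed simp
  have "is_haar (distr ?u borel \<phi>)" unfolding is_haar_def
  proof (intro conjI allI impI)
    show "prob_space (distr ?u borel \<phi>)" by (rule u.prob_space_distr) simp
    show "sets (distr ?u borel \<phi>) = sets borel" by simp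
    have un: "is_unitary_mat (\<phi> X)" if "X \<in> S" for X
    proof -
      let ?P = "mat_adj X ** X"
      have P: "?P \<in> O'" using that by (simp add: S_def)
      have "mat_adj (h ?P) = h ?P" by (rule ha[OF P]) (simp add: mat_adj_mult)
      then show ?thesis unfolding is_unitary_mat_def
        using that h[OF P] by (simp add: \<phi>_def mat_adj_mult matrix_mul_assoc)
    qed
    have "AE X in ?u. is_unitary_mat (\<phi> X)" using un pos fin by (intro AE_uniform_measureI) auto
    then have "emeasure ?u (\<phi> -` {U. is_unitary_mat U}) = 1"
      using u.emeasure_eq_1_AE[of "\<phi> -` {U. is_unitary_mat U}"] measurable_sets_borel[OF \<phi> borel_unitary] by simp
    then show "emeasure (distr ?u borel \<phi>) {U. is_unitary_mat U} = 1"
      by (subst emeasure_distr) auto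
    fix V :: "complex^'m^'m" assume V: "is_unitary_mat V"
    have "distr (distr ?u borel \<phi>) borel (\<lambda>X. V ** X) = distr ?u borel (\<lambda>X. V ** \<phi> X)"
      by (subst distr_distr) (auto simp: o_def)
    also have "\<dots> = distr ?u borel (\<lambda>X. \<phi> (V ** X))" by (simp only: \<phi>V[OF V])
    also have "\<dots> = distr (distr ?u borel (\<lambda>X. V ** X)) borel \<phi>"
      by (subst distr_distr) (auto simp: o_def)
    finally show "distr (distr ?u borel \<phi>) borel (\<lambda>X. V ** X) = distr ?u borel \<phi>"
      by (simp only: uV[OF V])
  qed
  then show ?thesis by blast
qed

lemma is_haar_AE:
  assumes "is_haar \<mu>" shows "AE U in \<mu>. is_unitary_mat U"
proof -
  interpret prob_space \<mu> using assms by (simp add: is_haar_def)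
  have "{U. is_unitary_mat U} \<in> sets \<mu>" "prob {U. is_unitary_mat U} = 1"
    using assms by (auto simp: is_haar_def measure_def)
  then show ?thesis using AE_in_set_eq_1[of "{U. is_unitary_mat U}"] by simp
qed

lemma is_haar_left:
  assumes "is_haar \<mu>" "is_unitary_mat V" and [measurable]: "f \<in> borel_measurable borel"
  shows "(\<integral>\<^sup>+U. f (V ** U) \<partial>\<mu>) = (\<integral>\<^sup>+U. f U \<partial>\<mu>)"
proof -
  have [measurable_cong]: "sets \<mu> = sets borel" using assms by (simp add: is_haar_def)
  have "(\<integral>\<^sup>+U. f (V ** U) \<partial>\<mu>) = (\<integral>\<^sup>+U. f U \<partial>distr \<mu> borel (\<lambda>U. V ** U))"
    by (subst nn_integral_distr) auto
  also have "distr \<mu> borel (\<lambda>U. V ** U) = \<mu>" using assms by (simp add: is_haar_def)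
  finally show ?thesis .
qed

text \<open>Integrate f (x^* y) over the product of the two measures. Left invariance in y removes
  x^*, and x^* y = (y^* x)^* together with left invariance in x removes y.\<close>

lemma is_haar_adj:
  fixes \<mu> \<nu> :: "(complex^'m^'m) measure"
  assumes m: "is_haar \<mu>" and n: "is_haar \<nu>" and f[measurable]: "f \<in> borel_measurable borel"
  shows "(\<integral>\<^sup>+U. f U \<partial>\<nu>) = (\<integral>\<^sup>+U. f (mat_adj U) \<partial>\<mu>)"
proof -
  have [measurable_cong]: "sets \<mu> = sets borel" "sets \<nu> = sets borel" using m n by (auto simp: is_haar_def)
  interpret \<mu>: prob_space \<mu> using m by (simp add: is_haar_def)
  interpret \<nu>: prob_space \<nu> using n by (simp add: is_haar_def)
  interpret pair_sigma_finite \<mu> \<nu> ..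
  have "(\<integral>\<^sup>+x. (\<integral>\<^sup>+y. f (mat_adj x ** y) \<partial>\<nu>) \<partial>\<mu>) = (\<integral>\<^sup>+x. (\<integral>\<^sup>+y. f y \<partial>\<nu>) \<partial>\<mu>)"
    using is_haar_AE[OF m] by (intro nn_integral_cong_AE) (auto intro!: is_haar_left[OF n] unitary_adj)
  also have "\<dots> = (\<integral>\<^sup>+y. f y \<partial>\<nu>)" by (simp add: \<mu>.emeasure_space_1)
  finally have 1: "(\<integral>\<^sup>+x. (\<integral>\<^sup>+y. f (mat_adj x ** y) \<partial>\<nu>) \<partial>\<mu>) = (\<integral>\<^sup>+y. f y \<partial>\<nu>)" .
  have "(\<integral>\<^sup>+y. (\<integral>\<^sup>+x. f (mat_adj x ** y) \<partial>\<mu>) \<partial>\<nu>) = (\<integral>\<^sup>+y. (\<integral>\<^sup>+x. f (mat_adj x) \<partial>\<mu>) \<partial>\<nu>)"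
  proof (intro nn_integral_cong_AE)
    show "AE y in \<nu>. (\<integral>\<^sup>+x. f (mat_adj x ** y) \<partial>\<mu>) = (\<integral>\<^sup>+x. f (mat_adj x) \<partial>\<mu>)"
      using is_haar_AE[OF n]
    proof eventually_elim
      fix y :: "complex^'m^'m" assume y: "is_unitary_mat y"
      have "mat_adj x ** y = mat_adj (mat_adj y ** x)" for x by (simp add: mat_adj_mult)
      then show "(\<integral>\<^sup>+x. f (mat_adj x ** y) \<partial>\<mu>) = (\<integral>\<^sup>+x. f (mat_adj x) \<partial>\<mu>)"
        using is_haar_left[OF m unitary_adj[OF y], of "\<lambda>x. f (mat_adj x)"] by simp
    qed
  qed
  also have "\<dots> = (\<integral>\<^sup>+x. f (mat_adj x) \<partial>\<mu>)" by (simp add: \<nu>.emeasure_space_1)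
  finally have 2: "(\<integral>\<^sup>+y. (\<integral>\<^sup>+x. f (mat_adj x ** y) \<partial>\<mu>) \<partial>\<nu>) = (\<integral>\<^sup>+x. f (mat_adj x) \<partial>\<mu>)" .
  have "(\<integral>\<^sup>+y. (\<integral>\<^sup>+x. f (mat_adj x ** y) \<partial>\<mu>) \<partial>\<nu>) = (\<integral>\<^sup>+x. (\<integral>\<^sup>+y. f (mat_adj x ** y) \<partial>\<nu>) \<partial>\<mu>)"
    by (rule Fubini') measurable
  then show ?thesis using 1 2 by simp
qed

text \<open>By \<open>is_haar_adj\<close> both measures equal the image of \<mu> under the
  adjoint.\<close>

lemma is_haar_unique:
  assumes m: "is_haar \<mu>" and n: "is_haar \<nu>" shows "\<mu> = \<nu>"
proof (rule measure_eqI)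
  show "sets \<mu> = sets \<nu>" using m n by (simp add: is_haar_def)
  fix A assume "A \<in> sets \<mu>"
  then have [measurable]: "A \<in> sets borel" and A: "A \<in> sets \<mu>" "A \<in> sets \<nu>" using m n by (auto simp: is_haar_def)
  show "emeasure \<mu> A = emeasure \<nu> A"
    using is_haar_adj[OF m m, of "indicator A"] is_haar_adj[OF m n, of "indicator A"] A by simp
qed

lemma is_haar_haar: "is_haar (haar_unitary :: (complex^'m^'m) measure)"
proof -
  have "haar_unitary = (THE \<mu> :: (complex^'m^'m) measure. is_haar \<mu>)"
    unfolding haar_unitary_def is_haar_def ..
  then show ?thesis using haar_exists is_haar_unique by (metis (mono_tags, lifting) theI)
qed

lemma sets_haar [measurable_cong, simp]: "sets haar_unitary = sets borel"
  by (rule is_haar_haar[unfolded is_haar_def, THEN conjunct2, THEN conjunct1])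

lemma space_haar [simp]: "space haar_unitary = UNIV"
  using sets_eq_imp_space_eq[OF sets_haar] by simp

lemma prob_space_haar: "prob_space haar_unitary"
  by (rule is_haar_haar[unfolded is_haar_def, THEN conjunct1])

lemma AE_haar: "AE U in haar_unitary. is_unitary_mat U"
  by (rule is_haar_AE[OF is_haar_haar])

lemma distr_haar_adj: "distr haar_unitary borel mat_adj = haar_unitary"
proof (rule measure_eqI)
  fix A assume "A \<in> sets (distr haar_unitary borel mat_adj)"
  then have [measurable]: "A \<in> sets borel" by simp
  have [measurable]: "mat_adj \<in> borel_measurable borel" by (rule borel_mat_adj) simp
  have "emeasure (distr haar_unitary borel mat_adj) A = (\<integral>\<^sup>+U. indicator A U \<partial>distr haar_unitary borel mat_adj)"
    by simp
  also have "\<dots> = (\<integral>\<^sup>+U. indicator A (mat_adj U) \<partial>haar_unitary)" by (subst nn_integral_distr) auto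
  also have "\<dots> = emeasure haar_unitary A"
    using is_haar_adj[OF is_haar_haar is_haar_haar, of "indicator A"] by simp
  finally show "emeasure (distr haar_unitary borel mat_adj) A = emeasure haar_unitary A" .
qed simp

text \<open>Right multiplication by V is left multiplication by its adjoint conjugated with
  \<open>mat_adj\<close>, which preserves Haar measure.\<close>

lemma haar_right:
  fixes f :: "complex^'m^'m \<Rightarrow> 'b::{banach, second_countable_topology}"
  assumes V: "is_unitary_mat V" and [measurable]: "f \<in> borel_measurable borel"
  shows "(LINT U|haar_unitary. f (U ** V)) = (LINT U|haar_unitary. f U)"
proof -
  have [measurable]: "(mat_adj :: complex^'m^'m \<Rightarrow> _) \<in> borel_measurable borel" by (rule borel_mat_adj) simp
  have d: "distr haar_unitary borel (\<lambda>U. mat_adj V ** U) = haar_unitary"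
    using is_haar_haar[where ?'m = 'm] unitary_adj[OF V] by (simp add: is_haar_def)
  have "(LINT U|haar_unitary. f (U ** V)) = (LINT U|distr haar_unitary borel mat_adj. f (U ** V))"
    by (simp only: distr_haar_adj)
  also have "\<dots> = (LINT U|haar_unitary. f (mat_adj (mat_adj V ** U)))"
    by (subst integral_distr) (auto simp: mat_adj_mult)
  also have "\<dots> = (LINT U|distr haar_unitary borel (\<lambda>U. mat_adj V ** U). f (mat_adj U))"
    by (subst integral_distr) auto
  also have "\<dots> = (LINT U|haar_unitary. f (mat_adj U))" by (simp only: d)
  also have "\<dots> = (LINT U|distr haar_unitary borel mat_adj. f U)" by (subst integral_distr) auto
  finally show ?thesis by (simp only: distr_haar_adj)
qed

subsection \<open>Differentiating along right translations\<close>

definition mat_cscale :: "complex \<Rightarrow> complex^'m^'m \<Rightarrow> complex^'m^'m" where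
  "mat_cscale c A = (\<chi> i j. c * A $ i $ j)"

lemma mat_cscale_nth [simp]: "mat_cscale c A $ i $ j = c * A $ i $ j"
  by (simp add: mat_cscale_def)

lemma mat_cscale_mult_left: "mat_cscale c A ** B = mat_cscale c (A ** B)"
  by (simp add: vec_eq_iff matrix_matrix_mult_def sum_distrib_left mult.assoc)

lemma mat_cscale_mult_right: "A ** mat_cscale c B = mat_cscale c (A ** B)"
  by (simp add: vec_eq_iff matrix_matrix_mult_def sum_distrib_left mult.left_commute)

definition proj_mat :: "complex^'m^'m \<Rightarrow> bool" where
  "proj_mat R \<longleftrightarrow> R ** R = R \<and> mat_adj R = R"

text \<open>For a projection \<open>R\<close> this is \<open>exp (\<i> t R)\<close>.\<close>

definition phase :: "complex^'m^'m \<Rightarrow> real \<Rightarrow> complex^'m^'m" where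
  "phase R t = mat 1 + mat_cscale (cis t - 1) R"

lemma phase_unitary:
  assumes "proj_mat R" shows "is_unitary_mat (phase R t)"
proof -
  have a: "mat_adj (phase R t) = mat 1 + mat_cscale (cnj (cis t) - 1) R"
  proof -
    have "mat_adj (phase R t) = mat_adj (mat 1) + mat_cscale (cnj (cis t) - 1) (mat_adj R)"
      by (simp add: phase_def mat_adj_def vec_eq_iff)
    then show ?thesis using assms by (simp add: proj_mat_def)
  qed
  have "mat_adj (phase R t) ** phase R t
    = mat 1 + mat_cscale (cis t - 1) R + (mat_cscale (cnj (cis t) - 1) R + mat_cscale ((cnj (cis t) - 1) * (cis t - 1)) (R ** R))"
    unfolding a unfolding phase_def mm.add_left mm.add_right mat_cscale_mult_left mat_cscale_mult_right
    by (simp add: vec_eq_iff algebra_simps)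
  also have "R ** R = R" using assms by (simp add: proj_mat_def)
  also have "mat 1 + mat_cscale (cis t - 1) R + (mat_cscale (cnj (cis t) - 1) R + mat_cscale ((cnj (cis t) - 1) * (cis t - 1)) R) = mat 1"
  proof -
    have "cis t * cnj (cis t) = 1" by (simp add: cis_cnj cis_mult)
    then have "(cis t - 1) + ((cnj (cis t) - 1) + (cnj (cis t) - 1) * (cis t - 1)) = 0"
      by (simp add: algebra_simps)
    then have "(cis t - 1) * z + ((cnj (cis t) - 1) * z + (cnj (cis t) - 1) * (cis t - 1) * z) = 0" for z
      by (metis distrib_right mult_zero_left)
    then show ?thesis by (simp add: vec_eq_iff add.assoc del: mult_eq_0_iff)
  qed
  finally show ?thesis by (simp add: is_unitary_mat_def)
qed

lemma cis_taylor: "t \<ge> 0 \<Longrightarrow> cmod (cis t - 1 - \<i> * of_real t) \<le> t\<^sup>2"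
  using Taylor_exp[of "\<i> * of_real t" 1] by (simp add: cis_conv_exp norm_mult algebra_simps power2_eq_square)

text \<open>Bounds are asked for on unitary matrices, since nonconstant polynomials in the entries
  are unbounded elsewhere; Haar measure is concentrated there, so integrability follows.\<close>

definition unitary_bdd :: "(complex^'m^'m \<Rightarrow> complex) \<Rightarrow> bool" where
  "unitary_bdd F \<longleftrightarrow> F \<in> borel_measurable borel \<and> (\<exists>C. \<forall>U. is_unitary_mat U \<longrightarrow> cmod (F U) \<le> C)"

lemma unitary_bdd_const: "unitary_bdd (\<lambda>U. c)"
  by (auto simp: unitary_bdd_def)

lemma unitary_bdd_add: "unitary_bdd F \<Longrightarrow> unitary_bdd G \<Longrightarrow> unitary_bdd (\<lambda>U. F U + G U)"
  unfolding unitary_bdd_def by (auto, meson add_mono norm_triangle_ineq order_trans)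

lemma unitary_bdd_mult: assumes "unitary_bdd F" "unitary_bdd G" shows "unitary_bdd (\<lambda>U. F U * G U)"
proof -
  obtain A B where A: "\<And>U. is_unitary_mat U \<Longrightarrow> cmod (F U) \<le> A" and B: "\<And>U. is_unitary_mat U \<Longrightarrow> cmod (G U) \<le> B"
    using assms unfolding unitary_bdd_def by blast
  have "cmod (F U * G U) \<le> \<bar>A\<bar> * \<bar>B\<bar>" if "is_unitary_mat U" for U
    unfolding norm_mult using A[OF that] B[OF that] by (intro mult_mono) auto
  moreover have "(\<lambda>U. F U * G U) \<in> borel_measurable borel"
    using assms by (auto simp: unitary_bdd_def)
  ultimately show ?thesis unfolding unitary_bdd_def by blast
qed

lemma unitary_bdd_uminus: "unitary_bdd F \<Longrightarrow> unitary_bdd (\<lambda>U. - F U)"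
  by (simp add: unitary_bdd_def)

lemma unitary_bdd_diff: "unitary_bdd F \<Longrightarrow> unitary_bdd G \<Longrightarrow> unitary_bdd (\<lambda>U. F U - G U)"
  using unitary_bdd_add[OF _ unitary_bdd_uminus, of F G] by simp

lemma unitary_bdd_sum: "(\<And>i. i \<in> A \<Longrightarrow> unitary_bdd (F i)) \<Longrightarrow> unitary_bdd (\<lambda>U. \<Sum>i\<in>A. F i U)"
  by (induction A rule: infinite_finite_induct) (auto intro: unitary_bdd_const unitary_bdd_add)

lemma unitary_entry_le: assumes "is_unitary_mat (U :: complex^'m^'m)" shows "cmod (U $ i $ j) \<le> 1"
proof -
  have "(\<Sum>k\<in>UNIV. (cmod (U $ k $ j))\<^sup>2) = Re ((mat_adj U ** U) $ j $ j)"
    by (simp add: mat_adj_def matrix_matrix_mult_def cmod_power2) (simp add: power2_eq_square)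
  also have "\<dots> = 1" using assms by (simp add: is_unitary_mat_def mat_def)
  finally have "(cmod (U $ i $ j))\<^sup>2 \<le> 1\<^sup>2"
    using member_le_sum[of i UNIV "\<lambda>k. (cmod (U $ k $ j))\<^sup>2"] by simp
  then show ?thesis by (rule power2_le_imp_le) simp
qed

lemma unitary_bdd_entry: "unitary_bdd (\<lambda>U. U $ i $ j)"
  unfolding unitary_bdd_def using unitary_entry_le
  by (intro conjI borel_measurable_continuous_onI continuous_intros) blast

lemma unitary_bdd_cnj: assumes "unitary_bdd F" shows "unitary_bdd (\<lambda>U. cnj (F U))"
proof -
  have "cnj \<in> borel_measurable borel"
    by (intro borel_measurable_continuous_onI continuous_on_cnj continuous_on_id)
  then have "(\<lambda>U. cnj (F U)) \<in> borel_measurable borel"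
    using assms measurable_compose[of F borel borel cnj borel] by (simp add: unitary_bdd_def)
  then show ?thesis using assms by (simp add: unitary_bdd_def)
qed

lemma unitary_bdd_integrable: assumes "unitary_bdd F" shows "integrable haar_unitary F"
proof -
  interpret prob_space "haar_unitary :: (complex^'a^'a) measure" by (rule prob_space_haar)
  obtain C where C: "\<And>U. is_unitary_mat U \<Longrightarrow> cmod (F U) \<le> C" using assms unfolding unitary_bdd_def by blast
  have "AE U in haar_unitary. cmod (F U) \<le> C" using AE_haar by eventually_elim (rule C)
  moreover have "F \<in> borel_measurable haar_unitary"
    using assms by (simp add: unitary_bdd_def measurable_cong_sets[OF sets_haar refl])
  ultimately show ?thesis by (rule integrable_const_bound)
qed

definition clin :: "(complex^'m^'m \<Rightarrow> complex) \<Rightarrow> bool" where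
  "clin f \<longleftrightarrow> (\<forall>X Y. f (X + Y) = f X + f Y) \<and> (\<forall>c X. f (mat_cscale c X) = c * f X)"

text \<open>\<open>dpair F D\<close>: the derivative of \<open>F\<close> along \<open>t \<mapsto> U exp (\<i> t R)\<close> is \<open>D U (\<i> R)\<close>, uniformly in the
  unitary matrix \<open>U\<close>. Orthogonal projections \<open>R\<close> suffice because they span all matrices over the complex numbers.\<close>

definition dpair :: "(complex^'m^'m \<Rightarrow> complex) \<Rightarrow> (complex^'m^'m \<Rightarrow> complex^'m^'m \<Rightarrow> complex) \<Rightarrow> bool" where
  "dpair F D \<longleftrightarrow> unitary_bdd F \<and> (\<forall>X. unitary_bdd (\<lambda>U. D U X)) \<and> (\<forall>U. clin (D U)) \<and>
    (\<forall>R. proj_mat R \<longrightarrow> (\<exists>C. \<forall>U t. is_unitary_mat U \<longrightarrow> 0 \<le> t \<longrightarrow> t \<le> 1 \<longrightarrow>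
       cmod (F (U ** phase R t) - F U - of_real t * D U (mat_cscale \<i> R)) \<le> C * t\<^sup>2))"

lemma dpair_base:
  assumes "dpair F D"
  shows "unitary_bdd F" "\<forall>X. unitary_bdd (\<lambda>U. D U X)" "\<forall>U. clin (D U)"
  using assms by (auto simp: dpair_def)

definition jet where
  "jet F D R C \<longleftrightarrow> (\<forall>U t. is_unitary_mat U \<longrightarrow> 0 \<le> t \<longrightarrow> t \<le> 1 \<longrightarrow>
       cmod (F (U ** phase R t) - F U - of_real t * D U (mat_cscale \<i> R)) \<le> C * t\<^sup>2)"

lemma jetD: "jet F D R C \<Longrightarrow> is_unitary_mat U \<Longrightarrow> 0 \<le> t \<Longrightarrow> t \<le> 1 \<Longrightarrow>
       cmod (F (U ** phase R t) - F U - of_real t * D U (mat_cscale \<i> R)) \<le> C * t\<^sup>2"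
  by (simp add: jet_def)

lemma dpairD:
  assumes "dpair F D" "proj_mat R"
  shows "\<exists>C\<ge>0. jet F D R C"
proof -
  obtain C where C: "\<forall>U t. is_unitary_mat U \<longrightarrow> 0 \<le> t \<longrightarrow> t \<le> 1 \<longrightarrow>
       cmod (F (U ** phase R t) - F U - of_real t * D U (mat_cscale \<i> R)) \<le> C * t\<^sup>2"
    using assms unfolding dpair_def by blast
  show ?thesis unfolding jet_def
  proof (intro exI[of _ "\<bar>C\<bar>"] conjI allI impI)
    fix U :: "complex^'a^'a" and t :: real
    assume "is_unitary_mat U" "0 \<le> t" "t \<le> 1"
    then have "cmod (F (U ** phase R t) - F U - of_real t * D U (mat_cscale \<i> R)) \<le> C * t\<^sup>2"
      using C by blast
    also have "\<dots> \<le> \<bar>C\<bar> * t\<^sup>2" by (intro mult_right_mono) auto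
    finally show "cmod (F (U ** phase R t) - F U - of_real t * D U (mat_cscale \<i> R)) \<le> \<bar>C\<bar> * t\<^sup>2" .
  qed simp
qed

lemma dpair_const: "dpair (\<lambda>U. c) (\<lambda>U X. 0)"
  unfolding dpair_def
proof (intro conjI allI impI)
  show "\<exists>C. \<forall>U t. is_unitary_mat U \<longrightarrow> 0 \<le> t \<longrightarrow> t \<le> 1 \<longrightarrow>
       cmod (c - c - of_real t * 0) \<le> C * t\<^sup>2"
    by (rule exI[of _ 0]) simp
qed (simp_all add: unitary_bdd_const clin_def)

lemma dpair_add:
  assumes "dpair F D" "dpair G E" shows "dpair (\<lambda>U. F U + G U) (\<lambda>U X. D U X + E U X)"
  unfolding dpair_def
proof (intro conjI allI impI)
  fix R :: "complex^'a^'a" assume R: "proj_mat R"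
  obtain A where A0: "A \<ge> 0" and Aj: "jet F D R A" using dpairD[OF assms(1) R] by blast
  note A = jetD[OF Aj]
  obtain B where B0: "B \<ge> 0" and Bj: "jet G E R B" using dpairD[OF assms(2) R] by blast
  note B = jetD[OF Bj]
  show "\<exists>C. \<forall>U t. is_unitary_mat U \<longrightarrow> 0 \<le> t \<longrightarrow> t \<le> 1 \<longrightarrow>
       cmod (F (U ** phase R t) + G (U ** phase R t) - (F U + G U) - of_real t * (D U (mat_cscale \<i> R) + E U (mat_cscale \<i> R))) \<le> C * t\<^sup>2"
  proof (intro exI[of _ "A + B"] allI impI)
    fix U :: "complex^'a^'a" and t :: real
    assume h: "is_unitary_mat U" "0 \<le> t" "t \<le> 1"
    have "F (U ** phase R t) + G (U ** phase R t) - (F U + G U) - of_real t * (D U (mat_cscale \<i> R) + E U (mat_cscale \<i> R))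
      = (F (U ** phase R t) - F U - of_real t * D U (mat_cscale \<i> R)) + (G (U ** phase R t) - G U - of_real t * E U (mat_cscale \<i> R))"
      by (simp add: algebra_simps)
    also have "cmod \<dots> \<le> A * t\<^sup>2 + B * t\<^sup>2" by (rule norm_triangle_mono[OF A[OF h] B[OF h]])
    finally show "cmod (F (U ** phase R t) + G (U ** phase R t) - (F U + G U) - of_real t * (D U (mat_cscale \<i> R) + E U (mat_cscale \<i> R))) \<le> (A + B) * t\<^sup>2"
      by (simp add: distrib_right)
  qed
qed (use dpair_base[OF assms(1)] dpair_base[OF assms(2)] in \<open>auto simp: clin_def algebra_simps intro: unitary_bdd_add\<close>)

lemma dpair_mult:
  assumes "dpair F D" "dpair G E" shows "dpair (\<lambda>U. F U * G U) (\<lambda>U X. D U X * G U + F U * E U X)"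
  unfolding dpair_def
proof (intro conjI allI impI)
  fix R :: "complex^'a^'a" assume R: "proj_mat R"
  obtain A where A0: "A \<ge> 0" and Aj: "jet F D R A" using dpairD[OF assms(1) R] by blast
  note A2 = jetD[OF Aj]
  obtain B where B0: "B \<ge> 0" and Bj: "jet G E R B" using dpairD[OF assms(2) R] by blast
  note B2 = jetD[OF Bj]
  obtain f where f: "\<And>U. is_unitary_mat U \<Longrightarrow> cmod (F U) \<le> f" using dpair_base(1)[OF assms(1)] unfolding unitary_bdd_def by blast
  obtain g where g: "\<And>U. is_unitary_mat U \<Longrightarrow> cmod (G U) \<le> g" using dpair_base(1)[OF assms(2)] unfolding unitary_bdd_def by blast
  obtain d where d: "\<And>U. is_unitary_mat U \<Longrightarrow> cmod (D U (mat_cscale \<i> R)) \<le> d" using dpair_base(2)[OF assms(1)] unfolding unitary_bdd_def by blast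
  obtain e where e: "\<And>U. is_unitary_mat U \<Longrightarrow> cmod (E U (mat_cscale \<i> R)) \<le> e" using dpair_base(2)[OF assms(2)] unfolding unitary_bdd_def by blast
  show "\<exists>C. \<forall>U t. is_unitary_mat U \<longrightarrow> 0 \<le> t \<longrightarrow> t \<le> 1 \<longrightarrow>
       cmod (F (U ** phase R t) * G (U ** phase R t) - F U * G U - of_real t * (D U (mat_cscale \<i> R) * G U + F U * E U (mat_cscale \<i> R))) \<le> C * t\<^sup>2"
  proof (intro exI[of _ "A * \<bar>g\<bar> + (\<bar>f\<bar> * B + \<bar>d\<bar> * (B + \<bar>e\<bar>))"] allI impI)
    fix U :: "complex^'a^'a" and t :: real
    assume h: "is_unitary_mat U" "0 \<le> t" "t \<le> 1"
    let ?V = "U ** phase R t"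
    have V: "is_unitary_mat ?V" by (intro unitary_mult h phase_unitary R)
    let ?f = "F ?V - F U - of_real t * D U (mat_cscale \<i> R)" and ?g = "G ?V - G U - of_real t * E U (mat_cscale \<i> R)"
    have t2: "t\<^sup>2 \<le> t" using h by (simp add: power2_eq_square mult_left_le)
    have 1: "cmod (?f * G ?V) \<le> (A * t\<^sup>2) * \<bar>g\<bar>"
      unfolding norm_mult using A2[OF h] g[OF V] A0 by (intro mult_mono) auto
    have 2: "cmod (F U * ?g) \<le> \<bar>f\<bar> * (B * t\<^sup>2)"
      unfolding norm_mult using B2[OF h] f[OF h(1)] B0 by (intro mult_mono) auto
    have "cmod (G ?V - G U) = cmod (?g + of_real t * E U (mat_cscale \<i> R))" by simp
    also have "\<dots> \<le> B * t\<^sup>2 + t * \<bar>e\<bar>"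
    proof (rule norm_triangle_mono[OF B2[OF h]])
      show "cmod (of_real t * E U (mat_cscale \<i> R)) \<le> t * \<bar>e\<bar>"
        unfolding norm_mult using h e[OF h(1)] by (intro mult_mono) auto
    qed
    also have "\<dots> \<le> t * (B + \<bar>e\<bar>)" using mult_left_mono[OF t2 B0] by (simp add: algebra_simps)
    finally have "cmod (of_real t * D U (mat_cscale \<i> R) * (G ?V - G U)) \<le> (t * \<bar>d\<bar>) * (t * (B + \<bar>e\<bar>))"
      unfolding norm_mult using h d[OF h(1)] B0 by (intro mult_mono) auto
    then have 3: "cmod (of_real t * D U (mat_cscale \<i> R) * (G ?V - G U)) \<le> \<bar>d\<bar> * (B + \<bar>e\<bar>) * t\<^sup>2"
      by (simp add: power2_eq_square mult_ac)
    \<comment> \<open>Telescoping: the error of F times the new value of G, the old value of F times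
      the error of G, and a product of two first-order quantities. Each is O(t^2).\<close>
    have "F ?V * G ?V - F U * G U - of_real t * (D U (mat_cscale \<i> R) * G U + F U * E U (mat_cscale \<i> R))
      = ?f * G ?V + (F U * ?g + of_real t * D U (mat_cscale \<i> R) * (G ?V - G U))"
      by (simp add: algebra_simps)
    also have "cmod \<dots> \<le> (A * t\<^sup>2) * \<bar>g\<bar> + (\<bar>f\<bar> * (B * t\<^sup>2) + \<bar>d\<bar> * (B + \<bar>e\<bar>) * t\<^sup>2)"
      by (intro norm_triangle_mono 1 2 3)
    finally show "cmod (F ?V * G ?V - F U * G U - of_real t * (D U (mat_cscale \<i> R) * G U + F U * E U (mat_cscale \<i> R)))
      \<le> (A * \<bar>g\<bar> + (\<bar>f\<bar> * B + \<bar>d\<bar> * (B + \<bar>e\<bar>))) * t\<^sup>2"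
      by (simp add: algebra_simps)
  qed
qed (use dpair_base[OF assms(1)] dpair_base[OF assms(2)] in \<open>auto simp: clin_def algebra_simps intro!: unitary_bdd_add unitary_bdd_mult\<close>)

lemma dpair_sum:
  "(\<And>i. i \<in> A \<Longrightarrow> dpair (F i) (D i)) \<Longrightarrow> dpair (\<lambda>U. \<Sum>i\<in>A. F i U) (\<lambda>U X. \<Sum>i\<in>A. D i U X)"
  by (induction A rule: infinite_finite_induct) (auto intro: dpair_const dpair_add)

lemma dpair_entry: "dpair (\<lambda>U. U $ i $ j) (\<lambda>U X. (U ** X) $ i $ j)"
  unfolding dpair_def
proof (intro conjI allI impI)
  fix X :: "complex^'a^'a"
  show "unitary_bdd (\<lambda>U. (U ** X) $ i $ j)"
    unfolding matrix_matrix_mult_def by (simp) (intro unitary_bdd_sum unitary_bdd_mult unitary_bdd_entry unitary_bdd_const)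
next
  fix R :: "complex^'a^'a" assume R: "proj_mat R"
  obtain C where C: "\<And>U. is_unitary_mat U \<Longrightarrow> cmod ((U ** R) $ i $ j) \<le> C"
  proof -
    have "unitary_bdd (\<lambda>U. (U ** R) $ i $ j)"
      unfolding matrix_matrix_mult_def by (simp) (intro unitary_bdd_sum unitary_bdd_mult unitary_bdd_entry unitary_bdd_const)
    then show ?thesis using that unfolding unitary_bdd_def by blast
  qed
  show "\<exists>C. \<forall>U t. is_unitary_mat U \<longrightarrow> 0 \<le> t \<longrightarrow> t \<le> 1 \<longrightarrow>
       cmod ((U ** phase R t) $ i $ j - U $ i $ j - of_real t * (U ** mat_cscale \<i> R) $ i $ j) \<le> C * t\<^sup>2"
  proof (intro exI[of _ C] allI impI)
    fix U :: "complex^'a^'a" and t :: real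
    assume h: "is_unitary_mat U" "0 \<le> t" "t \<le> 1"
    have "(U ** phase R t) $ i $ j - U $ i $ j - of_real t * (U ** mat_cscale \<i> R) $ i $ j
      = (U ** R) $ i $ j * (cis t - 1 - \<i> * of_real t)"
      unfolding phase_def mm.add_right mat_cscale_mult_right by (simp add: algebra_simps)
    also have "cmod \<dots> \<le> C * t\<^sup>2"
      unfolding norm_mult using C[OF h(1)] cis_taylor[OF h(2)] order_trans[OF norm_ge_zero C[OF h(1)]]
      by (intro mult_mono) auto
    finally show "cmod ((U ** phase R t) $ i $ j - U $ i $ j - of_real t * (U ** mat_cscale \<i> R) $ i $ j) \<le> C * t\<^sup>2" .
  qed
qed (auto simp: clin_def unitary_bdd_entry mm.add_right mat_cscale_mult_right)

text \<open>For X = i R with R selfadjoint, the adjoint of U X is - X U^*. This expression is taken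
  for all X because it is complex linear in X, as \<open>clin\<close> demands, while the adjoint of
  U X is antilinear.\<close>

lemma dpair_adj_entry: "dpair (\<lambda>U. mat_adj U $ i $ j) (\<lambda>U X. - (X ** mat_adj U) $ i $ j)"
  unfolding dpair_def
proof (intro conjI allI impI)
  have e: "unitary_bdd (\<lambda>U. mat_adj U $ k $ l)" for k l
    unfolding mat_adj_def by (simp add: unitary_bdd_cnj unitary_bdd_entry)
  show "unitary_bdd (\<lambda>U. mat_adj U $ i $ j)" by (rule e)
  have b: "unitary_bdd (\<lambda>U. (X ** mat_adj U) $ i $ j)" for X
    unfolding matrix_matrix_mult_def by (simp) (intro unitary_bdd_sum unitary_bdd_mult e unitary_bdd_const)
  then show "unitary_bdd (\<lambda>U. - (X ** mat_adj U) $ i $ j)" for X by (rule unitary_bdd_uminus)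
  fix R :: "complex^'a^'a" assume R: "proj_mat R"
  obtain C where C: "\<And>U. is_unitary_mat U \<Longrightarrow> cmod ((R ** mat_adj U) $ i $ j) \<le> C"
    using b[of R] unfolding unitary_bdd_def by blast
  show "\<exists>C. \<forall>U t. is_unitary_mat U \<longrightarrow> 0 \<le> t \<longrightarrow> t \<le> 1 \<longrightarrow>
       cmod (mat_adj (U ** phase R t) $ i $ j - mat_adj U $ i $ j - of_real t * - (mat_cscale \<i> R ** mat_adj U) $ i $ j) \<le> C * t\<^sup>2"
  proof (intro exI[of _ C] allI impI)
    fix U :: "complex^'a^'a" and t :: real
    assume h: "is_unitary_mat U" "0 \<le> t" "t \<le> 1"
    have a: "mat_adj (phase R t) = mat 1 + mat_cscale (cnj (cis t) - 1) R"
    proof -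
      have "mat_adj (phase R t) = mat_adj (mat 1) + mat_cscale (cnj (cis t) - 1) (mat_adj R)"
        by (simp add: phase_def mat_adj_def vec_eq_iff)
      then show ?thesis using R by (simp add: proj_mat_def)
    qed
    have "mat_adj (U ** phase R t) $ i $ j - mat_adj U $ i $ j - of_real t * - (mat_cscale \<i> R ** mat_adj U) $ i $ j
      = (R ** mat_adj U) $ i $ j * cnj (cis t - 1 - \<i> * of_real t)"
      unfolding mat_adj_mult a mm.add_left mat_cscale_mult_left by (simp add: algebra_simps)
    also have "cmod \<dots> \<le> C * t\<^sup>2"
      unfolding norm_mult complex_mod_cnj using C[OF h(1)] cis_taylor[OF h(2)] order_trans[OF norm_ge_zero C[OF h(1)]]
      by (intro mult_mono) auto
    finally show "cmod (mat_adj (U ** phase R t) $ i $ j - mat_adj U $ i $ j - of_real t * - (mat_cscale \<i> R ** mat_adj U) $ i $ j) \<le> C * t\<^sup>2" .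
  qed
qed (auto simp: clin_def mm.add_left mat_cscale_mult_left algebra_simps)

text \<open>Right invariance gives F the same mean before and after the translation, so t |I| is at
  most C t^2, where I is the mean of the derivative. Let t tend to 0.\<close>

lemma dpair_integral_proj:
  assumes D: "dpair F D" and R: "proj_mat R"
  shows "(LINT U|haar_unitary. D U (mat_cscale \<i> R)) = 0"
proof -
  interpret prob_space "haar_unitary :: (complex^'a^'a) measure" by (rule prob_space_haar)
  obtain C where C1: "C \<ge> 0" and Cj: "jet F D R C" using dpairD[OF D R] by blast
  note C = jetD[OF Cj]
  let ?I = "LINT U|haar_unitary. D U (mat_cscale \<i> R)"
  have F: "unitary_bdd F" and Dx: "unitary_bdd (\<lambda>U. D U (mat_cscale \<i> R))" using dpair_base[OF D] by auto
  have "cmod ?I \<le> C * t" if t: "0 < t" "t \<le> 1" for t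
  proof -
    have u: "is_unitary_mat (phase R t)" by (rule phase_unitary[OF R])
    have FV: "unitary_bdd (\<lambda>U. F (U ** phase R t))"
    proof -
      have [measurable]: "F \<in> borel_measurable borel" using F by (simp add: unitary_bdd_def)
      show ?thesis using F unitary_mult[OF _ u] unfolding unitary_bdd_def by (auto; blast)
    qed
    have "(LINT U|haar_unitary. F (U ** phase R t) - F U - of_real t * D U (mat_cscale \<i> R)) = - of_real t * ?I"
      using haar_right[OF u, of F] F unitary_bdd_integrable[OF F] unitary_bdd_integrable[OF FV] unitary_bdd_integrable[OF Dx]
      by (simp add: unitary_bdd_def)
    then have "t * cmod ?I = cmod (LINT U|haar_unitary. F (U ** phase R t) - F U - of_real t * D U (mat_cscale \<i> R))"
      using t by (simp add: norm_mult)
    also have "\<dots> \<le> (LINT U|haar_unitary. cmod (F (U ** phase R t) - F U - of_real t * D U (mat_cscale \<i> R)))"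
      by (rule integral_norm_bound)
    also have "\<dots> \<le> (LINT U|(haar_unitary :: (complex^'a^'a) measure). C * t\<^sup>2)"
    proof (rule integral_mono_AE)
      show "AE U in haar_unitary. cmod (F (U ** phase R t) - F U - of_real t * D U (mat_cscale \<i> R)) \<le> C * t\<^sup>2"
        using AE_haar by eventually_elim (use t in \<open>auto intro: C\<close>)
      have "unitary_bdd (\<lambda>U. F (U ** phase R t) - F U - of_real t * D U (mat_cscale \<i> R))"
        by (intro unitary_bdd_diff unitary_bdd_mult unitary_bdd_const F FV Dx)
      then show "integrable haar_unitary (\<lambda>U. cmod (F (U ** phase R t) - F U - of_real t * D U (mat_cscale \<i> R)))"
        by (intro integrable_norm unitary_bdd_integrable)
    qed simp
    also have "\<dots> = t * (C * t)" using prob_space by (simp add: power2_eq_square)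
    finally show ?thesis using t by (simp add: mult_le_cancel_left_pos)
  qed
  note * = this
  have "cmod ?I \<le> 0"
  proof (rule field_le_epsilon)
    fix e :: real assume e: "e > 0"
    define t where "t = min 1 (e / (C + 1))"
    have t: "0 < t" "t \<le> 1" using e C1 by (auto simp: t_def)
    have "C * t \<le> (C + 1) * (e / (C + 1))" using C1 e by (intro mult_mono) (auto simp: t_def)
    also have "\<dots> = e" using C1 by simp
    finally show "cmod ?I \<le> 0 + e" using *[OF t] by simp
  qed
  then show ?thesis by simp
qed

definition unit_mat :: "'m \<Rightarrow> 'm \<Rightarrow> complex^'m^'m" where
  "unit_mat k l = (\<chi> i j. if i = k \<and> j = l then 1 else 0)"

lemma unit_mat_mult: "unit_mat k l ** unit_mat k' l' = (if l = k' then unit_mat k l' else 0)"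
  by (auto simp: vec_eq_iff unit_mat_def matrix_matrix_mult_def if_distrib[where f = "\<lambda>x. x * _"] cong: if_cong)

lemma mat_adj_unit_mat: "mat_adj (unit_mat k l) = unit_mat l k"
  by (auto simp: vec_eq_iff unit_mat_def mat_adj_def)

lemma dpair_integral_unit_mat:
  assumes D: "dpair F D"
  shows "(LINT U|haar_unitary. D U (unit_mat k l)) = 0"
proof -
  have lin: "clin (D U)" for U using D by (simp add: dpair_def)
  have int: "integrable haar_unitary (\<lambda>U. D U X)" for X
    using D by (intro unitary_bdd_integrable) (simp add: dpair_def)
  have P: "(LINT U|haar_unitary. D U R) = 0" if "proj_mat R" for R
  proof -
    have "D U R = - \<i> * D U (mat_cscale \<i> R)" for U using lin[of U] by (simp add: clin_def)
    then show ?thesis using dpair_integral_proj[OF D that] int by simp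
  qed
  have kk: "proj_mat (unit_mat k k)" for k :: 'a
    by (simp add: proj_mat_def unit_mat_mult mat_adj_unit_mat)
  show ?thesis
  proof (cases "k = l")
    case True then show ?thesis using P[OF kk] by simp
  next
    case False
    \<comment> \<open>Polarization: \<open>R1\<close> and \<open>R2\<close> project onto the lines
      of e_k + e_l and e_k + i e_l, and R1 + i R2 differs from the matrix unit only by diagonal
      matrix units.\<close>
    define R1 where "R1 = mat_cscale (1/2) (unit_mat k k + unit_mat l l + unit_mat k l + unit_mat l k)"
    define R2 where "R2 = mat_cscale (1/2) (unit_mat k k + unit_mat l l + mat_cscale (- \<i>) (unit_mat k l) + mat_cscale \<i> (unit_mat l k))"
    have r: "proj_mat R1" "proj_mat R2" unfolding proj_mat_def
    proof -
      have adj: "mat_adj (A + B) = mat_adj A + mat_adj B" "mat_adj (mat_cscale c A) = mat_cscale (cnj c) (mat_adj A)"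
        for A B :: "complex^'a^'a" and c by (simp_all add: mat_adj_def vec_eq_iff)
      have kl: "unit_mat k k ** unit_mat l l = 0" "unit_mat l l ** unit_mat k k = 0" "unit_mat k k ** unit_mat l k = 0"
        "unit_mat l l ** unit_mat k l = 0" "unit_mat k l ** unit_mat k k = 0" "unit_mat l k ** unit_mat l l = 0"
        "unit_mat k l ** unit_mat k l = 0" "unit_mat l k ** unit_mat l k = 0"
        using False by (simp_all add: unit_mat_mult)
      have kk: "unit_mat i j ** unit_mat j i' = unit_mat i i'" for i j i' :: 'a by (simp add: unit_mat_mult)
      show "R1 ** R1 = R1 \<and> mat_adj R1 = R1" "R2 ** R2 = R2 \<and> mat_adj R2 = R2"
        unfolding R1_def R2_def adj mat_adj_unit_mat mm.add_left mm.add_right mat_cscale_mult_left mat_cscale_mult_right kl kk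
        by (simp_all add: vec_eq_iff algebra_simps)
    qed
    have "unit_mat k l = R1 + mat_cscale \<i> R2 + mat_cscale (- (1 + \<i>) / 2) (unit_mat k k + unit_mat l l)"
      by (auto simp: vec_eq_iff R1_def R2_def field_simps)
    then have "D U (unit_mat k l) = D U R1 + \<i> * D U R2 + (- (1 + \<i>) / 2) * (D U (unit_mat k k) + D U (unit_mat l l))" for U
      using lin[of U] by (simp add: clin_def)
    then show ?thesis using int P[OF r(1)] P[OF r(2)] P[OF kk[of k]] P[OF kk[of l]]
      by simp
  qed
qed

subsection \<open>Loop equations for the Haar measure\<close>

definition mpair :: "(complex^'m^'m \<Rightarrow> complex^'m^'m) \<Rightarrow> (complex^'m^'m \<Rightarrow> complex^'m^'m \<Rightarrow> complex^'m^'m) \<Rightarrow> bool" where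
  "mpair M DM \<longleftrightarrow> (\<forall>i j. dpair (\<lambda>U. M U $ i $ j) (\<lambda>U X. DM U X $ i $ j))"

lemma mpair_const: "mpair (\<lambda>U. A) (\<lambda>U X. 0)"
  by (simp add: mpair_def dpair_const)

lemma mpair_id: "mpair (\<lambda>U. U) (\<lambda>U X. U ** X)"
  by (simp add: mpair_def dpair_entry)

lemma mpair_adj: "mpair mat_adj (\<lambda>U X. - (X ** mat_adj U))"
  by (simp add: mpair_def dpair_adj_entry)

lemma mpair_mult:
  assumes "mpair M DM" "mpair K DK"
  shows "mpair (\<lambda>U. M U ** K U) (\<lambda>U X. DM U X ** K U + M U ** DK U X)"
  unfolding mpair_def
proof (intro allI)
  fix i j
  have "dpair (\<lambda>U. \<Sum>k\<in>UNIV. M U $ i $ k * K U $ k $ j)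
     (\<lambda>U X. \<Sum>k\<in>UNIV. DM U X $ i $ k * K U $ k $ j + M U $ i $ k * DK U X $ k $ j)"
    using assms by (intro dpair_sum dpair_mult) (auto simp: mpair_def)
  then show "dpair (\<lambda>U. (M U ** K U) $ i $ j) (\<lambda>U X. (DM U X ** K U + M U ** DK U X) $ i $ j)"
    by (simp add: matrix_matrix_mult_def sum.distrib)
qed

lemma mpair_trace: "mpair M DM \<Longrightarrow> dpair (\<lambda>U. trace (M U)) (\<lambda>U X. trace (DM U X))"
  unfolding trace_def by (intro dpair_sum) (simp add: mpair_def)

primrec mat_pow :: "complex^'m^'m \<Rightarrow> nat \<Rightarrow> complex^'m^'m" where
  "mat_pow C 0 = mat 1"
| "mat_pow C (Suc n) = C ** mat_pow C n"

lemma mat_pow_add: "mat_pow C (m + n) = mat_pow C m ** mat_pow C n"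
  by (induction m) (simp_all add: matrix_mul_assoc)

definition mat_pow_deriv :: "complex^'m^'m \<Rightarrow> complex^'m^'m \<Rightarrow> nat \<Rightarrow> complex^'m^'m" where
  "mat_pow_deriv C d n = (\<Sum>m<n. mat_pow C m ** d ** mat_pow C (n - 1 - m))"

lemma mat_pow_deriv_Suc: "mat_pow_deriv C d (Suc n) = d ** mat_pow C n + C ** mat_pow_deriv C d n"
  unfolding mat_pow_deriv_def by (subst sum.lessThan_Suc_shift) (simp add: mm.sum_right matrix_mul_assoc)

lemma mpair_mat_pow:
  assumes "mpair M DM" shows "mpair (\<lambda>U. mat_pow (M U) n) (\<lambda>U X. mat_pow_deriv (M U) (DM U X) n)"
proof (induction n)
  case 0
  then show ?case by (simp add: mat_pow_deriv_def mpair_const)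
next
  case (Suc n)
  then show ?case using mpair_mult[OF assms Suc] by (simp add: mat_pow_deriv_Suc)
qed

fun cldot :: "(nat \<Rightarrow> complex) \<Rightarrow> (nat \<Rightarrow> complex) \<Rightarrow> nat list \<Rightarrow> complex" where
  "cldot p \<delta> [] = 0"
| "cldot p \<delta> (a # as) = \<delta> a * (\<Prod>b\<leftarrow>as. p b) + p a * cldot p \<delta> as"

text \<open>\<open>loopf\<close> with arbitrary complex numbers in place of the power sums, since
  traces of matrix powers are a priori complex.\<close>

definition cloop :: "(nat \<Rightarrow> complex) \<Rightarrow> nat \<Rightarrow> nat list \<Rightarrow> complex" where
  "cloop p r as = ((\<Sum>m<r. p m * p (r - 1 - m)) - (\<Sum>m<Suc r. p m * p (r - m))) * (\<Prod>a\<leftarrow>as. p a)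
     + cldot p (\<lambda>a. of_nat a * (p (r + a - 1) - p (r + a))) as"

lemma dpair_prod_list:
  assumes "\<And>a. dpair (p a) (D a)"
  shows "dpair (\<lambda>U. \<Prod>a\<leftarrow>as. p a U) (\<lambda>U X. cldot (\<lambda>a. p a U) (\<lambda>a. D a U X) as)"
proof (induction as)
  case Nil
  show ?case using dpair_const[of 1] by simp
next
  case (Cons a as)
  show ?case using dpair_mult[OF assms Cons, of a] by simp
qed

text \<open>For the projection \<open>P\<close> onto the first block of coordinates, \<open>cmom P U a\<close> is the trace of
  \<open>(A\<^sup>* A) ^ a\<close>, where \<open>A\<close> is the upper left block of \<open>U\<close>.\<close>

definition comp_mat :: "complex^'m^'m \<Rightarrow> complex^'m^'m \<Rightarrow> complex^'m^'m" where
  "comp_mat P U = mat_adj U ** P ** U ** P"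

definition cmom :: "complex^'m^'m \<Rightarrow> complex^'m^'m \<Rightarrow> nat \<Rightarrow> complex" where
  "cmom P U a = trace (mat_pow (comp_mat P U) a ** P)"

lemma mpair_comp_mat:
  "mpair (comp_mat P) (\<lambda>U X. ((mat_adj U ** P ** U) ** X - X ** (mat_adj U ** P ** U)) ** P)"
proof -
  have "mpair (\<lambda>U. ((mat_adj U ** P) ** U) ** P)
    (\<lambda>U X. (((- (X ** mat_adj U) ** P + mat_adj U ** 0) ** U + (mat_adj U ** P) ** (U ** X)) ** P + ((mat_adj U ** P) ** U) ** 0))"
    by (intro mpair_mult mpair_adj mpair_const mpair_id)
  moreover have "(((- (X ** mat_adj U) ** P + mat_adj U ** 0) ** U + (mat_adj U ** P) ** (U ** X)) ** P + ((mat_adj U ** P) ** U) ** 0)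
     = ((mat_adj U ** P ** U) ** X - X ** (mat_adj U ** P ** U)) ** P" for X U
    by (simp add: mm.add_left mm.diff_left mm.minus_left mm.zero_right matrix_mul_assoc)
  ultimately show ?thesis by (simp only: comp_mat_def[abs_def])
qed

lemma dpair_cmom:
  "dpair (\<lambda>U. cmom P U a)
     (\<lambda>U X. trace (mat_pow_deriv (comp_mat P U) (((mat_adj U ** P ** U) ** X - X ** (mat_adj U ** P ** U)) ** P) a ** P))"
proof -
  have "mpair (\<lambda>U. mat_pow (comp_mat P U) a ** P)
     (\<lambda>U X. mat_pow_deriv (comp_mat P U) (((mat_adj U ** P ** U) ** X - X ** (mat_adj U ** P ** U)) ** P) a ** P
        + mat_pow (comp_mat P U) a ** 0)"
    by (intro mpair_mult mpair_mat_pow mpair_comp_mat mpair_const)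
  from mpair_trace[OF this] show ?thesis unfolding cmom_def by (simp add: mm.zero_right)
qed

text \<open>The (k, l) entry of A E_kl B is A_kk B_ll. Summation thus splits one product into two
  traces, the source of the quadratic terms of the loop equations.\<close>

lemma sum_unit_mat:
  "(\<Sum>k\<in>UNIV. \<Sum>l\<in>UNIV. (A ** unit_mat k l ** B) $ k $ l) = trace A * trace (B :: complex^'m^'m)"
proof -
  have e: "(A ** unit_mat k l ** B) $ i $ j = A $ i $ k * B $ l $ j" for i j k l
  proof -
    have "(A ** unit_mat k l) $ i $ q = (if q = l then A $ i $ k else 0)" for q
      by (auto simp: matrix_matrix_mult_def unit_mat_def if_distrib[where f = "\<lambda>x. _ * x"] cong: if_cong)
    then show ?thesis
      by (simp add: matrix_matrix_mult_def[of "A ** unit_mat k l"] if_distrib[where f = "\<lambda>x. x * _"] cong: if_cong)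
  qed
  show ?thesis unfolding e trace_def sum_product ..
qed

lemma clin_sum: assumes "clin f" shows "f (\<Sum>i\<in>A. X i) = (\<Sum>i\<in>A. f (X i))"
proof -
  have "f 0 = 0"
  proof -
    have "f (0 + 0) = f 0 + f 0" using assms unfolding clin_def by blast
    then show ?thesis by simp
  qed
  then show ?thesis using assms
    by (induction A rule: infinite_finite_induct) (auto simp: clin_def)
qed

lemma clin_expand:
  assumes "clin f"
  shows "f W = (\<Sum>k\<in>UNIV. \<Sum>l\<in>UNIV. W $ k $ l * f (unit_mat k l))"
proof -
  have "W = (\<Sum>k\<in>UNIV. \<Sum>l\<in>UNIV. mat_cscale (W $ k $ l) (unit_mat k l))"
    unfolding vec_eq_iff
  proof (intro allI)
    fix i j
    have "(\<Sum>k\<in>UNIV. \<Sum>l\<in>UNIV. mat_cscale (W $ k $ l) (unit_mat k l)) $ i $ j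
      = (\<Sum>k\<in>UNIV. if i = k then (\<Sum>l\<in>UNIV. if j = l then W $ k $ l else 0) else 0)"
      unfolding sum_component mat_cscale_nth
      by (intro sum.cong refl) (auto simp: unit_mat_def if_distrib[where f = "\<lambda>x. _ * x"] cong: if_cong)
    then show "W $ i $ j = (\<Sum>k\<in>UNIV. \<Sum>l\<in>UNIV. mat_cscale (W $ k $ l) (unit_mat k l)) $ i $ j" by simp
  qed
  then have "f W = f (\<Sum>k\<in>UNIV. \<Sum>l\<in>UNIV. mat_cscale (W $ k $ l) (unit_mat k l))" by simp
  also have "\<dots> = (\<Sum>k\<in>UNIV. \<Sum>l\<in>UNIV. W $ k $ l * f (unit_mat k l))"
    unfolding clin_sum[OF assms] using assms by (simp add: clin_def)
  finally show ?thesis .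
qed

text \<open>\<open>Q\<close> stands for U^* P U with U unitary and \<open>C\<close> for
  \<open>comp_mat P U\<close>. The last assumption says that P has half the full trace; here the
  size N of the block inside 2 N enters.\<close>

context
  fixes P Q C :: "complex^'m^'m"
  assumes PP: "P ** P = P" and QQ: "Q ** Q = Q" and C: "C = Q ** P" and tr: "trace Q = trace P"
    and tr1: "trace (mat 1 :: complex^'m^'m) = 2 * trace P"
begin

lemma C_P: "C ** P = C" by (simp add: C matrix_mul_assoc[symmetric] PP)
lemma Q_C: "Q ** C = C" by (simp add: C matrix_mul_assoc QQ)

lemma mat_pow_P: "r \<ge> 1 \<Longrightarrow> mat_pow C r ** P = mat_pow C r"
  using mat_pow_add[of C "r - 1" 1] by (simp add: matrix_mul_assoc[symmetric] C_P)

lemma Q_mat_pow: "r \<ge> 1 \<Longrightarrow> Q ** mat_pow C r = mat_pow C r"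
  by (cases r) (simp_all add: matrix_mul_assoc Q_C)

text \<open>In the direction C^r the commutator reduces to C^r - C^(r + 1), because Q C = C and C P
  = C. On eigenvalues this is the field x^r (1 - x).\<close>

lemma trace_mat_pow_deriv_mat_pow:
  assumes "r \<ge> 1"
  shows "trace (mat_pow_deriv C ((Q ** mat_pow C r - mat_pow C r ** Q) ** P) a ** P)
    = of_nat a * (trace (mat_pow C (r + a - 1) ** P) - trace (mat_pow C (r + a) ** P))"
proof -
  have d: "(Q ** mat_pow C r - mat_pow C r ** Q) ** P = mat_pow C r - mat_pow C (Suc r)"
  proof -
    have "mat_pow C r ** Q ** P = mat_pow C r ** C" by (simp add: C matrix_mul_assoc)
    also have "\<dots> = mat_pow C (Suc r)" using mat_pow_add[of C r 1] by simp
    finally show ?thesis by (simp add: Q_mat_pow[OF assms] mm.diff_left mat_pow_P[OF assms])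
  qed
  have "mat_pow C m ** (mat_pow C r - mat_pow C (Suc r)) ** mat_pow C (a - 1 - m) = mat_pow C (r + a - 1) - mat_pow C (r + a)" if "m < a" for m
  proof -
    have "m + r + (a - 1 - m) = r + a - 1" "m + Suc r + (a - 1 - m) = r + a" using that by auto
    then show ?thesis unfolding mm.diff_right mm.diff_left mat_pow_add[symmetric] by simp
  qed
  then have "mat_pow_deriv C ((Q ** mat_pow C r - mat_pow C r ** Q) ** P) a = (\<Sum>m<a. mat_pow C (r + a - 1) - mat_pow C (r + a))"
    unfolding d mat_pow_deriv_def by (intro sum.cong) auto
  then have "mat_pow_deriv C ((Q ** mat_pow C r - mat_pow C r ** Q) ** P) a ** P = (\<Sum>m<a. mat_pow C (r + a - 1) ** P - mat_pow C (r + a) ** P)"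
    by (simp only: mm.sum_left mm.diff_left)
  then have "trace (mat_pow_deriv C ((Q ** mat_pow C r - mat_pow C r ** Q) ** P) a ** P) = (\<Sum>m<a. trace (mat_pow C (r + a - 1) ** P - mat_pow C (r + a) ** P))"
    by (simp only: trace_def sum_component sum.swap[of _ UNIV])
  then show ?thesis by (simp add: trace_sub)
qed

text \<open>The left side is the divergence part of the field U C^r; \<open>sum_unit_mat\<close>
  splits each of its terms into two traces.\<close>

lemma divergence_mat_pow:
  assumes "r \<ge> 1"
  defines "p \<equiv> \<lambda>a. trace (mat_pow C a ** P)"
  shows "(\<Sum>k\<in>UNIV. \<Sum>l\<in>UNIV. mat_pow_deriv C ((Q ** unit_mat k l - unit_mat k l ** Q) ** P) r $ k $ l)
    = (\<Sum>m<r. p m * p (r - 1 - m)) - (\<Sum>m<Suc r. p m * p (r - m))"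
proof -
  have 1: "trace (mat_pow C m ** Q) = p m" for m
  proof (cases "m = 0")
    case False
    then show ?thesis using trace_mul_sym[of "mat_pow C m" Q] Q_mat_pow[of m] mat_pow_P[of m] by (simp add: p_def)
  qed (simp add: p_def tr)
  have 2: "trace (P ** mat_pow C j) = p j" for j unfolding p_def by (rule trace_mul_sym)
  \<comment> \<open>For m = 0 this is the trace of the identity, 2 p 0 by \<open>tr1\<close>. The
    surplus p 0 p r later supplies the term m = r of the second sum.\<close>
  have 3: "trace (mat_pow C m) = p m + (if m = 0 then p 0 else 0)" for m
    using mat_pow_P[of m] tr1 by (auto simp: p_def)
  have 4: "trace (Q ** P ** mat_pow C (r - 1 - m)) = p (r - m)" if "m < r" for m
  proof -
    have "r - m = Suc (r - 1 - m)" using that by simp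
    then have "Q ** P ** mat_pow C (r - 1 - m) = mat_pow C (r - m)" by (simp add: C[symmetric])
    then show ?thesis using that 3[of "r - m"] by simp
  qed
  have "mat_pow_deriv C ((Q ** unit_mat k l - unit_mat k l ** Q) ** P) r
     = (\<Sum>m<r. (mat_pow C m ** Q) ** unit_mat k l ** (P ** mat_pow C (r - 1 - m)) - mat_pow C m ** unit_mat k l ** (Q ** P ** mat_pow C (r - 1 - m)))" for k l
    unfolding mat_pow_deriv_def by (simp add: mm.diff_left mm.diff_right matrix_mul_assoc)
  then have "(\<Sum>k\<in>UNIV. \<Sum>l\<in>UNIV. mat_pow_deriv C ((Q ** unit_mat k l - unit_mat k l ** Q) ** P) r $ k $ l)
     = (\<Sum>k\<in>UNIV. \<Sum>l\<in>UNIV. \<Sum>m<r. ((mat_pow C m ** Q) ** unit_mat k l ** (P ** mat_pow C (r - 1 - m))) $ k $ l - (mat_pow C m ** unit_mat k l ** (Q ** P ** mat_pow C (r - 1 - m))) $ k $ l)"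
    by (simp add: sum_component)
  also have "\<dots> = (\<Sum>k\<in>UNIV. \<Sum>m<r. \<Sum>l\<in>UNIV. ((mat_pow C m ** Q) ** unit_mat k l ** (P ** mat_pow C (r - 1 - m))) $ k $ l - (mat_pow C m ** unit_mat k l ** (Q ** P ** mat_pow C (r - 1 - m))) $ k $ l)"
    by (intro sum.cong refl sum.swap)
  also have "\<dots> = (\<Sum>m<r. \<Sum>k\<in>UNIV. \<Sum>l\<in>UNIV. ((mat_pow C m ** Q) ** unit_mat k l ** (P ** mat_pow C (r - 1 - m))) $ k $ l - (mat_pow C m ** unit_mat k l ** (Q ** P ** mat_pow C (r - 1 - m))) $ k $ l)"
    by (rule sum.swap)
  also have "\<dots> = (\<Sum>m<r. p m * p (r - 1 - m) - (p m + (if m = 0 then p 0 else 0)) * p (r - m))"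
    unfolding sum_subtractf sum_unit_mat 1 2 3
    by (intro arg_cong2[where f = "(-)"] sum.cong refl) (simp only: 4 lessThan_iff)
  also have "\<dots> = (\<Sum>m<r. p m * p (r - 1 - m)) - ((\<Sum>m<r. p m * p (r - m)) + (\<Sum>m<r. if m = 0 then p 0 * p r else 0))"
    unfolding sum_subtractf sum.distrib[symmetric]
    by (intro arg_cong2[where f = "(-)"] sum.cong refl) (auto simp: distrib_right)
  also have "(\<Sum>m<r. if m = 0 then p 0 * p r else 0) = p r * p 0"
    using assms by simp
  finally show ?thesis by simp
qed

end

text \<open>The (k, l) entry of C^r times the word is differentiated along the matrix unit (k, l);
  the result has mean 0 and is summed over k and l. Derivatives of the entry give the divergence,
  those of the word its derivative along C^r.\<close>

theorem haar_loop:
  fixes P :: "complex^'m^'m"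
  assumes PP: "P ** P = P" and tr1: "trace (mat 1 :: complex^'m^'m) = 2 * trace P" and r: "r \<ge> 1"
  shows "(LINT U|haar_unitary. cloop (cmom P U) r as) = 0"
proof -
  let ?Q = "\<lambda>U. mat_adj U ** P ** U"
  let ?d = "\<lambda>U X. (?Q U ** X - X ** ?Q U) ** P"
  let ?C = "comp_mat P"
  let ?G = "\<lambda>U. \<Prod>a\<leftarrow>as. cmom P U a"
  let ?DG = "\<lambda>U X. cldot (cmom P U) (\<lambda>a. trace (mat_pow_deriv (?C U) (?d U X) a ** P)) as"
  have W: "dpair (\<lambda>U. mat_pow (?C U) r $ k $ l) (\<lambda>U X. mat_pow_deriv (?C U) (?d U X) r $ k $ l)" for k l
    using mpair_mat_pow[OF mpair_comp_mat[of P], of r] by (simp add: mpair_def)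
  have G: "dpair ?G ?DG" by (rule dpair_prod_list[OF dpair_cmom])
  let ?h = "\<lambda>k l U. mat_pow_deriv (?C U) (?d U (unit_mat k l)) r $ k $ l * ?G U + mat_pow (?C U) r $ k $ l * ?DG U (unit_mat k l)"
  have WG: "dpair (\<lambda>U. mat_pow (?C U) r $ k $ l * ?G U) (\<lambda>U X. mat_pow_deriv (?C U) (?d U X) r $ k $ l * ?G U + mat_pow (?C U) r $ k $ l * ?DG U X)" for k l
    by (rule dpair_mult[OF W G])
  have int: "integrable haar_unitary (?h k l)" for k l
    using dpair_base(2)[OF WG[of k l]] by (intro unitary_bdd_integrable) blast
  have zero: "(LINT U|haar_unitary. ?h k l U) = 0" for k l
    by (rule dpair_integral_unit_mat[OF WG])
  have "(LINT U|haar_unitary. (\<Sum>k\<in>UNIV. \<Sum>l\<in>UNIV. ?h k l U)) = (\<Sum>k\<in>UNIV. \<Sum>l\<in>UNIV. LINT U|haar_unitary. ?h k l U)"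
    using int by simp
  also have "\<dots> = 0" by (simp only: zero sum.neutral_const)
  finally have 0: "(LINT U|haar_unitary. (\<Sum>k\<in>UNIV. \<Sum>l\<in>UNIV. ?h k l U)) = 0" .
  have eq: "(\<Sum>k\<in>UNIV. \<Sum>l\<in>UNIV. ?h k l U) = cloop (cmom P U) r as" if U: "is_unitary_mat U" for U
  proof -
    have UU: "U ** mat_adj U = mat 1" by (rule unitary_right[OF U])
    have QQ: "?Q U ** ?Q U = ?Q U"
    proof -
      have "?Q U ** ?Q U = mat_adj U ** P ** (U ** mat_adj U) ** P ** U" by (simp add: matrix_mul_assoc)
      also have "\<dots> = mat_adj U ** (P ** P) ** U" by (simp add: UU matrix_mul_assoc)
      finally show ?thesis by (simp add: PP)
    qed
    have C: "?C U = ?Q U ** P" by (simp add: comp_mat_def)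
    have tr: "trace (?Q U) = trace P"
    proof -
      have "trace (?Q U) = trace (U ** (mat_adj U ** P))" by (rule trace_mul_sym)
      then show ?thesis by (simp add: matrix_mul_assoc UU)
    qed
    note prem = PP QQ C tr tr1
    have clin: "clin (?DG U)" using dpair_base(3)[OF G] by blast
    have "(\<Sum>k\<in>UNIV. \<Sum>l\<in>UNIV. ?h k l U)
      = (\<Sum>k\<in>UNIV. \<Sum>l\<in>UNIV. mat_pow_deriv (?C U) (?d U (unit_mat k l)) r $ k $ l) * ?G U
        + (\<Sum>k\<in>UNIV. \<Sum>l\<in>UNIV. mat_pow (?C U) r $ k $ l * ?DG U (unit_mat k l))"
      by (simp add: sum.distrib sum_distrib_right)
    also have "(\<Sum>k\<in>UNIV. \<Sum>l\<in>UNIV. mat_pow (?C U) r $ k $ l * ?DG U (unit_mat k l)) = ?DG U (mat_pow (?C U) r)"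
      by (rule clin_expand[OF clin, symmetric])
    also have "?DG U (mat_pow (?C U) r) = cldot (cmom P U) (\<lambda>a. of_nat a * (cmom P U (r + a - 1) - cmom P U (r + a))) as"
      unfolding trace_mat_pow_deriv_mat_pow[OF prem r] cmom_def ..
    also have "(\<Sum>k\<in>UNIV. \<Sum>l\<in>UNIV. mat_pow_deriv (?C U) (?d U (unit_mat k l)) r $ k $ l)
      = (\<Sum>m<r. cmom P U m * cmom P U (r - 1 - m)) - (\<Sum>m<Suc r. cmom P U m * cmom P U (r - m))"
      unfolding cmom_def by (rule divergence_mat_pow[OF prem r])
    finally show ?thesis unfolding cloop_def .
  qed
  have cm: "unitary_bdd (\<lambda>U. cmom P U a)" for a by (rule dpair_base(1)[OF dpair_cmom])
  have pl: "unitary_bdd (\<lambda>U. \<Prod>a\<leftarrow>as. cmom P U a)" for as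
    by (rule dpair_base(1)[OF dpair_prod_list[OF dpair_cmom]])
  have cl: "unitary_bdd (\<lambda>U. cldot (cmom P U) (\<lambda>a. of_nat a * (cmom P U (r + a - 1) - cmom P U (r + a))) as)"
    by (induction as) (auto intro!: unitary_bdd_const unitary_bdd_add unitary_bdd_mult unitary_bdd_diff cm pl)
  have "unitary_bdd (\<lambda>U. cloop (cmom P U) r as)"
    unfolding cloop_def by (intro unitary_bdd_add unitary_bdd_mult unitary_bdd_diff unitary_bdd_sum cm pl cl)
  then have m: "(\<lambda>U. cloop (cmom P U) r as) \<in> borel_measurable haar_unitary"
    by (simp add: unitary_bdd_def measurable_cong_sets[OF sets_haar refl])
  have "(LINT U|haar_unitary. cloop (cmom P U) r as) = (LINT U|haar_unitary. (\<Sum>k\<in>UNIV. \<Sum>l\<in>UNIV. ?h k l U))"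
  proof (rule integral_cong_AE[OF m])
    show "(\<lambda>U. \<Sum>k\<in>UNIV. \<Sum>l\<in>UNIV. ?h k l U) \<in> borel_measurable haar_unitary"
      using int by (intro borel_measurable_sum borel_measurable_integrable)
    show "AE U in haar_unitary. cloop (cmom P U) r as = (\<Sum>k\<in>UNIV. \<Sum>l\<in>UNIV. ?h k l U)"
      using AE_haar by eventually_elim (simp only: eq)
  qed
  then show ?thesis using 0 by simp
qed

subsection \<open>Eigenvalues\<close>

lemma sum_UNIV_sum: "(\<Sum>x\<in>(UNIV :: ('a::finite + 'b::finite) set). f x) = (\<Sum>i\<in>UNIV. f (Inl i)) + (\<Sum>i\<in>UNIV. f (Inr i))"
  by (simp add: UNIV_Plus_UNIV[symmetric] sum.Plus comp_def del: UNIV_Plus_UNIV)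

definition char_poly_mat :: "complex^'n^'n \<Rightarrow> complex poly" where
  "char_poly_mat H = det (\<chi> i j. [:- H $ i $ j, if i = j then 1 else 0:])"

lemma poly_char_poly_mat: "poly (char_poly_mat H) x = det (mat x - H)"
  unfolding char_poly_mat_def det_def
  by (simp add: poly_sum poly_prod poly_mult mat_def of_int_poly)
    (intro sum.cong refl arg_cong2[where f = "(*)"] prod.cong; simp)

text \<open>Only the identity permutation picks up the variable in every factor; any other one loses
  degree.\<close>

lemma char_poly_mat_monic:
  fixes H :: "complex^'n^'n"
  shows "degree (char_poly_mat H) = CARD('n)" "lead_coeff (char_poly_mat H) = 1"
proof -
  let ?N = "CARD('n)"
  let ?t = "\<lambda>p. of_int (sign p) * (\<Prod>i\<in>UNIV. [:- H $ i $ p i, if i = p i then 1 else 0:]) :: complex poly"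
  let ?S = "{p. p permutes (UNIV :: 'n set)}"
  have small: "degree (?t p) < ?N" if "p \<in> ?S" and pid: "p \<noteq> id" for p
  proof -
    obtain i where i: "p i \<noteq> i" using pid by (auto simp: fun_eq_iff)
    have "degree (?t p) \<le> 0 + (\<Sum>i\<in>UNIV. degree [:- H $ i $ p i, if i = p i then 1 else 0:])"
      by (intro order_trans[OF degree_mult_le] add_mono order_trans[OF degree_prod_sum_le]) auto
    also have "\<dots> < (\<Sum>i\<in>(UNIV :: 'n set). 1)"
      unfolding add_0
    proof (rule sum_strict_mono_ex1)
      show "\<exists>a\<in>UNIV. degree [:- H $ a $ p a, if a = p a then 1 else 0:] < 1"
        using i by (intro bexI[of _ i]) auto
    qed auto
    finally show ?thesis by simp
  qed
  have idp: "?t id = (\<Prod>i\<in>UNIV. [:- H $ i $ i, 1:])" by (simp add: sign_id)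
  have d: "degree (?t id) = ?N" unfolding idp by (subst degree_prod_eq_sum_degree) auto
  have l: "lead_coeff (?t id) = 1" unfolding idp by (simp add: lead_coeff_prod)
  have "char_poly_mat H = ?t id + (\<Sum>p\<in>?S - {id}. ?t p)"
    unfolding char_poly_mat_def det_def by (simp add: sum.remove[of ?S id] finite_permutations permutes_id)
  moreover have "degree (\<Sum>p\<in>?S - {id}. ?t p) < degree (?t id)"
    unfolding d using small by (intro degree_sum_less) auto
  ultimately show "degree (char_poly_mat H) = ?N" "lead_coeff (char_poly_mat H) = 1"
    using d l by (simp_all only: degree_add_eq_left lead_coeff_add_le degree_add_eq_left coeff_add) (simp_all add: coeff_eq_0)
qed

lemma proots_linear: "proots (\<Prod>e\<in>#M. [:- e, 1:]) = (M :: complex multiset)"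
proof (induction M)
  case (add x M)
  have "(\<Prod>e\<in>#M. [:- e, 1:]) \<noteq> 0" by (auto simp: prod_mset_zero_iff)
  then show ?case using add by (simp add: proots_mult del: mult_pCons_left)
qed simp

lemma poly_linear_prod: "poly (\<Prod>e\<in>#M. [:- e, 1:]) x = (\<Prod>e\<in>#M. x - (e::complex))"
  by (induction M) (auto simp: algebra_simps)

text \<open>Resolves the definite description: factorization of the characteristic polynomial over
  the complex numbers gives existence, and \<open>proots\<close> recovers the multiset from the
  product of linear factors.\<close>

lemma eig_mset_props:
  fixes H :: "complex^'n^'n"
  shows "size (eig_mset H) = CARD('n)" "det (mat x - H) = (\<Prod>e\<in>#eig_mset H. x - e)"
proof -
  let ?Q = "\<lambda>M. size M = CARD('n) \<and> (\<forall>x. det (mat x - H) = (\<Prod>e\<in>#M. x - e))"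
  have nz: "char_poly_mat H \<noteq> 0" using char_poly_mat_monic(2)[of H] by auto
  obtain A where A: "size A = degree (char_poly_mat H)" "char_poly_mat H = smult (lead_coeff (char_poly_mat H)) (\<Prod>x\<in>#A. [:- x, 1:])"
    using alg_closed_imp_factorization[OF nz] by blast
  have cp: "char_poly_mat H = (\<Prod>x\<in>#A. [:- x, 1:])" using A(2) unfolding char_poly_mat_monic(2) by simp
  have QA: "?Q A" using A(1) char_poly_mat_monic(1)[of H]
    by (simp add: poly_char_poly_mat[symmetric] cp poly_linear_prod)
  have uniq: "M = A" if "?Q M" for M
  proof -
    have "poly (\<Prod>e\<in>#M. [:- e, 1:]) x = poly (\<Prod>e\<in>#A. [:- e, 1:]) x" for x
      using that QA by (simp add: poly_linear_prod)
    then have "(\<Prod>e\<in>#M. [:- e, 1:]) = (\<Prod>e\<in>#A. [:- e, 1:])" by (intro poly_ext)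
    then show ?thesis using proots_linear by metis
  qed
  have "?Q (eig_mset H)" unfolding eig_mset_def by (rule theI[of ?Q A]) (use QA uniq in blast)+
  then show "size (eig_mset H) = CARD('n)" "det (mat x - H) = (\<Prod>e\<in>#eig_mset H. x - e)" by auto
qed

definition mat_poly :: "complex poly \<Rightarrow> complex^'n^'n \<Rightarrow> complex^'n^'n" where
  "mat_poly p H = fold_coeffs (\<lambda>a B. mat_cscale a (mat 1) + H ** B) p 0"

lemma mat_cscale_0 [simp]: "mat_cscale 0 A = 0" "mat_cscale a 0 = 0"
  by (simp_all add: vec_eq_iff)

lemma mat_poly_0 [simp]: "mat_poly 0 H = 0"
  by (simp add: mat_poly_def)

lemma mat_poly_pCons [simp]: "mat_poly (pCons a p) H = mat_cscale a (mat 1) + H ** mat_poly p H"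
  by (cases "p = 0 \<and> a = 0") (auto simp: mat_poly_def mm.zero_right)

lemma mat_cscale_add: "mat_cscale (a + b) A = mat_cscale a A + mat_cscale b A" "mat_cscale a (A + B) = mat_cscale a A + mat_cscale a B"
  by (simp_all add: vec_eq_iff algebra_simps)

lemma mat_cscale_mat_cscale: "mat_cscale a (mat_cscale b A) = mat_cscale (a * b) A"
  by (simp add: vec_eq_iff)

lemma mat_poly_add: "mat_poly (p + q) H = mat_poly p H + mat_poly q H"
  by (induction p q rule: poly_induct2) (simp_all add: mat_cscale_add mm.add_right algebra_simps)

lemma mat_poly_smult: "mat_poly (smult a p) H = mat_cscale a (mat_poly p H)"
  by (induction p) (simp_all add: mat_cscale_add mat_cscale_mat_cscale mat_cscale_mult_right)

lemma mat_poly_mult: "mat_poly (p * q) H = mat_poly p H ** mat_poly q H"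
proof (induction p)
  case (pCons a p)
  have "mat_poly (pCons a p * q) H = mat_cscale a (mat_poly q H) + H ** (mat_poly p H ** mat_poly q H)"
    using pCons by (simp add: mat_poly_add mat_poly_smult)
  then show ?case by (simp add: mm.add_left mat_cscale_mult_left matrix_mul_assoc)
qed (simp add: mm.zero_left)

lemma mat_poly_monom: "mat_poly (monom c a) H = mat_cscale c (mat_pow H a)"
  by (induction a) (simp_all add: monom_0 monom_Suc mat_cscale_mult_right mm.zero_right)

lemma det_mat_cscale: "det (mat_cscale c (A :: complex^'n^'n)) = c ^ CARD('n) * det A"
proof -
  have "mat_cscale c A = mat_cscale c (mat 1) ** A" by (simp add: mat_cscale_mult_left)
  moreover have "det (mat_cscale c (mat 1 :: complex^'n^'n)) = (\<Prod>i\<in>UNIV. mat_cscale c (mat 1 :: complex^'n^'n) $ i $ i)"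
    by (rule det_diagonal) (simp add: mat_def)
  ultimately show ?thesis by (simp add: det_mul mat_def)
qed

text \<open>Split q into linear factors: the determinant is multiplicative, and for one linear
  factor the claim is the defining property of \<open>eig_mset\<close>. Algebraic multiplicities
  come out right without triangularizing H.\<close>

lemma det_mat_poly:
  fixes H :: "complex^'n^'n"
  shows "det (mat_poly q H) = (\<Prod>e\<in>#eig_mset H. poly q e)"
proof -
  have sc: "det (mat_poly (smult c p) H) = (\<Prod>e\<in>#eig_mset H. poly (smult c p) e)"
    if "det (mat_poly p H) = (\<Prod>e\<in>#eig_mset H. poly p e)" for c p
    using that eig_mset_props(1)[of H] by (simp add: mat_poly_smult det_mat_cscale prod_mset.distrib)
  have lin: "det (mat_poly [:- z, 1:] H) = (\<Prod>e\<in>#eig_mset H. poly [:- z, 1:] e)" for z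
  proof -
    \<comment> \<open>The sign matches the characteristic determinant; \<open>sc\<close> with the
      scalar -1 then turns it around.\<close>
    have "mat_poly [:z, -1:] H = mat z - H"
      by (simp add: mm.zero_right mat_cscale_mult_right) (auto simp: vec_eq_iff mat_def)
    then have "det (mat_poly [:z, -1:] H) = (\<Prod>e\<in>#eig_mset H. poly [:z, -1:] e)"
      using eig_mset_props(2)[of z H] by simp
    from sc[OF this, of "-1"] show ?thesis by simp
  qed
  show ?thesis
  proof (cases "q = 0")
    case True
    have "eig_mset H \<noteq> {#}" using eig_mset_props(1)[of H] by auto
    moreover have "det (0 :: complex^'n^'n) = 0" using det_mat_cscale[of 0 "mat 1 :: complex^'n^'n"] by simp
    ultimately show ?thesis using True by (simp add: prod_mset_zero_iff eig_mset_props)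
  next
    case False
    obtain A where A: "q = smult (lead_coeff q) (\<Prod>x\<in>#A. [:- x, 1:])"
      using alg_closed_imp_factorization[OF False] by blast
    have "det (mat_poly (\<Prod>x\<in>#A. [:- x, 1:]) H) = (\<Prod>e\<in>#eig_mset H. poly (\<Prod>x\<in>#A. [:- x, 1:]) e)"
    proof (induction A)
      case empty
      show ?case by (simp add: one_pCons mm.zero_right) (simp add: mat_cscale_def[abs_def] vec_lambda_eta)
    next
      case (add x A)
      have "det (mat_poly (\<Prod>x\<in>#add_mset x A. [:- x, 1:]) H) = det (mat_poly [:- x, 1:] H) * det (mat_poly (\<Prod>x\<in>#A. [:- x, 1:]) H)"
        by (simp only: image_mset_add_mset prod_mset.add_mset mat_poly_mult det_mul)
      also have "\<dots> = (\<Prod>e\<in>#eig_mset H. poly [:- x, 1:] e * poly (\<Prod>x\<in>#A. [:- x, 1:]) e)"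
        unfolding lin add.IH prod_mset.distrib ..
      finally show ?case by (simp only: image_mset_add_mset prod_mset.add_mset poly_mult)
    qed
    from sc[OF this, of "lead_coeff q"] show ?thesis using A by simp
  qed
qed

text \<open>A permutation other than the identity moves at least two indices, so its term is
  divisible by u^2 and contributes nothing at first order.\<close>

lemma det_derivative:
  fixes K :: "complex^'n^'n"
  shows "((\<lambda>u. det (mat 1 + mat_cscale u K)) has_field_derivative trace K) (at 0)"
proof -
  let ?S = "{p. p permutes (UNIV :: 'n set)}"
  let ?f = "\<lambda>p i u. (if i = p i then 1 else 0) + u * K $ i $ p i"
  have "((\<lambda>u. \<Sum>p\<in>?S. of_int (sign p) * (\<Prod>i\<in>UNIV. ?f p i u)) has_field_derivative
     (\<Sum>p\<in>?S. of_int (sign p) * (\<Sum>i\<in>UNIV. K $ i $ p i * (\<Prod>j\<in>UNIV - {i}. ?f p j 0)))) (at 0)"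
    by (intro DERIV_sum DERIV_cmult has_field_derivative_prod) (auto intro!: derivative_eq_intros)
  moreover have "(\<lambda>u. \<Sum>p\<in>?S. of_int (sign p) * (\<Prod>i\<in>UNIV. ?f p i u)) = (\<lambda>u. det (mat 1 + mat_cscale u K))"
    by (simp add: det_def mat_def fun_eq_iff)
  moreover have "(\<Sum>p\<in>?S. of_int (sign p) * (\<Sum>i\<in>UNIV. K $ i $ p i * (\<Prod>j\<in>UNIV - {i}. ?f p j 0))) = trace K"
  proof -
    have "(\<Sum>i\<in>UNIV. K $ i $ p i * (\<Prod>j\<in>UNIV - {i}. ?f p j 0)) = 0" if pS: "p \<in> ?S" and pid: "p \<noteq> id" for p
    proof (intro sum.neutral ballI)
      fix i
      obtain k where k: "p k \<noteq> k" using pid by (auto simp: fun_eq_iff)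
      have inj: "inj p" using pS by (auto intro: permutes_inj)
      \<comment> \<open>A moved index other than \<open>i\<close> leaves a factor that is 0 at u =
        0. If the known moved index is \<open>i\<close> itself, its image is moved as well, by
        injectivity.\<close>
      have "\<exists>j. j \<noteq> i \<and> j \<noteq> p j"
      proof (cases "k = i")
        case True
        have "p (p k) \<noteq> p k" using k inj by (metis injD)
        then show ?thesis using True k by (intro exI[of _ "p k"]) auto
      qed (use k in auto)
      then have "(\<Prod>j\<in>UNIV - {i}. ?f p j 0) = 0" by (intro prod_zero) auto
      then show "K $ i $ p i * (\<Prod>j\<in>UNIV - {i}. ?f p j 0) = 0" by simp
    qed
    then have "(\<Sum>p\<in>?S. of_int (sign p) * (\<Sum>i\<in>UNIV. K $ i $ p i * (\<Prod>j\<in>UNIV - {i}. ?f p j 0)))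
      = (\<Sum>p\<in>{id}. of_int (sign p) * (\<Sum>i\<in>UNIV. K $ i $ p i * (\<Prod>j\<in>UNIV - {i}. ?f p j 0)))"
      by (intro sum.mono_neutral_right) (auto simp: finite_permutations permutes_id)
    then show ?thesis by (simp add: sign_id trace_def)
  qed
  ultimately show ?thesis by simp
qed

text \<open>Compare first-order terms at u = 0 of det (1 + u H^a), once as a determinant and once as
  a product over the eigenvalues.\<close>

lemma trace_mat_pow:
  fixes H :: "complex^'n^'n"
  shows "trace (mat_pow H a) = (\<Sum>e\<in>#eig_mset H. e ^ a)"
proof -
  have "mat_poly (1 + monom u a) H = mat 1 + mat_cscale u (mat_pow H a)" for u
    unfolding mat_poly_add mat_poly_monom by (simp add: one_pCons mm.zero_right) (simp add: vec_eq_iff)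
  then have e: "det (mat 1 + mat_cscale u (mat_pow H a)) = (\<Prod>e\<in>#eig_mset H. 1 + u * e ^ a)" for u
    using det_mat_poly[of "1 + monom u a" H] by (simp add: poly_monom)
  have d: "((\<lambda>u. \<Prod>e\<in>#M. 1 + u * e ^ a) has_field_derivative (\<Sum>e\<in>#M. e ^ a)) (at 0)" for M :: "complex multiset"
  proof (induction M)
    case (add x M)
    have one: "(\<Prod>e\<in>#M. 1 + 0 * e ^ a) = 1" by (induction M) auto
    have "((\<lambda>u. (1 + u * x ^ a) * (\<Prod>e\<in>#M. 1 + u * e ^ a)) has_field_derivative
        (x ^ a * (\<Prod>e\<in>#M. 1 + 0 * e ^ a) + (\<Sum>e\<in>#M. e ^ a) * (1 + 0 * x ^ a))) (at 0)"
      by (rule DERIV_mult) (auto intro!: derivative_eq_intros add)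
    then show ?case unfolding one by simp
  qed simp
  have "((\<lambda>u. \<Prod>e\<in>#eig_mset H. 1 + u * e ^ a) has_field_derivative trace (mat_pow H a)) (at 0)"
    using det_derivative[of "mat_pow H a"] unfolding e .
  then show ?thesis using d by (rule DERIV_unique)
qed

lemma quadratic_form:
  fixes B :: "complex^'n^'n"
  shows "(\<Sum>k\<in>UNIV. cnj ((B *v x) $ k) * (B *v x) $ k) = (\<Sum>i\<in>UNIV. cnj (x $ i) * ((mat_adj B ** B) *v x) $ i)"
proof -
  have "(\<Sum>k\<in>UNIV. cnj ((B *v x) $ k) * (B *v x) $ k) = (\<Sum>k\<in>UNIV. \<Sum>i\<in>UNIV. cnj (x $ i) * (cnj (B $ k $ i) * (B *v x) $ k))"
  proof -
    have c: "cnj ((B *v x) $ k) = (\<Sum>i\<in>UNIV. cnj (x $ i) * cnj (B $ k $ i))" for k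
      by (simp add: matrix_vector_mult_def mult.commute)
    show ?thesis by (simp only: c sum_distrib_right mult.assoc)
  qed
  also have "\<dots> = (\<Sum>i\<in>UNIV. \<Sum>k\<in>UNIV. cnj (x $ i) * (cnj (B $ k $ i) * (B *v x) $ k))" by (rule sum.swap)
  also have "\<dots> = (\<Sum>i\<in>UNIV. cnj (x $ i) * (mat_adj B *v (B *v x)) $ i)"
  proof -
    have a: "(mat_adj B *v y) $ i = (\<Sum>k\<in>UNIV. cnj (B $ k $ i) * y $ k)" for y i
      by (simp add: matrix_vector_mult_def mat_adj_def)
    show ?thesis by (simp only: a sum_distrib_left)
  qed
  finally show ?thesis by (simp add: matrix_vector_mul_assoc)
qed

lemma norm_vec_sq: "(\<Sum>k\<in>UNIV. cnj (x $ k) * x $ k) = of_real (\<Sum>k\<in>UNIV. (cmod (x $ k))\<^sup>2)"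
  unfolding of_real_sum by (intro sum.cong refl) (simp only: complex_norm_square mult.commute)

text \<open>For an eigenvector v, e |v|^2 = |A v|^2, so e is real and nonnegative. If U is unitary,
  A v is the upper half of U applied to (v, 0), hence |A v| <= |v|.\<close>

lemma eig_bounds:
  fixes U :: "complex^('n::finite+'n)^('n+'n)"
  assumes e: "e \<in># eig_mset (mat_adj (ul_block U) ** ul_block U)"
  shows "e = of_real (Re e)" "0 \<le> Re e" "is_unitary_mat U \<Longrightarrow> Re e \<le> 1"
proof -
  let ?A = "ul_block U"
  let ?H = "mat_adj ?A ** ?A"
  have "det (mat e - ?H) = 0" using e by (auto simp: eig_mset_props(2) prod_mset_zero_iff)
  then have "\<not> (\<exists>B. B ** (mat e - ?H) = mat 1)"
    using invertible_det_nz[of "mat e - ?H"] invertible_left_inverse[of "mat e - ?H"] by auto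
  then obtain v where v: "(mat e - ?H) *v v = 0" "v \<noteq> 0" unfolding matrix_left_invertible_ker by blast
  have "mat e *v v = e *s v"
    by (simp add: vec_eq_iff matrix_vector_mult_def mat_def if_distrib[where f = "\<lambda>x. x * _"] cong: if_cong)
  then have Hv: "?H *v v = e *s v" using v(1) by (simp add: matrix_vector_mult_diff_rdistrib)
  let ?n = "\<Sum>k\<in>UNIV. (cmod (v $ k))\<^sup>2" and ?m = "\<Sum>k\<in>UNIV. (cmod ((?A *v v) $ k))\<^sup>2"
  have "of_real ?m = (\<Sum>i\<in>UNIV. cnj (v $ i) * (?H *v v) $ i)"
    unfolding norm_vec_sq[symmetric] by (rule quadratic_form)
  also have "\<dots> = e * (\<Sum>i\<in>UNIV. cnj (v $ i) * v $ i)" unfolding Hv by (simp add: sum_distrib_left mult_ac)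
  also have "\<dots> = e * of_real ?n" unfolding norm_vec_sq ..
  finally have en: "e * of_real ?n = of_real ?m" ..
  obtain k where "v $ k \<noteq> 0" using v(2) by (auto simp: vec_eq_iff)
  then have n: "?n > 0" by (intro sum_pos2[of UNIV k]) auto
  have ev: "e = of_real (?m / ?n)" 
  proof -
    have "of_real ?n \<noteq> (0 :: complex)" using n unfolding of_real_eq_0_iff by linarith
    then have "e = of_real ?m / of_real ?n" using en by (rule nonzero_eq_divide_eq[THEN iffD2])
    then show ?thesis by (simp only: of_real_divide)
  qed
  have m: "?m \<ge> 0" by (intro sum_nonneg) auto
  show "e = of_real (Re e)" "0 \<le> Re e" using ev n m by simp_all
  assume U: "is_unitary_mat U"
  let ?x = "\<chi> i. (case i of Inl a \<Rightarrow> v $ a | Inr b \<Rightarrow> 0) :: complex^('n+'n)"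
  have "of_real (\<Sum>k\<in>UNIV. (cmod ((U *v ?x) $ k))\<^sup>2) = (of_real (\<Sum>k\<in>UNIV. (cmod (?x $ k))\<^sup>2) :: complex)"
    unfolding norm_vec_sq[symmetric] quadratic_form using U by (simp add: is_unitary_mat_def)
  then have "(\<Sum>k\<in>UNIV. (cmod ((U *v ?x) $ k))\<^sup>2) = (\<Sum>k\<in>UNIV. (cmod (?x $ k))\<^sup>2)"
    by (simp only: of_real_eq_iff)
  moreover have "(\<Sum>k\<in>UNIV. (cmod (?x $ k))\<^sup>2) = ?n" by (simp add: sum_UNIV_sum)
  moreover have "(U *v ?x) $ Inl k = (?A *v v) $ k" for k
    by (simp add: matrix_vector_mult_def sum_UNIV_sum ul_block_def)
  ultimately have "?m + (\<Sum>k\<in>UNIV. (cmod ((U *v ?x) $ Inr k))\<^sup>2) = ?n" by (simp add: sum_UNIV_sum)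
  then have mn: "?m \<le> ?n" using sum_nonneg[of UNIV "\<lambda>k. (cmod ((U *v ?x) $ Inr k))\<^sup>2"] by simp
  show "Re e \<le> 1" using ev n mn by simp
qed

text \<open>Padding by zero blocks; \<open>emb (mat 1)\<close> is the projection onto the first
  block of coordinates.\<close>

definition emb :: "complex^'n^'n \<Rightarrow> complex^('n::finite+'n)^('n+'n)" where
  "emb B = (\<chi> i j. case i of Inl a \<Rightarrow> (case j of Inl b \<Rightarrow> B $ a $ b | Inr b \<Rightarrow> 0) | Inr a \<Rightarrow> 0)"

lemma emb_nth [simp]: "emb B $ Inl a $ Inl b = B $ a $ b" "emb B $ Inl a $ Inr b' = 0" "emb B $ Inr a' $ j = 0"
  by (simp_all add: emb_def)

lemma emb_mult: "emb A ** emb B = emb (A ** B)"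
  by (simp add: vec_eq_iff matrix_matrix_mult_def sum_UNIV_sum emb_def split: sum.split)

lemma trace_emb: "trace (emb A) = trace A"
  by (simp add: trace_def sum_UNIV_sum)

text \<open>Between two copies of the projection P, U^* P U becomes the embedded H, so P C^a P is
  the embedded H^a. Cyclicity of the trace supplies the second P.\<close>

lemma cmom_eig:
  fixes U :: "complex^('n::finite+'n)^('n+'n)"
  shows "cmom (emb (mat 1)) U a = (\<Sum>e\<in>#eig_mset (mat_adj (ul_block U) ** ul_block U). e ^ a)"
proof -
  let ?P = "emb (mat 1) :: complex^('n+'n)^('n+'n)"
  let ?A = "ul_block U"
  let ?H = "mat_adj ?A ** ?A"
  let ?C = "comp_mat ?P U"
  have PP: "?P ** ?P = ?P" by (simp add: emb_mult)
  have PX: "(?P ** X) $ i $ j = (case i of Inl a \<Rightarrow> X $ i $ j | Inr a \<Rightarrow> 0)"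
    "(X ** ?P) $ i $ j = (case j of Inl a \<Rightarrow> X $ i $ j | Inr a \<Rightarrow> 0)" for X :: "complex^('n+'n)^('n+'n)" and i j
    by (auto simp: matrix_matrix_mult_def sum_UNIV_sum mat_def if_distrib[where f = "\<lambda>x. x * _"] if_distrib[where f = "\<lambda>x. _ * x"] split: sum.split cong: if_cong)
  have PC: "?P ** ?C = emb ?H"
  proof -
    have ma: "(mat_adj X ** Y) $ i $ j = (\<Sum>k\<in>UNIV. cnj (X $ k $ i) * Y $ k $ j)"
      for X Y :: "complex^('n+'n)^('n+'n)" and i j
      by (simp add: matrix_matrix_mult_def mat_adj_def)
    have "(mat_adj U ** (?P ** U)) $ Inl a $ Inl b = ?H $ a $ b" for a b
    proof -
      have "?H $ a $ b = (\<Sum>k\<in>UNIV. cnj (U $ Inl k $ Inl a) * U $ Inl k $ Inl b)"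
        by (simp add: matrix_matrix_mult_def mat_adj_def ul_block_def)
      moreover have "(mat_adj U ** (?P ** U)) $ Inl a $ Inl b = (\<Sum>k\<in>UNIV. cnj (U $ k $ Inl a) * (?P ** U) $ k $ Inl b)"
        by (rule ma)
      ultimately show ?thesis by (simp add: PX sum_UNIV_sum)
    qed
    moreover define X where "X = mat_adj U ** (?P ** U)"
    ultimately have X: "X $ Inl a $ Inl b = ?H $ a $ b" for a b by blast
    have PCX: "?P ** ?C = ?P ** X ** ?P" by (simp only: comp_mat_def X_def matrix_mul_assoc)
    show ?thesis unfolding PCX vec_eq_iff
    proof (intro allI)
      fix i j
      show "(?P ** X ** ?P) $ i $ j = emb ?H $ i $ j"
        by (cases i; cases j) (simp_all only: PX sum.case X emb_nth)
    qed
  qed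
  have "?P ** mat_pow ?C a ** ?P = emb (mat_pow ?H a)"
  proof (induction a)
    case (Suc a)
    have "emb ?H = emb ?H ** ?P" by (simp add: emb_mult)
    have "?P ** mat_pow ?C (Suc a) ** ?P = (?P ** ?C) ** mat_pow ?C a ** ?P" by (simp add: matrix_mul_assoc)
    also have "\<dots> = emb ?H ** (?P ** mat_pow ?C a ** ?P)" unfolding PC by (subst \<open>emb ?H = emb ?H ** ?P\<close>) (simp only: matrix_mul_assoc)
    finally show ?case unfolding Suc.IH emb_mult by simp
  qed (simp add: emb_mult)
  moreover have "cmom ?P U a = trace (?P ** mat_pow ?C a ** ?P)"
  proof -
    have "trace (?P ** (mat_pow ?C a ** ?P)) = trace (mat_pow ?C a ** ?P ** ?P)" by (rule trace_mul_sym)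
    also have "mat_pow ?C a ** ?P ** ?P = mat_pow ?C a ** ?P" by (simp only: matrix_mul_assoc[symmetric] PP)
    finally show ?thesis by (simp add: cmom_def matrix_mul_assoc)
  qed
  ultimately show ?thesis by (simp add: trace_emb trace_mat_pow)
qed

definition eigs :: "complex^('n::finite+'n)^('n+'n) \<Rightarrow> nat \<Rightarrow> real" where
  "eigs U k = eig_list U ! k"

lemma mset_eig_list: "mset (eig_list U) = image_mset Re (eig_mset (mat_adj (ul_block U) ** ul_block U))"
  by (simp add: eig_list_def)

lemma length_eig_list: "length (eig_list (U :: complex^('n::finite+'n)^('n+'n))) = CARD('n)"
proof -
  have "length (eig_list U) = size (mset (eig_list U))" by simp
  then show ?thesis unfolding mset_eig_list by (simp add: eig_mset_props)
qed

lemma sorted_eig_list: "sorted (eig_list U)"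
  by (simp add: eig_list_def)

lemma eigs_bounds:
  fixes U :: "complex^('n::finite+'n)^('n+'n)"
  assumes "k < CARD('n)"
  shows "0 \<le> eigs U k" "is_unitary_mat U \<Longrightarrow> eigs U k \<le> 1"
proof -
  have "eigs U k \<in># mset (eig_list U)" using assms by (simp add: eigs_def length_eig_list)
  then obtain e where e: "e \<in># eig_mset (mat_adj (ul_block U) ** ul_block U)" "eigs U k = Re e"
    unfolding mset_eig_list by auto
  show "0 \<le> eigs U k" "is_unitary_mat U \<Longrightarrow> eigs U k \<le> 1" using eig_bounds[OF e(1)] e(2) by auto
qed

lemma sum_eigs:
  fixes U :: "complex^('n::finite+'n)^('n+'n)"
  shows "(\<Sum>k<CARD('n). g (eigs U k)) = (\<Sum>e\<in>#eig_mset (mat_adj (ul_block U) ** ul_block U). g (Re e))"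
proof -
  have "(\<Sum>k<CARD('n). g (eigs U k)) = sum_list (map g (eig_list U))"
    unfolding sum_list_sum_nth by (simp add: length_eig_list eigs_def atLeast0LessThan)
  also have "\<dots> = (\<Sum>x\<in>#mset (eig_list U). g x)" by (metis mset_map sum_mset_sum_list)
  finally show ?thesis unfolding mset_eig_list by (simp add: multiset.map_comp comp_def)
qed

lemma cmom_psum:
  fixes U :: "complex^('n::finite+'n)^('n+'n)"
  shows "cmom (emb (mat 1)) U a = of_real (psum CARD('n) a (eigs U))"
proof -
  have "of_real (psum CARD('n) a (eigs U)) = (\<Sum>k<CARD('n). of_real (eigs U k) ^ a :: complex)"
    by (simp add: psum_def)
  also have "\<dots> = (\<Sum>e\<in>#eig_mset (mat_adj (ul_block U) ** ul_block U). of_real (Re e) ^ a)"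
    by (rule sum_eigs)
  also have "\<dots> = (\<Sum>e\<in>#eig_mset (mat_adj (ul_block U) ** ul_block U). e ^ a)"
    by (intro arg_cong[where f = sum_mset] image_mset_cong) (metis eig_bounds(1))
  finally show ?thesis unfolding cmom_eig ..
qed

subsection \<open>Moments of the eigenvalues\<close>

lemma borel_psum_eigs: "(\<lambda>U :: complex^('n::finite+'n)^('n+'n). psum CARD('n) a (eigs U)) \<in> borel_measurable borel"
proof -
  have "(\<lambda>U :: complex^('n+'n)^('n+'n). cmom (emb (mat 1)) U a) \<in> borel_measurable borel"
    using dpair_base(1)[OF dpair_cmom] by (auto simp: unitary_bdd_def)
  then have "(\<lambda>U :: complex^('n+'n)^('n+'n). Re (cmom (emb (mat 1)) U a)) \<in> borel_measurable borel"
    by measurable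
  then show ?thesis unfolding cmom_psum by simp
qed

text \<open>Power sums of the eigenvalues are traces, hence measurable, and polynomials approximate
  g uniformly on [0, R]. As the eigenvalues are unbounded over all matrices U, the sum is cut off
  where the trace exceeds R, and then R grows.\<close>

lemma borel_sum_eigs:
  fixes g :: "real \<Rightarrow> real"
  assumes g: "continuous_on UNIV g"
  shows "(\<lambda>U :: complex^('n::finite+'n)^('n+'n). \<Sum>k<CARD('n). g (eigs U k)) \<in> borel_measurable borel"
proof -
  let ?N = "CARD('n)"
  let ?S = "\<lambda>g (U :: complex^('n+'n)^('n+'n)). \<Sum>k<?N. g (eigs U k) :: real"
  let ?t = "\<lambda>U :: complex^('n+'n)^('n+'n). psum ?N 1 (eigs U)"
  have tm[measurable]: "?t \<in> borel_measurable borel" by (rule borel_psum_eigs)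
  have pol: "?S q \<in> borel_measurable borel" if q: "real_polynomial_function q" for q
  proof -
    obtain a n where "q = (\<lambda>x. \<Sum>i\<le>n. a i * x ^ i)" using q unfolding real_polynomial_function_iff_sum by blast
    then have "?S q = (\<lambda>U. \<Sum>i\<le>n. a i * psum ?N i (eigs U))"
      by (simp add: psum_def sum_distrib_left fun_eq_iff sum.swap[of _ "{..<?N}" "{..n}"])
    then show ?thesis by (simp only:) (intro borel_measurable_sum borel_measurable_times borel_measurable_const borel_psum_eigs)
  qed
  have trunc: "(\<lambda>U. if ?t U \<le> real R then ?S g U else 0) \<in> borel_measurable borel" for R :: nat
  proof -
    have "\<exists>q. real_polynomial_function q \<and> (\<forall>x\<in>{0..real R}. \<bar>g x - q x\<bar> < 1 / real (Suc n))" for n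
    proof -
      obtain q where "real_polynomial_function q" "\<And>x. x \<in> {0..real R} \<Longrightarrow> \<bar>g x - q x\<bar> < 1 / real (Suc n)"
        by (rule Stone_Weierstrass_real_polynomial_function[of "{0..real R}" g "1 / real (Suc n)"])
           (rule compact_Icc continuous_on_subset[OF g subset_UNIV] | simp | (rule that; assumption))+
      then show ?thesis by blast
    qed
    then obtain q where q: "\<And>n. real_polynomial_function (q n)" "\<And>n x. x \<in> {0..real R} \<Longrightarrow> \<bar>g x - q n x\<bar> < 1 / real (Suc n)"
      by metis
    show ?thesis
    proof (rule borel_measurable_LIMSEQ_real)
      show "(\<lambda>U. if ?t U \<le> real R then ?S (q n) U else 0) \<in> borel_measurable borel" for n
        using pol[OF q(1)[of n]] by measurable
      fix U :: "complex^('n+'n)^('n+'n)"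
      show "(\<lambda>n. if ?t U \<le> real R then ?S (q n) U else 0) \<longlonglongrightarrow> (if ?t U \<le> real R then ?S g U else 0)"
      proof (cases "?t U \<le> real R")
        case True
        have "(\<lambda>n. q n (eigs U k)) \<longlonglongrightarrow> g (eigs U k)" if k: "k < ?N" for k
        proof -
          have "eigs U k \<le> ?t U" unfolding psum_def
            using k eigs_bounds(1)[where U = U] by (simp, intro member_le_sum) auto
          then have "eigs U k \<in> {0..real R}" using True eigs_bounds(1)[OF k, of U] by auto
          from q(2)[OF this] have "\<bar>q n (eigs U k) - g (eigs U k)\<bar> \<le> 1 / real (Suc n)" for n
            by (simp add: abs_minus_commute less_imp_le)
          then have "(\<lambda>n. q n (eigs U k) - g (eigs U k)) \<longlonglongrightarrow> 0"
            by (intro Lim_null_comparison[OF _ LIMSEQ_Suc[OF lim_1_over_n]]) (auto intro!: always_eventually)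
          then show ?thesis by (simp add: LIM_zero_iff)
        qed
        then show ?thesis using True by (simp, intro tendsto_sum) auto
      qed simp
    qed
  qed
  show ?thesis
  proof (rule borel_measurable_LIMSEQ_real[OF _ trunc])
    fix U :: "complex^('n+'n)^('n+'n)"
    obtain R where R: "?t U \<le> real R" using real_arch_simple by blast
    show "(\<lambda>R. if ?t U \<le> real R then ?S g U else 0) \<longlonglongrightarrow> ?S g U"
      by (rule tendsto_eventually, rule eventually_sequentiallyI[of R]) (use R in auto)
  qed
qed

text \<open>The list is sorted, so the k-th entry is at most t exactly if more than k eigenvalues
  are. This count is symmetric in the eigenvalues and a limit of sums of continuous
  functions.\<close>

lemma borel_eigs:
  assumes k: "k < CARD('n::finite)"
  shows "(\<lambda>U :: complex^('n+'n)^('n+'n). eigs U k) \<in> borel_measurable borel"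
proof (rule borel_measurableI_le)
  fix t :: real
  let ?N = "CARD('n)"
  let ?c = "\<lambda>U :: complex^('n+'n)^('n+'n). \<Sum>j<?N. if eigs U j \<le> t then 1 else 0 :: real"
  \<comment> \<open>For n >= 1 a ramp equal to 1 up to t and to 0 from t + 1/n on; it tends to the
    indicator of the half-line up to t.\<close>
  let ?g = "\<lambda>n x. max 0 (min 1 (1 - real n * (x - t)))"
  have lim: "(\<lambda>n. ?g n x) \<longlonglongrightarrow> (if x \<le> t then 1 else 0)" for x
  proof (cases "x \<le> t")
    case True
    then have "real n * (x - t) \<le> 0" for n by (simp add: mult_nonneg_nonpos)
    then have "?g n x = 1" for n by (smt (verit))
    then show ?thesis using True by simp
  next
    case False
    obtain m where m: "1 / (x - t) \<le> real m" using real_arch_simple by blast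
    have "?g n x = 0" if "n \<ge> m" for n
    proof -
      have "1 / (x - t) \<le> real n" using m that by linarith
      then have "1 \<le> real n * (x - t)" using False by (simp add: field_simps)
      then show ?thesis by auto
    qed
    then show ?thesis using False by (intro tendsto_eventually eventually_sequentiallyI[of m]) auto
  qed
  have "?c \<in> borel_measurable borel"
  proof (rule borel_measurable_LIMSEQ_real)
    show "(\<lambda>U :: complex^('n+'n)^('n+'n). \<Sum>j<?N. ?g n (eigs U j)) \<in> borel_measurable borel" for n
      by (rule borel_sum_eigs) (intro continuous_intros)
    show "(\<lambda>n. \<Sum>j<?N. ?g n (eigs U j)) \<longlonglongrightarrow> ?c U" for U :: "complex^('n+'n)^('n+'n)"
      by (intro tendsto_sum lim)
  qed
  then have "{U. real k < ?c U} \<in> sets borel" by measurable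
  moreover have "real k < ?c U \<longleftrightarrow> eigs U k \<le> t" for U
  proof -
    have c: "?c U = real (card {j. j < ?N \<and> eigs U j \<le> t})"
      by (simp add: sum.If_cases) (simp add: lessThan_def Int_def)
    have mono: "eigs U i \<le> eigs U j" if "i \<le> j" "j < ?N" for i j
      unfolding eigs_def using that by (intro sorted_nth_mono sorted_eig_list) (auto simp: length_eig_list)
    show ?thesis
    proof
      assume "eigs U k \<le> t"
      then have "{..k} \<subseteq> {j. j < ?N \<and> eigs U j \<le> t}" using mono k by (auto intro: order_trans)
      then have "card {..k} \<le> card {j. j < ?N \<and> eigs U j \<le> t}" by (intro card_mono) auto
      then show "real k < ?c U" unfolding c by simp
    next
      assume l: "real k < ?c U"
      show "eigs U k \<le> t"
      proof (rule ccontr)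
        assume n: "\<not> eigs U k \<le> t"
        have "{j. j < ?N \<and> eigs U j \<le> t} \<subseteq> {..<k}"
        proof
          fix j assume "j \<in> {j. j < ?N \<and> eigs U j \<le> t}"
          then have "j < ?N" "eigs U j \<le> t" by auto
          then show "j \<in> {..<k}" using mono[of k j] n by (cases "j < k") auto
        qed
        then have "card {j. j < ?N \<and> eigs U j \<le> t} \<le> card {..<k}" by (intro card_mono) auto
        then show False using l unfolding c by simp
      qed
    qed
  qed
  ultimately have "{U :: complex^('n+'n)^('n+'n). eigs U k \<le> t} \<in> sets borel" by simp
  then show "{x \<in> space borel. eigs x k \<le> t} \<in> sets (borel :: (complex^('n+'n)^('n+'n)) measure)" by simp
qed

lemma symalg_eigs_integrable:
  assumes "G \<in> symalg CARD('n::finite)"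
  shows "integrable haar_unitary (\<lambda>U :: complex^('n+'n)^('n+'n). G (eigs U))"
proof -
  let ?N = "CARD('n)"
  have ps: "unitary_bdd (\<lambda>U :: complex^('n+'n)^('n+'n). of_real (psum ?N a (eigs U)))" for a
    unfolding cmom_psum[symmetric] by (rule dpair_base(1)[OF dpair_cmom])
  have pp: "unitary_bdd (\<lambda>U :: complex^('n+'n)^('n+'n). of_real (pprod ?N as (eigs U)))" for as
    by (induction as) (auto intro: unitary_bdd_const unitary_bdd_mult ps)
  have "unitary_bdd (\<lambda>U :: complex^('n+'n)^('n+'n). of_real (G (eigs U)))"
    using assms by (induction G rule: symalg.induct) (auto intro!: unitary_bdd_mult unitary_bdd_const pp unitary_bdd_add)
  then have "integrable haar_unitary (\<lambda>U :: complex^('n+'n)^('n+'n). complex_of_real (G (eigs U)))"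
    by (rule unitary_bdd_integrable)
  then show ?thesis by (simp only: complex_of_real_integrable_eq)
qed

lemma of_real_ldot:
  "of_real (ldot N \<delta> as x) = cldot (\<lambda>a. of_real (psum N a x)) (\<lambda>a. of_real (\<delta> a)) as"
proof -
  have "complex_of_real (pprod N as x) = (\<Prod>b\<leftarrow>as. of_real (psum N b x))" for as
    by (induction as) auto
  then show ?thesis by (induction as) auto
qed

lemma of_real_loopf: "of_real (loopf N k as x) = cloop (\<lambda>a. of_real (psum N a x)) k as"
proof -
  have "complex_of_real (pprod N as x) = (\<Prod>b\<leftarrow>as. of_real (psum N b x))" for as
    by (induction as) auto
  then show ?thesis unfolding loopf_def cloop_def by (simp add: of_real_ldot del: sum.lessThan_Suc)
qed

text \<open>The loop equations of the complex traces transfer to real power sums through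
  \<open>cmom_psum\<close>.\<close>

interpretation haar_functional: loop_functional "CARD('n::finite)"
  "\<lambda>G. LINT U|(haar_unitary :: (complex^('n+'n)^('n+'n)) measure). G (eigs U)"
proof
  interpret prob_space "haar_unitary :: (complex^('n+'n)^('n+'n)) measure" by (rule prob_space_haar)
  show "(LINT U|(haar_unitary :: (complex^('n+'n)^('n+'n)) measure). 1) = (1 :: real)" using prob_space by simp
  fix k as assume k: "1 \<le> (k :: nat)"
  let ?P = "emb (mat 1) :: complex^('n+'n)^('n+'n)"
  have "complex_of_real (LINT U|(haar_unitary :: (complex^('n+'n)^('n+'n)) measure). loopf CARD('n) k as (eigs U))
    = (LINT U|haar_unitary. cloop (cmom ?P U) k as)"
  proof -
    have "cmom ?P U = (\<lambda>a. complex_of_real (psum CARD('n) a (eigs U)))" for U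
      by (rule ext) (rule cmom_psum)
    then show ?thesis by (simp only: integral_complex_of_real[symmetric] of_real_loopf)
  qed
  also have "\<dots> = 0"
    by (rule haar_loop[OF _ _ k]) (simp_all add: emb_mult trace_emb trace_I)
  finally show "(LINT U|(haar_unitary :: (complex^('n+'n)^('n+'n)) measure). loopf CARD('n) k as (eigs U)) = 0"
    by simp
qed (auto intro!: Bochner_Integration.integral_add symalg_eigs_integrable)

definition dlists :: "nat \<Rightarrow> nat \<Rightarrow> nat list set" where
  "dlists N n = {vs. length vs = n \<and> distinct vs \<and> set vs \<subseteq> {..<N}}"

definition wlist :: "(nat \<Rightarrow> real) \<Rightarrow> nat list \<Rightarrow> nat list \<Rightarrow> real" where
  "wlist x as vs = (\<Prod>i<length as. x (vs ! i) ^ (as ! i))"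

text \<open>Augmented monomial symmetric polynomials: one term for each ordered choice of distinct
  indices.\<close>

definition msum :: "nat \<Rightarrow> nat list \<Rightarrow> (nat \<Rightarrow> real) \<Rightarrow> real" where
  "msum N as x = (\<Sum>vs\<in>dlists N (length as). wlist x as vs)"

lemma finite_dlists: "finite (dlists N n)"
proof (rule finite_subset)
  show "dlists N n \<subseteq> {vs. set vs \<subseteq> {..<N} \<and> length vs = n}" by (auto simp: dlists_def)
qed (simp add: finite_lists_length_eq)

lemma wlist_update:
  assumes "i < length as"
  shows "wlist x (as[i := as ! i + a]) vs = x (vs ! i) ^ a * wlist x as vs"
proof -
  have "wlist x (as[i := as ! i + a]) vs = (\<Prod>j<length as. (if j = i then x (vs ! i) ^ a else 1) * x (vs ! j) ^ (as ! j))"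
    unfolding wlist_def by (intro prod.cong) (auto simp: nth_list_update power_add)
  then show ?thesis using assms by (simp add: prod.distrib wlist_def)
qed

text \<open>Removing the terms in which the first index coincides with a later one expresses sums over
  distinct indices in power sums.\<close>

lemma msum_Cons:
  "msum N (a # as) x = psum N a x * msum N as x - (\<Sum>i<length as. msum N (as[i := as ! i + a]) x)"
proof -
  let ?n = "length as"
  have "msum N (a # as) x = (\<Sum>(vs, v)\<in>(SIGMA vs:dlists N ?n. {..<N} - set vs). x v ^ a * wlist x as vs)"
    unfolding msum_def
  proof (rule sum.reindex_bij_witness[where i = "\<lambda>(vs, v). v # vs" and j = "\<lambda>vs. (tl vs, hd vs)"])
    fix vs assume vs: "vs \<in> dlists N (length (a # as))"
    then obtain v ws where "vs = v # ws" by (cases vs) (auto simp: dlists_def)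
    then show "(case (tl vs, hd vs) of (vs, v) \<Rightarrow> v # vs) = vs" "(tl vs, hd vs) \<in> (SIGMA vs:dlists N ?n. {..<N} - set vs)"
      "(case (tl vs, hd vs) of (vs, v) \<Rightarrow> x v ^ a * wlist x as vs) = wlist x (a # as) vs"
      using vs by (auto simp: dlists_def wlist_def prod.lessThan_Suc_shift simp del: prod.lessThan_Suc)
  qed (auto simp: dlists_def)
  also have "\<dots> = (\<Sum>vs\<in>dlists N ?n. \<Sum>v\<in>{..<N} - set vs. x v ^ a * wlist x as vs)"
    by (rule sum.Sigma[symmetric]) (auto simp: finite_dlists)
  also have "\<dots> = (\<Sum>vs\<in>dlists N ?n. psum N a x * wlist x as vs - (\<Sum>i<?n. wlist x (as[i := as ! i + a]) vs))"
  proof (intro sum.cong refl)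
    fix vs assume "vs \<in> dlists N ?n"
    then have vs: "length vs = ?n" "distinct vs" "set vs \<subseteq> {..<N}" by (auto simp: dlists_def)
    have "(\<Sum>v\<in>{..<N} - set vs. x v ^ a * wlist x as vs) = psum N a x * wlist x as vs - (\<Sum>v\<in>set vs. x v ^ a * wlist x as vs)"
      using vs(3) by (simp add: sum_diff psum_def sum_distrib_right)
    also have "(\<Sum>v\<in>set vs. x v ^ a * wlist x as vs) = (\<Sum>i<?n. x (vs ! i) ^ a * wlist x as vs)"
      using sum.reindex_bij_betw[OF bij_betw_nth[OF vs(2) refl refl], of "\<lambda>v. x v ^ a * wlist x as vs"] vs(1)
      by simp
    also have "\<dots> = (\<Sum>i<?n. wlist x (as[i := as ! i + a]) vs)"
      by (intro sum.cong refl) (simp add: wlist_update)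
    finally show "(\<Sum>v\<in>{..<N} - set vs. x v ^ a * wlist x as vs) = psum N a x * wlist x as vs - (\<Sum>i<?n. wlist x (as[i := as ! i + a]) vs)" .
  qed
  also have "\<dots> = psum N a x * msum N as x - (\<Sum>vs\<in>dlists N ?n. \<Sum>i<?n. wlist x (as[i := as ! i + a]) vs)"
    by (simp add: sum_subtractf msum_def sum_distrib_left)
  also have "(\<Sum>vs\<in>dlists N ?n. \<Sum>i<?n. wlist x (as[i := as ! i + a]) vs) = (\<Sum>i<?n. msum N (as[i := as ! i + a]) x)"
    unfolding msum_def by (subst sum.swap) simp
  finally show ?thesis .
qed

text \<open>Induction on the length, because \<open>msum_Cons\<close> alters the exponents of the
  tail but leaves only shorter lists.\<close>

lemma symalg_msum: "msum N as \<in> symalg N"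
proof (induction "length as" arbitrary: as)
  case 0
  then have "as = []" by simp
  have "msum N [] = (\<lambda>x. 1)"
    by (simp add: msum_def dlists_def wlist_def fun_eq_iff conj_commute cong: conj_cong)
  then show ?case using symalg_const[of 1 N] by (simp add: \<open>as = []\<close>)
next
  case (Suc n)
  then obtain a bs where as: "as = a # bs" "length bs = n" by (cases as) auto
  have "(\<lambda>x. psum N a x * msum N bs x - (\<Sum>i<length bs. msum N (bs[i := bs ! i + a]) x)) \<in> symalg N"
    using as Suc.hyps(1) by (intro symalg_diff symalg_mult symalg_psum symalg_sum) auto
  then show ?case unfolding as(1) msum_Cons[abs_def] .
qed

lemma msum_perm:
  "msum N (map a [0..<N]) x = (\<Sum>\<sigma> | \<sigma> permutes {..<N}. \<Prod>j<N. x (\<sigma> j) ^ a j)"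
  unfolding msum_def
proof (rule sum.reindex_bij_witness[where i = "\<lambda>\<sigma>. map \<sigma> [0..<N]" and j = "\<lambda>vs j. if j < N then vs ! j else j"])
  fix vs assume "vs \<in> dlists N (length (map a [0..<N]))"
  then have vs: "length vs = N" "distinct vs" "set vs \<subseteq> {..<N}" by (auto simp: dlists_def)
  let ?s = "\<lambda>j. if j < N then vs ! j else j"
  show "map ?s [0..<N] = vs" using vs by (intro nth_equalityI) auto
  have "card (set vs) = card {..<N}" using vs by (simp add: distinct_card)
  then have "set vs = {..<N}" using vs(3) by (intro card_subset_eq) auto
  then have "bij_betw ((!) vs) {..<N} {..<N}" using bij_betw_nth[OF vs(2), of "{..<N}"] vs(1) by simp
  then have "bij_betw ?s {..<N} {..<N}" by (rule bij_betw_cong[THEN iffD1, rotated]) simp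
  then have "?s permutes {..<N}" by (rule bij_imp_permutes) simp
  then show "?s \<in> {\<sigma>. \<sigma> permutes {..<N}}" by simp
  show "(\<Prod>j<N. x (?s j) ^ a j) = wlist x (map a [0..<N]) vs"
    by (simp add: wlist_def)
next
  fix \<sigma> assume "\<sigma> \<in> {\<sigma>. \<sigma> permutes {..<N}}"
  then have s: "\<sigma> permutes {..<N}" by simp
  show "(\<lambda>j. if j < N then map \<sigma> [0..<N] ! j else j) = \<sigma>"
    using permutes_not_in[OF s] by (auto simp: fun_eq_iff)
  show "map \<sigma> [0..<N] \<in> dlists N (length (map a [0..<N]))"
    using permutes_image[OF s] permutes_inj_on[OF s] by (auto simp: dlists_def distinct_map atLeast0LessThan)
qed

text \<open>For two Legendre products the integral is a product of one-dimensional integrals, and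
  permuting the coordinates only permutes its factors.\<close>

lemma cube_integral_perm:
  assumes s: "\<sigma> permutes {..<N}" and F: "leg_span N F" and G: "leg_span N G"
  shows "cube_integral N (\<lambda>x. F (x \<circ> \<sigma>) * G (x \<circ> \<sigma>)) = cube_integral N (\<lambda>x. F x * G x)"
proof -
  obtain S c where Sc: "finite S" "\<And>x. F x = (\<Sum>k\<in>S. c k * leg_prod N k x)" using F unfolding leg_span_def by blast
  obtain T d where Td: "finite T" "\<And>x. G x = (\<Sum>k\<in>T. d k * leg_prod N k x)" using G unfolding leg_span_def by blast
  have si: "inv \<sigma> permutes {..<N}" by (rule permutes_inv[OF s])
  have r: "leg_prod N k (x \<circ> \<sigma>) = leg_prod N (k \<circ> inv \<sigma>) x" for k x
    using leg_prod_reindex[OF si, of k x] by (simp add: permutes_inv_inv[OF s])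
  have e: "cube_integral N (\<lambda>x. leg_prod N (k \<circ> inv \<sigma>) x * leg_prod N (l \<circ> inv \<sigma>) x) = cube_integral N (\<lambda>x. leg_prod N k x * leg_prod N l x)" for k l
    unfolding cube_integral_leg_prod_leg_prod using prod.permute[OF si, of "\<lambda>j. int01 (legp (k j) * legp (l j))"] by (simp add: o_def)
  have gen: "cube_integral N (\<lambda>x. (\<Sum>k\<in>S. c k * leg_prod N (f k) x) * (\<Sum>l\<in>T. d l * leg_prod N (f l) x))
     = (\<Sum>k\<in>S. \<Sum>l\<in>T. c k * d l * cube_integral N (\<lambda>x. leg_prod N (f k) x * leg_prod N (f l) x))" for f
  proof -
    have "(\<lambda>x. (\<Sum>k\<in>S. c k * leg_prod N (f k) x) * (\<Sum>l\<in>T. d l * leg_prod N (f l) x))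
       = (\<lambda>x. \<Sum>k\<in>S. \<Sum>l\<in>T. c k * d l * (leg_prod N (f k) x * leg_prod N (f l) x))"
      by (simp add: sum_product fun_eq_iff mult_ac)
    then show ?thesis
      by (simp only:) (subst cube_integral_sum; (subst cube_integral_sum)?; auto simp: cube_integral_scale intro!: cube_integrable_sum cube_integrable_scale cube_integrable_leg_prod_leg_prod)
  qed
  show ?thesis unfolding Sc Td r gen[of "\<lambda>k. k \<circ> inv \<sigma>"] gen[of "\<lambda>k. k"] e ..
qed

lemma leg_span_monomial: "leg_span N F \<Longrightarrow> leg_span N (\<lambda>x. (\<Prod>j<N. x j ^ a j) * F x)"
proof -
  assume F: "leg_span N F"
  have "m \<le> N \<Longrightarrow> leg_span N (\<lambda>x. (\<Prod>j<m. x j ^ a j) * F x)" for m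
  proof (induction m)
    case (Suc m)
    then show ?case using leg_span_power[of m N "\<lambda>x. (\<Prod>j<m. x j ^ a j) * F x" "a m"] by (simp add: mult_ac)
  qed (simp add: F eta_contract_eq)
  then show ?thesis by blast
qed

text \<open>A single monomial is not symmetric, but its sum over all permutations is an
  \<open>msum\<close>, to which \<open>loop_functional_unique\<close> applies. As vdm^2 is
  symmetric, all permuted monomials have the same cube integral, whence the factorial.\<close>

theorem haar_moments:
  "(LINT U|(haar_unitary :: (complex^('n::finite+'n)^('n+'n)) measure).
      (\<Sum>\<sigma> | \<sigma> permutes {..<CARD('n)}. \<Prod>j<CARD('n). eigs U (\<sigma> j) ^ a j))
   = fact CARD('n) * (cube_integral CARD('n) (\<lambda>x. (\<Prod>j<CARD('n). x j ^ a j) * (vdm CARD('n) x * vdm CARD('n) x)) / vnorm CARD('n))"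
proof -
  let ?N = "CARD('n)"
  let ?F = "\<lambda>x. (\<Prod>j<?N. x j ^ a j) * vdm ?N x"
  have F: "leg_span ?N ?F" by (intro leg_span_monomial leg_span_vdm)
  have "(LINT U|(haar_unitary :: (complex^('n+'n)^('n+'n)) measure). msum ?N (map a [0..<?N]) (eigs U))
    = cube_integral ?N (\<lambda>x. msum ?N (map a [0..<?N]) x * (vdm ?N x * vdm ?N x)) / vnorm ?N"
    by (rule haar_functional.loop_functional_unique[OF symalg_msum])
  also have "(\<lambda>x. msum ?N (map a [0..<?N]) x * (vdm ?N x * vdm ?N x))
     = (\<lambda>x. \<Sum>\<sigma> | \<sigma> permutes {..<?N}. ?F (x \<circ> \<sigma>) * vdm ?N (x \<circ> \<sigma>))"
  proof
    fix x
    have "(\<Prod>j<?N. x (\<sigma> j) ^ a j) * (vdm ?N x * vdm ?N x) = ?F (x \<circ> \<sigma>) * vdm ?N (x \<circ> \<sigma>)" if "\<sigma> permutes {..<?N}" for \<sigma>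
      unfolding altp_perm_arg[OF that] by (simp add: sign_def)
    then show "msum ?N (map a [0..<?N]) x * (vdm ?N x * vdm ?N x) = (\<Sum>\<sigma> | \<sigma> permutes {..<?N}. ?F (x \<circ> \<sigma>) * vdm ?N (x \<circ> \<sigma>))"
      unfolding msum_perm sum_distrib_right by (intro sum.cong) auto
  qed
  also have "cube_integral ?N (\<lambda>x. \<Sum>\<sigma> | \<sigma> permutes {..<?N}. ?F (x \<circ> \<sigma>) * vdm ?N (x \<circ> \<sigma>))
     = (\<Sum>\<sigma> | \<sigma> permutes {..<?N}. cube_integral ?N (\<lambda>x. ?F x * vdm ?N x))"
  proof -
    have "cube_integrable ?N (\<lambda>x. ?F (x \<circ> \<sigma>) * vdm ?N (x \<circ> \<sigma>))" if s: "\<sigma> permutes {..<?N}" for \<sigma>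
    proof -
      have sq: "vdm ?N (x \<circ> \<sigma>) * vdm ?N (x \<circ> \<sigma>) = vdm ?N x * vdm ?N x" for x
        unfolding altp_perm_arg[OF s] by (simp add: sign_def)
      have "(\<Prod>j<?N. (x \<circ> \<sigma>) j ^ a j) = (\<Prod>j<?N. x j ^ (a (inv \<sigma> j)))" for x :: "nat \<Rightarrow> real"
        using prod.permute[OF s, of "\<lambda>j. x j ^ (a (inv \<sigma> j))"] by (simp add: o_def permutes_inverses[OF s])
      then have "(\<lambda>x. ?F (x \<circ> \<sigma>) * vdm ?N (x \<circ> \<sigma>)) = (\<lambda>x. ((\<Prod>j<?N. x j ^ (a (inv \<sigma> j))) * vdm ?N x) * vdm ?N x)"
        by (simp only: mult.assoc sq)
      then show ?thesis by (simp only:) (intro cube_integrable_leg_span leg_span_monomial leg_span_vdm)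
    qed
    then have "cube_integral ?N (\<lambda>x. \<Sum>\<sigma> | \<sigma> permutes {..<?N}. ?F (x \<circ> \<sigma>) * vdm ?N (x \<circ> \<sigma>))
      = (\<Sum>\<sigma> | \<sigma> permutes {..<?N}. cube_integral ?N (\<lambda>x. ?F (x \<circ> \<sigma>) * vdm ?N (x \<circ> \<sigma>)))"
      by (intro cube_integral_sum) auto
    also have "\<dots> = (\<Sum>\<sigma> | \<sigma> permutes {..<?N}. cube_integral ?N (\<lambda>x. ?F x * vdm ?N x))"
      by (intro sum.cong refl cube_integral_perm[OF _ F leg_span_vdm]) auto
    finally show ?thesis .
  qed
  finally show ?thesis by (simp add: msum_perm card_permutations mult.assoc)
qed

subsection \<open>Moments determine measures on the cube\<close>

text \<open>Uniqueness in the Hausdorff moment problem: moments fix the integrals of polynomials, by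
  Weierstrass those of continuous functions, by ramps those of half-line indicators, hence the
  distribution function.\<close>

lemma moment_unique:
  assumes fb: "finite_borel_measure M1" "finite_borel_measure M2"
    and ae: "AE x in M1. x \<in> {0..1}" "AE x in M2. x \<in> {0..1}"
    and mom: "\<And>a. (LINT x|M1. x ^ a) = (LINT x|M2. x ^ a)"
  shows "M1 = M2"
proof -
  interpret A: finite_borel_measure M1 by fact
  interpret B: finite_borel_measure M2 by fact
  have lim: "(LINT x|M1. g x) = (LINT x|M2. g x)"
    if m: "\<And>n. s n \<in> borel_measurable borel" "g \<in> borel_measurable borel"
      and b: "\<And>n x. x \<in> {0..1} \<Longrightarrow> \<bar>s n x\<bar> \<le> C" and l: "\<And>x. x \<in> {0..1} \<Longrightarrow> (\<lambda>n. s n x) \<longlonglongrightarrow> g x"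
      and e: "\<And>n. (LINT x|M1. s n x) = (LINT x|M2. s n x)" for s :: "nat \<Rightarrow> real \<Rightarrow> real" and g C
  proof -
    have *: "(\<lambda>n. LINT x|M. s n x) \<longlonglongrightarrow> (LINT x|M. g x)" if "finite_measure M" "sets M = sets borel" "AE x in M. x \<in> {0..1}" for M
    proof (rule integral_dominated_convergence[where w = "\<lambda>_. C"])
      show "integrable M (\<lambda>_. C)" by (rule finite_measure.integrable_const[OF that(1)])
      show "g \<in> borel_measurable M" "s n \<in> borel_measurable M" for n
        using m by (simp_all add: measurable_cong_sets[OF that(2) refl])
      show "AE x in M. (\<lambda>n. s n x) \<longlonglongrightarrow> g x" using that(3) by eventually_elim (rule l)
      show "AE x in M. norm (s n x) \<le> C" for n using that(3) by eventually_elim (use b in simp)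
    qed
    have "(\<lambda>n. LINT x|M1. s n x) \<longlonglongrightarrow> (LINT x|M1. g x)"
      by (rule *) (use ae A.finite_measure_axioms A.M_is_borel in auto)
    moreover have "(\<lambda>n. LINT x|M2. s n x) \<longlonglongrightarrow> (LINT x|M2. g x)"
      by (rule *) (use ae B.finite_measure_axioms B.M_is_borel in auto)
    ultimately show ?thesis unfolding e by (rule LIMSEQ_unique)
  qed
  have pw: "integrable M (\<lambda>x. x ^ a)" if "finite_measure M" "sets M = sets borel" "AE x in M. x \<in> {0..1::real}" for M and a :: nat
  proof (rule finite_measure.integrable_const_bound[OF that(1), where B = 1])
    show "AE x in M. norm (x ^ a) \<le> 1" using that(3) by eventually_elim (auto simp: power_le_one)
    show "(\<lambda>x. x ^ a) \<in> borel_measurable M" by (simp add: measurable_cong_sets[OF that(2) refl])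
  qed
  have pol: "(LINT x|M1. q x) = (LINT x|M2. q x)" if q: "real_polynomial_function q" for q
  proof -
    obtain a n where "q = (\<lambda>x. \<Sum>i\<le>n. a i * x ^ i)" using q unfolding real_polynomial_function_iff_sum by blast
    then show ?thesis
      using pw[OF A.finite_measure_axioms A.M_is_borel ae(1)] pw[OF B.finite_measure_axioms B.M_is_borel ae(2)]
      by (simp add: mom)
  qed
  have cont: "(LINT x|M1. g x) = (LINT x|M2. g x)" if g: "continuous_on UNIV g" for g :: "real \<Rightarrow> real"
  proof -
    have "\<exists>q. real_polynomial_function q \<and> (\<forall>x\<in>{0..1}. \<bar>g x - q x\<bar> < 1 / real (Suc n))" for n
    proof -
      obtain q where "real_polynomial_function q" "\<And>x. x \<in> {0..1} \<Longrightarrow> \<bar>g x - q x\<bar> < 1 / real (Suc n)"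
        by (rule Stone_Weierstrass_real_polynomial_function[of "{0..1}" g "1 / real (Suc n)"])
           (rule compact_Icc continuous_on_subset[OF g subset_UNIV] | simp | (rule that; assumption))+
      then show ?thesis by blast
    qed
    then obtain q where q: "\<And>n. real_polynomial_function (q n)" "\<And>n x. x \<in> {0..1} \<Longrightarrow> \<bar>g x - q n x\<bar> < 1 / real (Suc n)"
      by metis
    have "bounded (g ` {0..1})"
      by (intro compact_imp_bounded compact_continuous_image continuous_on_subset[OF g]) auto
    then obtain C where "\<forall>x\<in>{0..1}. \<bar>g x\<bar> \<le> C" by (auto simp: bounded_iff)
    then have C: "\<bar>g x\<bar> \<le> C" if "x \<in> {0..1}" for x using that by blast
    show ?thesis
    \<comment> \<open>The approximations are within 1 of \<open>g\<close>, and |g| is at most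
      \<open>C\<close> on [0, 1].\<close>
    proof (rule lim[where s = q and C = "C + 1"])
      show "q n \<in> borel_measurable borel" for n
        using q(1)[of n] by (intro borel_measurable_continuous_onI continuous_on_polymonial_function) (auto simp: real_polynomial_function_eq)
      show "g \<in> borel_measurable borel" by (rule borel_measurable_continuous_onI[OF g])
      fix x :: real and n assume x: "x \<in> {0..1}"
      have "1 / real (Suc n) \<le> 1" by simp
      then show "\<bar>q n x\<bar> \<le> C + 1" using q(2)[OF x, of n] C[OF x] by linarith
    next
      fix x :: real assume x: "x \<in> {0..1}"
      have "\<bar>q n x - g x\<bar> \<le> 1 / real (Suc n)" for n using q(2)[OF x, of n] by (simp add: abs_minus_commute)
      then have "(\<lambda>n. q n x - g x) \<longlonglongrightarrow> 0"
        by (intro Lim_null_comparison[OF _ LIMSEQ_Suc[OF lim_1_over_n]]) (auto intro!: always_eventually)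
      then show "(\<lambda>n. q n x) \<longlonglongrightarrow> g x" by (simp add: LIM_zero_iff)
    qed (rule pol[OF q(1)])
  qed
  have "cdf M1 t = cdf M2 t" for t
  proof -
    let ?g = "\<lambda>n x. max 0 (min 1 (1 - real n * (x - t)))"
    have "(LINT x|M1. indicator {..t} x) = (LINT x|M2. indicator {..t} x :: real)"
    proof (rule lim[where s = ?g and C = 1])
      show "?g n \<in> borel_measurable borel" for n by measurable
      show "(LINT x|M1. ?g n x) = (LINT x|M2. ?g n x)" for n by (rule cont) (intro continuous_intros)
      show "\<bar>?g n x\<bar> \<le> 1" for n x by auto
      show "(\<lambda>n. ?g n x) \<longlonglongrightarrow> indicator {..t} x" for x
      proof (cases "x \<le> t")
        case True
        then have "real n * (x - t) \<le> 0" for n by (simp add: mult_nonneg_nonpos)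
        then have "?g n x = 1" for n by (smt (verit))
        then show ?thesis using True by simp
      next
        case False
        obtain m where m: "1 / (x - t) \<le> real m" using real_arch_simple by blast
        have "?g n x = 0" if "n \<ge> m" for n
        proof -
          have "1 / (x - t) \<le> real n" using m that by linarith
          then have "1 \<le> real n * (x - t)" using False by (simp add: field_simps)
          then show ?thesis by auto
        qed
        then show ?thesis using False by (intro tendsto_eventually eventually_sequentiallyI[of m]) auto
      qed
    qed simp
    then show ?thesis unfolding cdf_def by (simp add: A.M_is_borel B.M_is_borel)
  qed
  then show ?thesis using fb by (intro cdf_unique') auto
qed

text \<open>\<open>moment_unique\<close> for the image under X of the measure with density h, which
  sits on [0, 1] by \<open>z\<close>. It trades powers of one coordinate for indicators while h
  carries the others.\<close>

lemma weighted_moment_unique: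
  assumes fm: "finite_measure \<mu>" "finite_measure \<nu>" and s: "sets \<mu> = sets \<nu>"
    and X: "X \<in> borel_measurable \<mu>" and h: "h \<in> borel_measurable \<mu>" "\<And>x. 0 \<le> h x" "\<And>x. h x \<le> 1"
    and z: "\<And>x. X x \<notin> {0..1} \<Longrightarrow> h x = 0"
    and mom: "\<And>a. (LINT x|\<mu>. h x * X x ^ a) = (LINT x|\<nu>. h x * X x ^ a)"
    and A: "A \<in> sets borel"
  shows "(LINT x|\<mu>. h x * indicator A (X x)) = (LINT x|\<nu>. h x * indicator A (X x :: real))"
proof -
  define M where "M \<rho> = distr (density \<rho> (\<lambda>x. ennreal (h x))) borel X" for \<rho>
  have M: "finite_borel_measure (M \<rho>)" "AE x in M \<rho>. x \<in> {0..1}"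
      "\<And>f :: real \<Rightarrow> real. f \<in> borel_measurable borel \<Longrightarrow> (LINT x|M \<rho>. f x) = (LINT x|\<rho>. h x * f (X x))"
    if f: "finite_measure \<rho>" and sr: "sets \<rho> = sets \<mu>" for \<rho>
  proof -
    have [measurable]: "X \<in> borel_measurable \<rho>" "h \<in> borel_measurable \<rho>"
      using X h by (simp_all add: measurable_cong_sets[OF sr refl])
    interpret finite_measure \<rho> by fact
    have "emeasure (M \<rho>) UNIV = (\<integral>\<^sup>+x. ennreal (h x) \<partial>\<rho>)"
      unfolding M_def by (subst emeasure_distr) (auto simp: emeasure_density space_density intro!: nn_integral_cong)
    also have "\<dots> \<le> (\<integral>\<^sup>+x. 1 \<partial>\<rho>)" using h(3) by (intro nn_integral_mono) (simp add: ennreal_le_1)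
    also have "\<dots> < \<infinity>" 
      by (simp add: top.not_eq_extremum[symmetric] emeasure_finite[unfolded infinity_ennreal_def])
    finally have "emeasure (M \<rho>) (space (M \<rho>)) \<noteq> \<infinity>" by (simp add: M_def)
    then show "finite_borel_measure (M \<rho>)"
      unfolding finite_borel_measure_def finite_borel_measure_axioms_def by (auto intro!: finite_measureI simp: M_def)
    show "AE x in M \<rho>. x \<in> {0..1}"
    proof -
      have "AE x in \<rho>. 0 < ennreal (h x) \<longrightarrow> X x \<in> {0..1}" using z by (intro AE_I2) force
      then show ?thesis unfolding M_def by (subst AE_distr_iff) (auto simp: AE_density)
    qed
    fix f :: "real \<Rightarrow> real" assume [measurable]: "f \<in> borel_measurable borel"
    show "(LINT x|M \<rho>. f x) = (LINT x|\<rho>. h x * f (X x))"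
      unfolding M_def using h(2) by (subst integral_distr) (auto simp: integral_density)
  qed
  have "M \<mu> = M \<nu>"
    by (rule moment_unique) (use M[OF fm(1) refl] M[OF fm(2) s[symmetric]] mom in auto)
  then have "(LINT x|M \<mu>. indicator A x) = (LINT x|M \<nu>. indicator A x :: real)" by simp
  then show ?thesis using M(3)[OF fm(1) refl, of "indicator A"] M(3)[OF fm(2) s[symmetric], of "indicator A"] A
    by simp
qed

text \<open>Coordinates are converted one at a time from powers to indicators; after N conversions
  the measures agree on boxes, which determine them.\<close>

lemma cube_moments_unique:
  fixes \<mu> \<nu> :: "(nat \<Rightarrow> real) measure"
  assumes fm: "finite_measure \<mu>" "finite_measure \<nu>"
    and s: "sets \<mu> = sets (PiM {..<N} (\<lambda>_. borel))" "sets \<nu> = sets (PiM {..<N} (\<lambda>_. borel))"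
    and ae: "AE x in \<mu>. \<forall>j<N. x j \<in> {0..1}" "AE x in \<nu>. \<forall>j<N. x j \<in> {0..1}"
    and mom: "\<And>a. (LINT x|\<mu>. (\<Prod>j<N. x j ^ a j)) = (LINT x|\<nu>. (\<Prod>j<N. x j ^ a j))"
  shows "\<mu> = \<nu>"
proof -
  have ms: "borel_measurable \<mu> = borel_measurable (PiM {..<N} (\<lambda>_. borel :: real measure))"
     "borel_measurable \<nu> = borel_measurable (PiM {..<N} (\<lambda>_. borel :: real measure))"
    by (intro measurable_cong_sets s refl)+
  \<comment> \<open>Test function in coordinate j: an indicator for j < m, a power otherwise. The
    cut-off to [0, 1] keeps it between 0 and 1, as \<open>weighted_moment_unique\<close> requires of
    weights.\<close>
  let ?t = "\<lambda>m A a j t. indicator {0..1} t * (if j < m then indicator (A j) t else t ^ a j) :: real"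
  have tb: "0 \<le> ?t m A a j t" "?t m A a j t \<le> 1" for m A a j t
    by (auto simp: indicator_def power_le_one)
  have tm[measurable]: "(\<lambda>x. ?t m A a j (x j)) \<in> borel_measurable (PiM {..<N} (\<lambda>_. borel :: real measure))"
    if "j < N" "\<And>j. A j \<in> sets borel" for m A a j
  proof -
    have [measurable]: "A j \<in> sets borel" "j \<in> {..<N}" using that by auto
    show ?thesis by measurable
  qed
  have claim: "m \<le> N \<Longrightarrow> (LINT x|\<mu>. (\<Prod>j<N. ?t m A a j (x j))) = (LINT x|\<nu>. (\<Prod>j<N. ?t m A a j (x j)))"
    if A: "\<And>j. A j \<in> sets borel" for m A a
  proof (induction m arbitrary: a)
    case 0
    have "(LINT x|\<rho>. (\<Prod>j<N. ?t 0 A a j (x j))) = (LINT x|\<rho>. (\<Prod>j<N. x j ^ a j))"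
      if "AE x in \<rho>. \<forall>j<N. x j \<in> {0..1}" "sets \<rho> = sets (PiM {..<N} (\<lambda>_. borel))" for \<rho>
    proof (rule integral_cong_AE)
      show "AE x in \<rho>. (\<Prod>j<N. ?t 0 A a j (x j)) = (\<Prod>j<N. x j ^ a j)"
        using that(1) by eventually_elim (auto intro!: prod.cong)
      have e: "borel_measurable \<rho> = borel_measurable (PiM {..<N} (\<lambda>_. borel :: real measure))"
        by (intro measurable_cong_sets that refl)
      show "(\<lambda>x. \<Prod>j<N. ?t 0 A a j (x j)) \<in> borel_measurable \<rho>"
        unfolding e by (intro borel_measurable_prod tm A) auto
      show "(\<lambda>x. \<Prod>j<N. x j ^ a j) \<in> borel_measurable \<rho>"
        unfolding e by (intro borel_measurable_prod borel_measurable_power measurable_component_singleton) auto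
    qed
    from this[OF ae(1) s(1)] this[OF ae(2) s(2)] show ?case using mom by simp
  next
    case (Suc m)
    then have m: "m < N" by simp
    let ?h = "\<lambda>x. indicator {0..1} (x m) * (\<Prod>j\<in>{..<N} - {m}. ?t m A a j (x j)) :: real"
    have split: "(\<Prod>j<N. ?t k A b j (x j)) = indicator {0..1} (x m) * (\<Prod>j\<in>{..<N} - {m}. ?t k A b j (x j)) * (if m < k then indicator (A m) (x m) else x m ^ b m)" for k b x
      using m by (subst prod.remove[of _ m]) auto
    have upd: "(\<Prod>j<N. ?t m A (a(m := b)) j (x j)) = ?h x * x m ^ b" for b x
      unfolding split by (intro arg_cong2[where f = "(*)"] prod.cong) auto
    have Sm: "(\<Prod>j<N. ?t (Suc m) A a j (x j)) = ?h x * indicator (A m) (x m)" for x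
      unfolding split by (intro arg_cong2[where f = "(*)"] prod.cong) (auto simp: less_Suc_eq)
    have "(LINT x|\<mu>. ?h x * indicator (A m) (x m)) = (LINT x|\<nu>. ?h x * indicator (A m) (x m))"
    proof (rule weighted_moment_unique[OF fm])
      show "sets \<mu> = sets \<nu>" using s by simp
      show "(\<lambda>x. x m) \<in> borel_measurable \<mu>" unfolding ms using m by (intro measurable_component_singleton) auto
      have [measurable]: "m \<in> {..<N}" using m by auto
      show "?h \<in> borel_measurable \<mu>" unfolding ms
      proof (rule borel_measurable_times)
        show "(\<lambda>x. indicator {0..1} (x m) :: real) \<in> borel_measurable (PiM {..<N} (\<lambda>_. borel :: real measure))"
          by measurable
        show "(\<lambda>x. \<Prod>j\<in>{..<N} - {m}. ?t m A a j (x j)) \<in> borel_measurable (PiM {..<N} (\<lambda>_. borel :: real measure))"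
          by (rule borel_measurable_prod, rule tm) (use A in auto)
      qed
      show "0 \<le> ?h x" for x by (rule mult_nonneg_nonneg[OF indicator_pos_le prod_nonneg[OF tb(1)]])
      show "?h x \<le> 1" for x
        by (rule mult_le_one[OF indicator_le_1 prod_nonneg[OF tb(1)] prod_le_1[OF conjI[OF tb]]])
      show "(LINT x|\<mu>. ?h x * x m ^ b) = (LINT x|\<nu>. ?h x * x m ^ b)" for b
        using Suc.IH[of "a(m := b)"] m unfolding upd by simp
    qed (use A in auto)
    then show ?case unfolding Sm .
  qed
  show ?thesis
  proof (rule measure_eqI_PiM_finite[where I = "{..<N}" and M = "\<lambda>_. borel"])
    show "finite {..<N}" by simp
    show "sets \<mu> = sets (PiM {..<N} (\<lambda>_. borel))" "sets \<nu> = sets (PiM {..<N} (\<lambda>_. borel))" by fact+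
    show "range (\<lambda>_ :: nat. Pi\<^sub>E {..<N} (\<lambda>_. UNIV :: real set)) \<subseteq> prod_algebra {..<N} (\<lambda>_. borel)"
      by (auto intro!: prod_algebraI_finite)
    show "(\<Union>i :: nat. Pi\<^sub>E {..<N} (\<lambda>_. UNIV :: real set)) = space (PiM {..<N} (\<lambda>_. borel))"
      by (simp add: space_PiM)
    show "emeasure \<mu> (Pi\<^sub>E {..<N} (\<lambda>_. UNIV)) \<noteq> \<infinity>"
      using finite_measure.emeasure_finite[OF fm(1)] by simp
    fix A :: "nat \<Rightarrow> real set" assume A: "\<And>i. i \<in> {..<N} \<Longrightarrow> A i \<in> sets borel"
    \<comment> \<open>Filled up beyond \<open>N\<close> by a Borel set, because \<open>claim\<close>
      asks for measurability at every index.\<close>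
    define A' where "A' j = (if j < N then A j else {})" for j
    have A': "A' j \<in> sets borel" for j using A by (simp add: A'_def)
    have e: "(LINT x|\<rho>. (\<Prod>j<N. ?t N A' (\<lambda>_. 0) j (x j))) = measure \<rho> (Pi\<^sub>E {..<N} A)"
      if "AE x in \<rho>. \<forall>j<N. x j \<in> {0..1}" "sets \<rho> = sets (PiM {..<N} (\<lambda>_. borel))" for \<rho>
    proof -
      have e: "borel_measurable \<rho> = borel_measurable (PiM {..<N} (\<lambda>_. borel :: real measure))"
        by (intro measurable_cong_sets that refl)
      have Pb: "Pi\<^sub>E {..<N} A \<in> sets \<rho>" unfolding that(2) using A by (intro sets_PiM_I_finite) auto
      have sp: "space \<rho> = Pi\<^sub>E {..<N} (\<lambda>_. UNIV)" using sets_eq_imp_space_eq[OF that(2)] by (simp add: space_PiM)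
      have "(LINT x|\<rho>. (\<Prod>j<N. ?t N A' (\<lambda>_. 0) j (x j))) = (LINT x|\<rho>. indicator (Pi\<^sub>E {..<N} A) x)"
      proof (rule integral_cong_AE)
        show "AE x in \<rho>. (\<Prod>j<N. ?t N A' (\<lambda>_. 0) j (x j)) = indicator (Pi\<^sub>E {..<N} A) x"
          using that(1) AE_space[of \<rho>]
        proof eventually_elim
          fix x assume x: "\<forall>j<N. x j \<in> {0..1}" "x \<in> space \<rho>"
          have "(\<Prod>j<N. ?t N A' (\<lambda>_. 0) j (x j)) = (\<Prod>j<N. indicator (A j) (x j))"
            using x(1) by (intro prod.cong) (auto simp: A'_def)
          also have "\<dots> = indicator (Pi\<^sub>E {..<N} A) x"
          proof (cases "x \<in> Pi\<^sub>E {..<N} A")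
            case False
            then obtain j where j: "j < N" "x j \<notin> A j" using x(2) by (auto simp: sp PiE_iff)
            have "(\<Prod>j<N. indicator (A j) (x j) :: real) = 0"
            proof (rule prod_zero)
              show "\<exists>a\<in>{..<N}. indicator (A a) (x a) = (0 :: real)"
                using j by (intro bexI[of _ j]) auto
            qed simp
            then show ?thesis using False by simp
          qed (auto simp: PiE_iff intro!: prod.neutral)
          finally show "(\<Prod>j<N. ?t N A' (\<lambda>_. 0) j (x j)) = indicator (Pi\<^sub>E {..<N} A) x" .
        qed
        show "(\<lambda>x. \<Prod>j<N. ?t N A' (\<lambda>_. 0) j (x j)) \<in> borel_measurable \<rho>"
          unfolding e by (intro borel_measurable_prod tm A') auto
        show "indicator (Pi\<^sub>E {..<N} A) \<in> borel_measurable \<rho>" using Pb by simp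
      qed
      also have "\<dots> = measure \<rho> (Pi\<^sub>E {..<N} A)" using Pb by (simp add: Int_absorb2 sets.sets_into_space)
      finally show ?thesis .
    qed
    have cl: "(LINT x|\<mu>. (\<Prod>j<N. ?t N A' (\<lambda>_. 0) j (x j))) = (LINT x|\<nu>. (\<Prod>j<N. ?t N A' (\<lambda>_. 0) j (x j)))"
      by (rule claim[OF _ order_refl]) (rule A')
    have "measure \<mu> (Pi\<^sub>E {..<N} A) = measure \<nu> (Pi\<^sub>E {..<N} A)"
      using e[OF ae(1) s(1)] e[OF ae(2) s(2)] cl by simp
    then show "emeasure \<mu> (Pi\<^sub>E {..<N} A) = emeasure \<nu> (Pi\<^sub>E {..<N} A)"
      using fm by (simp add: finite_measure.emeasure_eq_measure)
  qed
qed

subsection \<open>The joint eigenvalue density\<close>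

definition jdens :: "nat \<Rightarrow> (nat \<Rightarrow> real) \<Rightarrow> real" where
  "jdens N x = cubemap N (\<lambda>x. vdm N x * vdm N x) x / vnorm N"

lemma borel_vdm: "vdm N \<in> borel_measurable (PiM {..<N} (\<lambda>_. lborel))"
proof -
  have "(\<lambda>x. poly p (x j)) \<in> borel_measurable (PiM {..<N} (\<lambda>_. lborel :: real measure))" if "j < N" for j p
    by (rule measurable_compose[OF measurable_component_singleton[of j "{..<N}"]])
       (use that in \<open>auto intro!: borel_measurable_continuous_onI continuous_intros\<close>)
  then show ?thesis unfolding vdm_expand[abs_def] leg_prod_def
    by (intro borel_measurable_sum borel_measurable_times borel_measurable_const borel_measurable_prod) auto
qed

lemma borel_cube_indicator:
  "(\<lambda>x. (\<Prod>j<N. indicator {0..1} (x j)) :: real) \<in> borel_measurable (PiM {..<N} (\<lambda>_. lborel :: real measure))"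
proof (intro borel_measurable_prod)
  fix j assume "j \<in> {..<N}"
  then show "(\<lambda>x. indicator {0..1} (x j) :: real) \<in> borel_measurable (PiM {..<N} (\<lambda>_. lborel :: real measure))"
    by (intro measurable_compose[OF measurable_component_singleton[of j "{..<N}"]]) auto
qed

lemma borel_jdens: "jdens N \<in> borel_measurable (PiM {..<N} (\<lambda>_. lborel))"
  unfolding jdens_def[abs_def] cubemap_def
  by (intro borel_measurable_divide borel_measurable_times borel_cube_indicator borel_vdm borel_measurable_const)

lemma jdens_nonneg: "0 \<le> jdens N x"
  unfolding jdens_def cubemap_def using vnorm_pos[of N]
  by (intro divide_nonneg_pos mult_nonneg_nonneg[OF prod_nonneg zero_le_square]) auto

lemma integral_jdens:
  "(LINT x|density (PiM {..<N} (\<lambda>_. lborel)) (\<lambda>x. ennreal (jdens N x)). (\<Prod>j<N. x j ^ a j))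
   = cube_integral N (\<lambda>x. (\<Prod>j<N. x j ^ a j) * (vdm N x * vdm N x)) / vnorm N"
proof -
  have "(\<lambda>x. \<Prod>j<N. x j ^ a j) \<in> borel_measurable (PiM {..<N} (\<lambda>_. lborel :: real measure))"
  proof (intro borel_measurable_prod borel_measurable_power)
    fix j assume "j \<in> {..<N}"
    then show "(\<lambda>x. x j) \<in> borel_measurable (PiM {..<N} (\<lambda>_. lborel :: real measure))"
      using measurable_component_singleton[of j "{..<N}" "\<lambda>_. lborel :: real measure"] by simp
  qed
  then have "(LINT x|density (PiM {..<N} (\<lambda>_. lborel)) (\<lambda>x. ennreal (jdens N x)). (\<Prod>j<N. x j ^ a j))
    = (LINT x|PiM {..<N} (\<lambda>_. lborel). jdens N x *\<^sub>R (\<Prod>j<N. x j ^ a j))"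
    by (intro integral_density borel_jdens AE_I2 jdens_nonneg)
  also have "\<dots> = (LINT x|PiM {..<N} (\<lambda>_. lborel). cubemap N (\<lambda>x. (\<Prod>j<N. x j ^ a j) * (vdm N x * vdm N x)) x / vnorm N)"
    by (intro Bochner_Integration.integral_cong refl) (simp add: jdens_def cubemap_def)
  finally show ?thesis by (simp add: cube_integral_def)
qed

definition eig_perm :: "(complex^('n::finite+'n)^('n+'n)) \<times> (nat \<Rightarrow> nat) \<Rightarrow> nat \<Rightarrow> real" where
  "eig_perm = (\<lambda>(U, \<sigma>). \<lambda>i\<in>{..<CARD('n)}. eig_list U ! \<sigma> i)"

text \<open>The position in the list is random too; as there are finitely many permutations,
  measurability is checked for each fixed one.\<close>

lemma measurable_eig_perm:
  "(eig_perm :: (complex^('n::finite+'n)^('n+'n)) \<times> (nat \<Rightarrow> nat) \<Rightarrow> nat \<Rightarrow> real)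
    \<in> measurable (haar_unitary \<Otimes>\<^sub>M uniform_count_measure {\<sigma>. \<sigma> permutes {..<CARD('n)}}) (PiM {..<CARD('n)} (\<lambda>_. borel))"
proof -
  let ?N = "CARD('n)"
  let ?S = "{\<sigma>. \<sigma> permutes {..<?N}}"
  have ex: "\<exists>\<sigma>. \<sigma> permutes {..<?N}" by (rule exI, rule permutes_id)
  have c: "(\<lambda>z :: (complex^('n+'n)^('n+'n)) \<times> (nat \<Rightarrow> nat). eigs (fst z) (snd z i)) \<in> borel_measurable (borel \<Otimes>\<^sub>M count_space ?S)"
    if i: "i < ?N" for i
  proof (rule measurable_compose_countable'[where g = snd and I = ?S and f = "\<lambda>\<sigma> z. eigs (fst z) (\<sigma> i)"])
    fix \<sigma> assume "\<sigma> \<in> ?S"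
    then have "\<sigma> i < ?N" using i permutes_in_image[of \<sigma> "{..<?N}" i] by simp
    then show "(\<lambda>z :: (complex^('n+'n)^('n+'n)) \<times> (nat \<Rightarrow> nat). eigs (fst z) (\<sigma> i)) \<in> borel_measurable (borel \<Otimes>\<^sub>M count_space ?S)"
      by (rule measurable_compose[OF measurable_fst borel_eigs])
  qed (auto simp: finite_perms ex intro: countable_finite)
  have eq: "sets (haar_unitary \<Otimes>\<^sub>M uniform_count_measure ?S) = sets (borel \<Otimes>\<^sub>M count_space ?S :: ((complex^('n+'n)^('n+'n)) \<times> (nat \<Rightarrow> nat)) measure)"
    by (intro sets_pair_measure_cong sets_haar sets_uniform_count_measure_count_space)
  show ?thesis
    unfolding measurable_cong_sets[OF eq refl] eig_perm_def split_beta' eigs_def[symmetric]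
    by (rule measurable_restrict) (use c in auto)
qed

lemma eig_sym_law_eq: "eig_sym_law (t :: 'n::finite itself)
   = distr (haar_unitary \<Otimes>\<^sub>M uniform_count_measure {\<sigma>. \<sigma> permutes {..<CARD('n)}}) (PiM {..<CARD('n)} (\<lambda>_. borel))
     (eig_perm :: (complex^('n+'n)^('n+'n)) \<times> (nat \<Rightarrow> nat) \<Rightarrow> nat \<Rightarrow> real)"
  by (simp add: eig_sym_law_def eig_perm_def)

lemma prob_space_perms: "prob_space (uniform_count_measure {\<sigma>. \<sigma> permutes {..<N :: nat}})"
proof (rule prob_space_uniform_count_measure[OF finite_perms])
  have "id \<in> {\<sigma>. \<sigma> permutes {..<N}}" by (simp add: permutes_id)
  then show "{\<sigma>. \<sigma> permutes {..<N}} \<noteq> {}" by blast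
qed

lemma cube_sets:
  "{x \<in> space (PiM {..<N} (\<lambda>_. borel)). \<forall>j<N. x j \<in> {0..1 :: real}} \<in> sets (PiM {..<N :: nat} (\<lambda>_. borel :: real measure))"
proof -
  have "{x \<in> space (PiM {..<N} (\<lambda>_. borel :: real measure)). \<forall>j<N. x j \<in> {0..1}} = Pi\<^sub>E {..<N} (\<lambda>_. {0..1})"
  proof (intro equalityI subsetI)
    fix x :: "nat \<Rightarrow> real" assume x: "x \<in> {x \<in> space (PiM {..<N} (\<lambda>_. borel)). \<forall>j<N. x j \<in> {0..1}}"
    then have "x \<in> Pi\<^sub>E {..<N} (\<lambda>_. UNIV)" by (simp add: space_PiM)
    then have "x j = undefined" if "j \<notin> {..<N}" for j using that by (rule PiE_arb)
    then show "x \<in> Pi\<^sub>E {..<N} (\<lambda>_. {0..1})" using x by (intro PiE_I) auto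
  next
    fix x :: "nat \<Rightarrow> real" assume x: "x \<in> Pi\<^sub>E {..<N} (\<lambda>_. {0..1})"
    have "x \<in> Pi\<^sub>E {..<N} (\<lambda>_. UNIV)" using subsetD[OF PiE_mono[of "{..<N}" "\<lambda>_. {0..1}" "\<lambda>_. UNIV"] x] by simp
    moreover have "\<forall>j<N. x j \<in> {0..1}" using PiE_mem[OF x] by blast
    ultimately show "x \<in> {x \<in> space (PiM {..<N} (\<lambda>_. borel)). \<forall>j<N. x j \<in> {0..1}}" by (simp add: space_PiM)
  qed
  then show ?thesis by (simp add: sets_PiM_I_finite del: atLeastAtMost_iff)
qed

theorem eig_sym_law_density:
  "eig_sym_law (t :: 'n::finite itself)
    = density (PiM {..<CARD('n)} (\<lambda>_. lborel)) (\<lambda>x. ennreal (jdens CARD('n) x))"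
proof -
  let ?N = "CARD('n)"
  let ?S = "{\<sigma>. \<sigma> permutes {..<?N}}"
  let ?H = "haar_unitary :: (complex^('n+'n)^('n+'n)) measure"
  let ?u = "uniform_count_measure ?S"
  let ?D = "density (PiM {..<?N} (\<lambda>_. lborel)) (\<lambda>x. ennreal (jdens ?N x))"
  interpret H: prob_space ?H by (rule prob_space_haar)
  interpret u: prob_space ?u by (rule prob_space_perms)
  interpret pair_prob_space ?H ?u ..
  have meas: "eig_perm \<in> measurable (?H \<Otimes>\<^sub>M ?u) (PiM {..<?N} (\<lambda>_. borel))" by (rule measurable_eig_perm)
  have sD: "sets ?D = sets (PiM {..<?N} (\<lambda>_. borel))" by (simp cong: sets_PiM_cong)
  have AEp: "AE z in ?H \<Otimes>\<^sub>M ?u. \<forall>j<?N. eig_perm z j \<in> {0..1}"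
  proof (rule AE_pair_measure)
    have "{z \<in> space (?H \<Otimes>\<^sub>M ?u). \<forall>j<?N. eig_perm z j \<in> {0..1}}
      = eig_perm -` {x \<in> space (PiM {..<?N} (\<lambda>_. borel)). \<forall>j<?N. x j \<in> {0..1}} \<inter> space (?H \<Otimes>\<^sub>M ?u)"
      using measurable_space[OF meas] by blast
    then show "{z \<in> space (?H \<Otimes>\<^sub>M ?u). \<forall>j<?N. eig_perm z j \<in> {0..1}} \<in> sets (?H \<Otimes>\<^sub>M ?u)"
      by (simp only: measurable_sets[OF meas cube_sets])
    show "AE U in ?H. AE \<sigma> in ?u. \<forall>j<?N. eig_perm (U, \<sigma>) j \<in> {0..1}"
      using AE_haar
    proof eventually_elim
      fix U :: "complex^('n+'n)^('n+'n)" assume U: "is_unitary_mat U"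
      show "AE \<sigma> in ?u. \<forall>j<?N. eig_perm (U, \<sigma>) j \<in> {0..1}"
      proof (rule AE_I2, intro allI impI)
        fix \<sigma> j assume "\<sigma> \<in> space ?u" and j: "j < ?N"
        then have "\<sigma> permutes {..<?N}" by (simp add: space_uniform_count_measure)
        then have "\<sigma> j < ?N" using j permutes_in_image[of \<sigma> "{..<?N}" j] by simp
        then show "eig_perm (U, \<sigma>) j \<in> {0..1}"
          using eigs_bounds[of "\<sigma> j" U] U j by (simp add: eig_perm_def eigs_def)
      qed
    qed
  qed
  have mono: "(\<lambda>x. \<Prod>j<?N. x j ^ a j) \<in> borel_measurable (PiM {..<?N} (\<lambda>_. borel :: real measure))" for a
    by (intro borel_measurable_prod borel_measurable_power measurable_component_singleton) auto
  have moments: "(LINT x|eig_sym_law t. (\<Prod>j<?N. x j ^ a j)) = (LINT x|?D. (\<Prod>j<?N. x j ^ a j))" for a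
  proof -
    have "(LINT x|eig_sym_law t. (\<Prod>j<?N. x j ^ a j)) = (LINT z|(?H \<Otimes>\<^sub>M ?u). (\<Prod>j<?N. eig_perm z j ^ a j))"
      unfolding eig_sym_law_eq by (rule integral_distr[OF meas mono])
    also have "\<dots> = (LINT U|?H. (LINT \<sigma>|?u. (\<Prod>j<?N. eig_perm (U, \<sigma>) j ^ a j)))"
    proof (rule integral_fst'[symmetric])
      show "integrable (?H \<Otimes>\<^sub>M ?u) (\<lambda>z. \<Prod>j<?N. eig_perm z j ^ a j)"
      proof (rule integrable_const_bound[where B = 1])
        show "AE z in ?H \<Otimes>\<^sub>M ?u. norm (\<Prod>j<?N. eig_perm z j ^ a j) \<le> 1"
          using AEp by eventually_elim (auto simp: abs_prod intro!: prod_le_1 power_le_one)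
        show "(\<lambda>z. \<Prod>j<?N. eig_perm z j ^ a j) \<in> borel_measurable (?H \<Otimes>\<^sub>M ?u)"
          by (rule measurable_compose[OF meas mono])
      qed
    qed
    \<comment> \<open>The uniform average over permutations divides by the factorial that
      \<open>haar_moments\<close> produces.\<close>
    also have "\<dots> = (LINT U|?H. ((\<Sum>\<sigma> | \<sigma> permutes {..<?N}. (\<Prod>j<?N. eigs U (\<sigma> j) ^ a j)) / fact ?N))"
      by (intro Bochner_Integration.integral_cong refl)
         (simp add: integral_uniform_count_measure finite_perms card_permutations eig_perm_def eigs_def)
    also have "\<dots> = cube_integral ?N (\<lambda>x. (\<Prod>j<?N. x j ^ a j) * (vdm ?N x * vdm ?N x)) / vnorm ?N"
      by (simp add: haar_moments)
    finally show ?thesis unfolding integral_jdens .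
  qed
  have int1: "integrable (PiM {..<?N} (\<lambda>_. lborel)) (jdens ?N)"
    using cube_integrable_leg_span[OF leg_span_vdm leg_span_vdm, of ?N] by (simp add: cube_integrable_def jdens_def[abs_def])
  show ?thesis
  proof (rule cube_moments_unique[where N = ?N])
    show "finite_measure (eig_sym_law t)" unfolding eig_sym_law_eq
      by (intro prob_space.finite_measure prob_space_distr meas)
    show "finite_measure ?D"
    proof (rule finite_measureI)
      have "emeasure ?D (space ?D) = (\<integral>\<^sup>+x. ennreal (jdens ?N x) \<partial>PiM {..<?N} (\<lambda>_. lborel))"
        using borel_jdens by (subst emeasure_density) (auto intro!: nn_integral_cong simp: measurable_compose[OF borel_jdens])
      also have "\<dots> = ennreal (LINT x|PiM {..<?N} (\<lambda>_. lborel). jdens ?N x)"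
        by (rule nn_integral_eq_integral[OF int1]) (simp add: jdens_nonneg)
      finally show "emeasure ?D (space ?D) \<noteq> \<infinity>" by simp
    qed
    show "sets (eig_sym_law t) = sets (PiM {..<?N} (\<lambda>_. borel))" by (simp add: eig_sym_law_eq)
    show "sets ?D = sets (PiM {..<?N} (\<lambda>_. borel))" by (rule sD)
    show "AE x in eig_sym_law t. \<forall>j<?N. x j \<in> {0..1}"
      unfolding eig_sym_law_eq using AEp by (simp only: AE_distr_iff[OF meas cube_sets])
    show "AE x in ?D. \<forall>j<?N. x j \<in> {0..1}"
    proof -
      have "AE x in PiM {..<?N} (\<lambda>_. lborel). 0 < ennreal (jdens ?N x) \<longrightarrow> (\<forall>j<?N. x j \<in> {0..1})"
      proof (rule AE_I2, rule impI, intro allI impI)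
        fix x j assume "0 < ennreal (jdens ?N x)" and j: "j < ?N"
        then have nz: "jdens ?N x \<noteq> 0" by auto
        have "indicator {0..1} (x j) \<noteq> (0 :: real)"
        proof
          assume "indicator {0..1} (x j) = (0 :: real)"
          then have "\<exists>a\<in>{..<?N}. indicator {0..1} (x a) = (0 :: real)" using j by blast
          then have "(\<Prod>j<?N. indicator {0..1} (x j) :: real) = 0" by (rule prod_zero[rotated]) simp
          then have "jdens ?N x = 0" by (simp only: jdens_def cubemap_def mult_zero_left div_0)
          with nz show False ..
        qed
        then show "x j \<in> {0..1}" by (simp add: indicator_eq_0_iff)
      qed
      then show ?thesis by (subst AE_density) (auto intro: measurable_compose[OF borel_jdens])
    qed
  qed (rule moments)
qed

subsection \<open>Marginals\<close>

text \<open>Splitting the coordinates with \<open>merge\<close>, Fubini's theorem shows that the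
  cylinder over a null set is null. This yields absolute continuity of the marginals.\<close>

lemma AE_restrict_lborel:
  fixes m N :: nat
  assumes m: "m \<le> N" and A: "A \<in> null_sets (PiM {..<m} (\<lambda>_. lborel :: real measure))"
  shows "AE x in PiM {..<N} (\<lambda>_. lborel :: real measure). restrict x {..<m} \<notin> A"
proof -
  let ?L = "\<lambda>I. PiM I (\<lambda>_. lborel :: real measure) :: (nat \<Rightarrow> real) measure"
  let ?J = "{m..<N}"
  have IJ: "{..<m} \<inter> ?J = {}" "{..<m} \<union> ?J = {..<N}" using m by auto
  interpret I: finite_product_sigma_finite "\<lambda>_. lborel :: real measure" "{..<m}" by standard simp
  interpret J: finite_product_sigma_finite "\<lambda>_. lborel :: real measure" ?J by standard simp
  interpret P: pair_sigma_finite "?L {..<m}" "?L ?J" ..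
  have meas: "(\<lambda>x. restrict x {..<m}) \<in> measurable (?L {..<N}) (?L {..<m})"
    using m by (intro measurable_restrict_subset) auto
  have As: "A \<in> sets (?L {..<m})" using A by auto
  have pred: "{x \<in> space (?L {..<N}). restrict x {..<m} \<notin> A} \<in> sets (?L {..<N})"
  proof -
    have "(\<lambda>x. restrict x {..<m}) -` A \<inter> space (?L {..<N}) \<in> sets (?L {..<N})"
      by (rule measurable_sets[OF meas As])
    moreover have "{x \<in> space (?L {..<N}). restrict x {..<m} \<notin> A} = space (?L {..<N}) - ((\<lambda>x. restrict x {..<m}) -` A \<inter> space (?L {..<N}))"
      by auto
    ultimately show ?thesis by auto
  qed
  have mm: "merge {..<m} ?J \<in> measurable (?L {..<m} \<Otimes>\<^sub>M ?L ?J) (?L {..<N})"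
    using measurable_merge[of "{..<m}" ?J "\<lambda>_. lborel :: real measure"] unfolding IJ .
  have "distr (?L {..<m} \<Otimes>\<^sub>M ?L ?J) (?L {..<N}) (merge {..<m} ?J) = ?L {..<N}"
    using lborel_prod.distr_merge[OF IJ(1)] unfolding IJ by simp
  moreover have "AE x in distr (?L {..<m} \<Otimes>\<^sub>M ?L ?J) (?L {..<N}) (merge {..<m} ?J). restrict x {..<m} \<notin> A"
  proof (subst AE_distr_iff[OF mm pred])
    show "AE z in ?L {..<m} \<Otimes>\<^sub>M ?L ?J. restrict (merge {..<m} ?J z) {..<m} \<notin> A"
    proof (rule P.AE_pair_measure)
      show "{z \<in> space (?L {..<m} \<Otimes>\<^sub>M ?L ?J). restrict (merge {..<m} ?J z) {..<m} \<notin> A} \<in> sets (?L {..<m} \<Otimes>\<^sub>M ?L ?J)"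
      proof -
        have "{z \<in> space (?L {..<m} \<Otimes>\<^sub>M ?L ?J). restrict (merge {..<m} ?J z) {..<m} \<notin> A}
          = merge {..<m} ?J -` {x \<in> space (?L {..<N}). restrict x {..<m} \<notin> A} \<inter> space (?L {..<m} \<Otimes>\<^sub>M ?L ?J)"
          using measurable_space[OF mm] by blast
        then show ?thesis by (simp only: measurable_sets[OF mm pred])
      qed
      show "AE x in ?L {..<m}. AE y in ?L ?J. restrict (merge {..<m} ?J (x, y)) {..<m} \<notin> A"
        using AE_not_in[OF A] AE_space
      proof eventually_elim
        fix x assume x: "x \<notin> A" "x \<in> space (?L {..<m})"
        have "restrict (merge {..<m} ?J (x, y)) {..<m} = x" for y
          using x(2) by (auto simp: space_PiM fun_eq_iff merge_def PiE_def extensional_def)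
        then show "AE y in ?L ?J. restrict (merge {..<m} ?J (x, y)) {..<m} \<notin> A" using x(1) by simp
      qed
    qed
  qed
  ultimately show ?thesis by (simp only:)
qed

lemma sets_law: "sets (eig_sym_law (t :: 'n::finite itself)) = sets (PiM {..<CARD('n)} (\<lambda>_. borel))"
  by (simp add: eig_sym_law_def)

lemma sets_lborel_PiM: "sets (PiM I (\<lambda>_. lborel :: real measure)) = sets (PiM I (\<lambda>_. borel))"
  by (simp cong: sets_PiM_cong)

text \<open>\<open>eig_density\<close> is a Radon-Nikodym derivative, so absolute continuity of the
  marginal comes first. Then both sides are the mean of g at the first m coordinates, over the
  marginal and over the joint law.\<close>

lemma marginal_integral:
  fixes g :: "(nat \<Rightarrow> real) \<Rightarrow> complex" and t :: "'n::finite itself"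
  assumes m: "m \<le> CARD('n)" and g: "g \<in> borel_measurable (PiM {..<m} (\<lambda>_. lborel :: real measure))"
  shows "(LINT x : PiE {..<m} (\<lambda>_. {0..1}) | PiM {..<m} (\<lambda>_. lborel). enn2real (eig_density t m x) *\<^sub>R g x)
    = (LINT x|PiM {..<CARD('n)} (\<lambda>_. lborel). jdens CARD('n) x *\<^sub>R g (restrict x {..<m}))"
proof -
  let ?N = "CARD('n)"
  let ?L = "\<lambda>I. PiM I (\<lambda>_. lborel :: real measure) :: (nat \<Rightarrow> real) measure"
  let ?Q = "eig_marginal t m"
  let ?R = "eig_density t m"
  let ?C = "Pi\<^sub>E {..<m} (\<lambda>_. {0..1 :: real})"
  let ?r = "\<lambda>x :: nat \<Rightarrow> real. restrict x {..<m}"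
  have mr: "?r \<in> measurable (?L {..<?N}) (?L {..<m})"
    using m by (intro measurable_restrict_subset) auto
  have mr': "?r \<in> measurable (eig_sym_law t) (PiM {..<m} (\<lambda>_. borel))"
    using mr unfolding measurable_cong_sets[OF sets_law sets_lborel_PiM[symmetric]]
    by (subst measurable_cong_sets[OF sets_lborel_PiM[symmetric] refl])
  have law: "eig_sym_law t = density (?L {..<?N}) (\<lambda>x. ennreal (jdens ?N x))" by (rule eig_sym_law_density)
  have sQ: "sets ?Q = sets (?L {..<m})" by (simp add: eig_marginal_def sets_lborel_PiM)
  have pl: "prob_space (eig_sym_law t)"
  proof -
    interpret H: prob_space "haar_unitary :: (complex^('n+'n)^('n+'n)) measure" by (rule prob_space_haar)
    interpret u: prob_space "uniform_count_measure {\<sigma>. \<sigma> permutes {..<?N}}"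
      by (rule prob_space_perms)
    interpret pair_prob_space "haar_unitary :: (complex^('n+'n)^('n+'n)) measure" "uniform_count_measure {\<sigma>. \<sigma> permutes {..<?N}}" ..
    show ?thesis unfolding eig_sym_law_eq by (rule prob_space_distr[OF measurable_eig_perm])
  qed
  interpret Q: prob_space ?Q
    unfolding eig_marginal_def by (rule prob_space.prob_space_distr[OF pl mr'])
  interpret I: finite_product_sigma_finite "\<lambda>_. lborel :: real measure" "{..<m}" by standard simp
  have ac: "absolutely_continuous (?L {..<m}) ?Q"
    unfolding absolutely_continuous_def
  proof
    fix A assume A: "A \<in> null_sets (?L {..<m})"
    then have As: "A \<in> sets (PiM {..<m} (\<lambda>_. borel))" by (auto simp: sets_lborel_PiM)
    have "AE x in eig_sym_law t. ?r x \<notin> A"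
      unfolding law by (subst AE_density) (use AE_restrict_lborel[OF m A] in \<open>auto intro: measurable_compose[OF borel_jdens]\<close>)
    then have "AE x in ?Q. x \<notin> A"
      unfolding eig_marginal_def
    proof (subst AE_distr_iff[OF mr'])
      have "{x \<in> space (PiM {..<m} (\<lambda>_. borel)). x \<notin> A} = space (PiM {..<m} (\<lambda>_. borel)) - A" by auto
      then show "{x \<in> space (PiM {..<m} (\<lambda>_. borel)). x \<notin> A} \<in> sets (PiM {..<m} (\<lambda>_. borel))" using As by auto
    qed
    then show "A \<in> null_sets ?Q"
      using As by (subst (asm) AE_iff_null_sets[symmetric]) (auto simp: sQ sets_lborel_PiM)
  qed
  have dens: "density (?L {..<m}) ?R = ?Q"
    unfolding eig_density_def by (rule I.density_RN_deriv[OF ac sQ])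
  have Rm: "?R \<in> borel_measurable (?L {..<m})"
    unfolding eig_density_def by simp
  have fin: "AE x in ?L {..<m}. ?R x \<noteq> \<infinity>"
    unfolding eig_density_def by (rule I.RN_deriv_finite[OF Q.sigma_finite_measure_axioms ac sQ])
  \<comment> \<open>The derivative is finite almost everywhere, so \<open>enn2real\<close> changes
    it on a null set only.\<close>
  have dens': "density (?L {..<m}) (\<lambda>x. ennreal (enn2real (?R x))) = ?Q"
  proof -
    have "density (?L {..<m}) (\<lambda>x. ennreal (enn2real (?R x))) = density (?L {..<m}) ?R"
      using fin Rm by (intro density_cong) (auto simp: less_top)
    then show ?thesis using dens by simp
  qed
  have Cs: "?C \<in> sets (?L {..<m})" by (intro sets_PiM_I_finite) auto
  let ?f = "\<lambda>x. indicator ?C x *\<^sub>R g x"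
  have fm: "?f \<in> borel_measurable (?L {..<m})" using g Cs by simp
  have fm': "?f \<in> borel_measurable (PiM {..<m} (\<lambda>_. borel))"
    using fm by (simp only: measurable_cong_sets[OF sets_lborel_PiM refl])
  have "(LINT x : ?C | ?L {..<m}. enn2real (?R x) *\<^sub>R g x) = (LINT x|?L {..<m}. enn2real (?R x) *\<^sub>R ?f x)"
    unfolding set_lebesgue_integral_def by (simp add: mult.commute)
  also have "\<dots> = (LINT x|density (?L {..<m}) (\<lambda>x. ennreal (enn2real (?R x))). ?f x)"
    using Rm by (subst integral_density[OF fm]) auto
  also have "\<dots> = (LINT x|?Q. ?f x)" unfolding dens' ..
  also have "\<dots> = (LINT x|eig_sym_law t. ?f (?r x))"
    unfolding eig_marginal_def by (rule integral_distr[OF mr' fm'])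
  also have "\<dots> = (LINT x|?L {..<?N}. jdens ?N x *\<^sub>R ?f (?r x))"
    unfolding law
    by (rule integral_density[OF measurable_compose[OF mr fm] borel_jdens]) (simp add: jdens_nonneg)
  \<comment> \<open>The indicator of the smaller cube is absorbed, since \<open>jdens\<close>
    vanishes unless all coordinates lie in [0, 1].\<close>
  also have "\<dots> = (LINT x|?L {..<?N}. jdens ?N x *\<^sub>R g (?r x))"
  proof (intro Bochner_Integration.integral_cong refl)
    fix x
    show "jdens ?N x *\<^sub>R ?f (?r x) = jdens ?N x *\<^sub>R g (?r x)"
    proof (cases "\<forall>j<?N. x j \<in> {0..1}")
      case True
      then have "?r x \<in> ?C" using m by auto
      then show ?thesis by simp
    next
      case False
      then obtain j where "j < ?N" "x j \<notin> {0..1}" by blast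
      then have "\<exists>a\<in>{..<?N}. indicator {0..1} (x a) = (0 :: real)"
        by (intro bexI[of _ j]) auto
      then have "(\<Prod>j<?N. indicator {0..1} (x j) :: real) = 0"
        by (rule prod_zero[OF finite_lessThan])
      then have "jdens ?N x = 0" by (simp add: jdens_def cubemap_def)
      then show ?thesis by simp
    qed
  qed
  finally show ?thesis .
qed

subsection \<open>Determinantal expansion\<close>

definition cpoly :: "nat \<Rightarrow> (nat \<Rightarrow> complex) \<Rightarrow> real \<Rightarrow> complex" where
  "cpoly d c s = (\<Sum>q\<le>d. c q * of_real (poly (legp q) s))"

lemma borel_cpoly: "cpoly d c \<in> borel_measurable lborel"
proof -
  have "continuous_on UNIV (cpoly d c)"
    unfolding cpoly_def[abs_def] by (intro continuous_intros)
  then show ?thesis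
    unfolding measurable_lborel1 measurable_lborel2 by (rule borel_measurable_continuous_onI)
qed

lemma cpoly_integral:
  shows "integrable lborel (\<lambda>s. indicator {0..1} s *\<^sub>R (cpoly d c s * of_real (poly (p * r) s)))"
    and "(LINT s|lborel. indicator {0..1} s *\<^sub>R (cpoly d c s * of_real (poly (p * r) s)))
      = (\<Sum>q\<le>d. c q * of_real (int01 (legp q * p * r)))"
proof -
  have e: "(\<lambda>s. indicator {0..1} s *\<^sub>R (cpoly d c s * of_real (poly (p * r) s)))
    = (\<lambda>s. \<Sum>q\<le>d. c q * complex_of_real (indicator {0..1} s * poly (legp q * p * r) s))"
    by (simp add: cpoly_def scaleR_conv_of_real sum_distrib_left sum_distrib_right mult_ac fun_eq_iff)
  have i: "integrable lborel (\<lambda>s. complex_of_real (indicator {0..1} s * poly w s))" for w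
    by (rule integrable_of_real[OF indicator_poly_lborel(1)])
  show "integrable lborel (\<lambda>s. indicator {0..1} s *\<^sub>R (cpoly d c s * of_real (poly (p * r) s)))"
    unfolding e by (intro Bochner_Integration.integrable_sum integrable_mult_right i)
  show "(LINT s|lborel. indicator {0..1} s *\<^sub>R (cpoly d c s * of_real (poly (p * r) s)))
      = (\<Sum>q\<le>d. c q * of_real (int01 (legp q * p * r)))"
    unfolding e using i
    by (subst Bochner_Integration.integral_sum) (simp_all only: integrable_mult_right integral_mult_right_zero integral_complex_of_real indicator_poly_lborel(2))
qed

text \<open>Contribution of one index tuple to the final formula, a determinant expanded over
  permutations; \<pi> is the inverse of the permutation used there.\<close>

definition Theta :: "nat \<Rightarrow> (nat \<Rightarrow> nat \<Rightarrow> nat \<Rightarrow> complex) \<Rightarrow> (nat \<Rightarrow> nat) \<Rightarrow> complex" where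
  "Theta m B k = (\<Sum>\<pi> | \<pi> permutes {..<m}. of_int (sign \<pi>) * (\<Prod>j<m. of_nat (2 * k j + 1) * B j (k j) (k (\<pi> j))))"

lemma Theta_cong: "(\<And>j. j < m \<Longrightarrow> k j = k' j) \<Longrightarrow> Theta m B k = Theta m B k'"
  unfolding Theta_def
proof (intro sum.cong refl arg_cong2[where f = "(*)"] prod.cong)
  fix \<pi> j assume h: "\<And>j. j < m \<Longrightarrow> k j = k' j" "\<pi> \<in> {\<pi>. \<pi> permutes {..<m}}" "j \<in> {..<m}"
  then have "\<pi> j < m" using permutes_in_image[of \<pi> "{..<m}" j] by simp
  with h show "of_nat (2 * k j + 1) = (of_nat (2 * k' j + 1) :: complex)" "B j (k j) (k (\<pi> j)) = B j (k' j) (k' (\<pi> j))"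
    by simp_all
qed

text \<open>Composition with the transposition of two equal indices keeps the product and reverses
  the sign, so the sum equals its negative.\<close>

lemma Theta_noninj: assumes "\<not> inj_on k {..<m}" shows "Theta m B k = 0"
proof -
  obtain a b where ab: "a < m" "b < m" "a \<noteq> b" "k a = k b" using assms by (auto simp: inj_on_def)
  let ?t = "Transposition.transpose a b"
  have t: "?t permutes {..<m}" using ab by (intro permutes_swap_id) auto
  have kt: "k (?t i) = k i" for i using ab by (simp add: Transposition.transpose_def)
  let ?f = "\<lambda>\<pi>. of_int (sign \<pi>) * (\<Prod>j<m. of_nat (2 * k j + 1) * B j (k j) (k (\<pi> j)))"
  have "Theta m B k = (\<Sum>\<pi> | \<pi> permutes {..<m}. ?f (?t \<circ> \<pi>))"
    unfolding Theta_def by (rule setum_permutations_compose_left[OF t])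
  also have "\<dots> = (\<Sum>\<pi> | \<pi> permutes {..<m}. - ?f \<pi>)"
  proof (intro sum.cong refl)
    fix \<pi> assume "\<pi> \<in> {\<pi>. \<pi> permutes {..<m}}"
    then have "permutation \<pi>" "permutation ?t" using t by (auto simp: permutation_permutes)
    then have "sign (?t \<circ> \<pi>) = - sign \<pi>" using ab by (simp add: sign_compose sign_swap_id)
    then show "?f (?t \<circ> \<pi>) = - ?f \<pi>" by (simp add: kt)
  qed
  also have "\<dots> = - Theta m B k" by (simp add: Theta_def sum_negf)
  finally show ?thesis by simp
qed

text \<open>Put \<open>\<sigma> = \<tau> \<circ> \<pi>\<close>. From m on, orthogonality forces
  \<pi> to fix every index, and the norms there cancel the weights; what is left is a permutation of
  the first m indices.\<close>

lemma inner_perm_sum: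
  assumes m: "m \<le> N" and t: "\<tau> permutes {..<N}"
  shows "(\<Sum>\<sigma> | \<sigma> permutes {..<N}. of_int (sign \<tau>) * of_int (sign \<sigma>) *
      (\<Prod>j<N. of_nat (2 * \<tau> j + 1) * (if j < m then B j (\<tau> j) (\<sigma> j) else if \<tau> j = \<sigma> j then 1 / of_nat (2 * \<tau> j + 1) else 0)))
    = Theta m B \<tau>"
proof -
  let ?b = "\<lambda>\<sigma> j. of_nat (2 * \<tau> j + 1) * (if j < m then B j (\<tau> j) (\<sigma> j) else if \<tau> j = \<sigma> j then 1 / of_nat (2 * \<tau> j + 1) else 0) :: complex"
  let ?f = "\<lambda>\<sigma>. of_int (sign \<tau>) * of_int (sign \<sigma>) * (\<Prod>j<N. ?b \<sigma> j) :: complex"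
  have inj: "\<tau> a = \<tau> b \<longleftrightarrow> a = b" for a b using permutes_inj[OF t] by (auto dest: injD)
  have tail: "?f (\<tau> \<circ> \<pi>) = (if \<pi> permutes {..<m} then of_int (sign \<pi>) * (\<Prod>j<m. of_nat (2 * \<tau> j + 1) * B j (\<tau> j) (\<tau> (\<pi> j))) else 0)"
    if p: "\<pi> permutes {..<N}" for \<pi>
  proof -
    have "permutation \<tau>" "permutation \<pi>" using t p by (auto simp: permutation_permutes)
    then have s: "of_int (sign \<tau>) * of_int (sign (\<tau> \<circ> \<pi>)) = (of_int (sign \<pi>) :: complex)"
    proof -
      have "sign \<tau> * sign (\<tau> \<circ> \<pi>) = sign \<pi>"
        unfolding sign_compose[OF \<open>permutation \<tau>\<close> \<open>permutation \<pi>\<close>]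
        by (simp only: mult.assoc[symmetric] sign_idempotent mult_1)
      then show ?thesis by (simp only: of_int_mult[symmetric])
    qed
    have "(\<Prod>j<N. ?b (\<tau> \<circ> \<pi>) j) = (\<Prod>j<m. ?b (\<tau> \<circ> \<pi>) j) * (\<Prod>j\<in>{m..<N}. ?b (\<tau> \<circ> \<pi>) j)"
      using m by (subst prod.union_disjoint[symmetric]) (auto intro!: prod.cong simp: ivl_disj_un)
    also have "(\<Prod>j<m. ?b (\<tau> \<circ> \<pi>) j) = (\<Prod>j<m. of_nat (2 * \<tau> j + 1) * B j (\<tau> j) (\<tau> (\<pi> j)))" by simp
    also have "(\<Prod>j\<in>{m..<N}. ?b (\<tau> \<circ> \<pi>) j) = (if \<pi> permutes {..<m} then 1 else 0)"
    proof (cases "\<forall>j\<in>{m..<N}. \<pi> j = j")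
      case True
      have "\<pi> permutes {..<m}"
        by (rule permutes_superset[OF p]) (use True in auto)
      then show ?thesis using True by (auto intro!: prod.neutral simp del: of_nat_add of_nat_mult of_nat_Suc)
    next
      case False
      then obtain j where j: "j \<in> {m..<N}" "\<pi> j \<noteq> j" by auto
      then have "\<not> \<pi> permutes {..<m}" using permutes_not_in[of \<pi> "{..<m}" j] by auto
      moreover have "(\<Prod>j\<in>{m..<N}. ?b (\<tau> \<circ> \<pi>) j) = 0"
        using j inj[of j "\<pi> j"] by (intro prod_zero) (auto intro!: bexI[of _ j])
      ultimately show ?thesis by simp
    qed
    finally show ?thesis unfolding mult.assoc[symmetric] by (simp add: s)
  qed
  have "(\<Sum>\<sigma> | \<sigma> permutes {..<N}. ?f \<sigma>) = (\<Sum>\<pi> | \<pi> permutes {..<N}. ?f (\<tau> \<circ> \<pi>))"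
    by (rule setum_permutations_compose_left[OF t])
  also have "\<dots> = (\<Sum>\<pi> | \<pi> permutes {..<N}. if \<pi> permutes {..<m} then of_int (sign \<pi>) * (\<Prod>j<m. of_nat (2 * \<tau> j + 1) * B j (\<tau> j) (\<tau> (\<pi> j))) else 0)"
    by (intro sum.cong refl tail) simp
  also have "\<dots> = Theta m B \<tau>" unfolding Theta_def
    using m permutes_subset[of _ "{..<m}" "{..<N}"]
    by (intro sum.mono_neutral_cong_right) (auto simp: finite_perms)
  finally show ?thesis .
qed

lemma card_perm_extensions:
  assumes m: "m \<le> N" and k: "k \<in> {..<m} \<rightarrow>\<^sub>E {..<N}" and inj: "inj_on k {..<m}"
  shows "card {\<tau>. \<tau> permutes {..<N} \<and> restrict \<tau> {..<m} = k} = fact (N - m)"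
proof -
  have ks: "k ` {..<m} \<subseteq> {..<N}" using k by auto
  have "card ({..<N} - k ` {..<m}) = card {m..<N}"
    using ks inj m by (simp add: card_Diff_subset card_image)
  then obtain h where h: "bij_betw h {m..<N} ({..<N} - k ` {..<m})"
    using finite_same_card_bij[of "{m..<N}" "{..<N} - k ` {..<m}"] by auto
  define \<tau>0 where "\<tau>0 = (\<lambda>j. if j < m then k j else if j < N then h j else j)"
  have "bij_betw \<tau>0 ({..<m} \<union> {m..<N}) (k ` {..<m} \<union> ({..<N} - k ` {..<m}))"
  proof (rule bij_betw_combine)
    show "bij_betw \<tau>0 {..<m} (k ` {..<m})"
      using inj by (auto simp: bij_betw_def \<tau>0_def inj_on_def)
    show "bij_betw \<tau>0 {m..<N} ({..<N} - k ` {..<m})"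
      using h by (rule bij_betw_cong[THEN iffD1, rotated]) (simp add: \<tau>0_def)
  qed auto
  moreover have "{..<m} \<union> {m..<N} = {..<N}" "k ` {..<m} \<union> ({..<N} - k ` {..<m}) = {..<N}" using m ks by auto
  ultimately have "bij_betw \<tau>0 {..<N} {..<N}" by simp
  then have t0: "\<tau>0 permutes {..<N}" by (rule bij_imp_permutes) (use m in \<open>simp add: \<tau>0_def\<close>)
  have t0k: "\<tau>0 j = k j" if "j < m" for j using that by (simp add: \<tau>0_def)
  have "bij_betw (\<lambda>\<pi>. \<tau>0 \<circ> \<pi>) {\<pi>. \<pi> permutes {m..<N}} {\<tau>. \<tau> permutes {..<N} \<and> restrict \<tau> {..<m} = k}"
  proof (rule bij_betw_byWitness[where f' = "\<lambda>\<tau>. inv \<tau>0 \<circ> \<tau>"])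
    show "\<forall>\<pi>\<in>{\<pi>. \<pi> permutes {m..<N}}. inv \<tau>0 \<circ> (\<tau>0 \<circ> \<pi>) = \<pi>"
      using permutes_inverses[OF t0] by (auto simp: fun_eq_iff)
    show "\<forall>\<tau>\<in>{\<tau>. \<tau> permutes {..<N} \<and> restrict \<tau> {..<m} = k}. \<tau>0 \<circ> (inv \<tau>0 \<circ> \<tau>) = \<tau>"
      using permutes_inverses[OF t0] by (auto simp: fun_eq_iff)
    show "(\<lambda>\<pi>. \<tau>0 \<circ> \<pi>) ` {\<pi>. \<pi> permutes {m..<N}} \<subseteq> {\<tau>. \<tau> permutes {..<N} \<and> restrict \<tau> {..<m} = k}"
    proof (intro image_subsetI CollectI conjI)
      fix \<pi> assume "\<pi> \<in> {\<pi>. \<pi> permutes {m..<N}}"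
      then have p: "\<pi> permutes {m..<N}" by simp
      have "\<pi> permutes {..<N}" by (rule permutes_subset[OF p]) auto
      then show "\<tau>0 \<circ> \<pi> permutes {..<N}" by (rule permutes_compose[OF _ t0])
      show "restrict (\<tau>0 \<circ> \<pi>) {..<m} = k"
        using k permutes_not_in[OF p] by (auto simp: fun_eq_iff t0k PiE_def extensional_def)
    qed
    show "(\<lambda>\<tau>. inv \<tau>0 \<circ> \<tau>) ` {\<tau>. \<tau> permutes {..<N} \<and> restrict \<tau> {..<m} = k} \<subseteq> {\<pi>. \<pi> permutes {m..<N}}"
    proof (intro image_subsetI CollectI)
      fix \<tau> assume "\<tau> \<in> {\<tau>. \<tau> permutes {..<N} \<and> restrict \<tau> {..<m} = k}"
      then have t: "\<tau> permutes {..<N}" and r: "restrict \<tau> {..<m} = k" by auto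
      have p: "inv \<tau>0 \<circ> \<tau> permutes {..<N}" by (rule permutes_compose[OF t permutes_inv[OF t0]])
      have fix1: "(inv \<tau>0 \<circ> \<tau>) j = j" if "j < m" for j
      proof -
        have "\<tau> j = \<tau>0 j" using fun_cong[OF r, of j] that by (simp add: t0k)
        then show ?thesis using permutes_inverses[OF t0] by simp
      qed
      show "inv \<tau>0 \<circ> \<tau> permutes {m..<N}"
        by (rule permutes_superset[OF p]) (use fix1 in auto)
    qed
  qed
  then have "card {\<tau>. \<tau> permutes {..<N} \<and> restrict \<tau> {..<m} = k} = card {\<pi>. \<pi> permutes {m..<N}}"
    by (rule bij_betw_same_card[symmetric])
  also have "\<dots> = fact (N - m)" by (simp add: card_permutations)
  finally show ?thesis .
qed

text \<open>\<open>Theta m\<close> sees only the first m values of a permutation. An injective tuple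
  extends in (N - m)! ways; a tuple with a repetition does not extend, but its \<open>Theta\<close>
  is 0.\<close>

lemma Theta_sum:
  assumes m: "m \<le> N"
  shows "(\<Sum>\<tau> | \<tau> permutes {..<N}. Theta m B \<tau>) = of_nat (fact (N - m)) * (\<Sum>k\<in>{..<m} \<rightarrow>\<^sub>E {..<N}. Theta m B k)"
proof -
  let ?K = "{..<m} \<rightarrow>\<^sub>E {..<N}"
  have fK: "finite ?K" by (intro finite_PiE) auto
  have maps: "(\<lambda>\<tau>. restrict \<tau> {..<m}) ` {\<tau>. \<tau> permutes {..<N}} \<subseteq> ?K"
  proof (intro image_subsetI)
    fix \<tau> assume "\<tau> \<in> {\<tau>. \<tau> permutes {..<N}}"
    then show "restrict \<tau> {..<m} \<in> ?K"
      using permutes_in_image[of \<tau> "{..<N}"] m by (auto simp: PiE_iff)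
  qed
  have "(\<Sum>\<tau> | \<tau> permutes {..<N}. Theta m B \<tau>)
    = (\<Sum>k\<in>?K. \<Sum>\<tau>\<in>{\<tau>. \<tau> \<in> {\<tau>. \<tau> permutes {..<N}} \<and> restrict \<tau> {..<m} = k}. Theta m B \<tau>)"
    by (rule sum.group[OF finite_perms fK maps, symmetric])
  also have "\<dots> = (\<Sum>k\<in>?K. of_nat (fact (N - m)) * Theta m B k)"
  proof (intro sum.cong refl)
    fix k assume k: "k \<in> ?K"
    have "(\<Sum>\<tau>\<in>{\<tau>. \<tau> \<in> {\<tau>. \<tau> permutes {..<N}} \<and> restrict \<tau> {..<m} = k}. Theta m B \<tau>)
      = (\<Sum>\<tau>\<in>{\<tau>. \<tau> permutes {..<N} \<and> restrict \<tau> {..<m} = k}. Theta m B k)"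
      by (intro sum.cong Theta_cong) auto
    also have "\<dots> = of_nat (card {\<tau>. \<tau> permutes {..<N} \<and> restrict \<tau> {..<m} = k}) * Theta m B k" by simp
    also have "\<dots> = of_nat (fact (N - m)) * Theta m B k"
    proof (cases "inj_on k {..<m}")
      case True
      then show ?thesis by (simp add: card_perm_extensions[OF m k])
    qed (simp add: Theta_noninj)
    finally show "(\<Sum>\<tau>\<in>{\<tau>. \<tau> \<in> {\<tau>. \<tau> permutes {..<N}} \<and> restrict \<tau> {..<m} = k}. Theta m B \<tau>) = of_nat (fact (N - m)) * Theta m B k" .
  qed
  finally show ?thesis by (simp only: sum_distrib_left)
qed

lemma jdens_integral:
  fixes m N d :: nat and C :: "nat \<Rightarrow> nat \<Rightarrow> complex"
  assumes m: "m \<le> N"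
  defines "B \<equiv> \<lambda>j a b. \<Sum>q\<le>d. C j q * complex_of_real (legF q a b)"
  shows "(LINT x|PiM {..<N} (\<lambda>_. lborel). jdens N x *\<^sub>R (\<Prod>j<m. cpoly d (C j) (x j)))
    = of_nat (fact (N - m)) / of_nat (fact N) * (\<Sum>k\<in>{..<m} \<rightarrow>\<^sub>E {..<N}. Theta m B k)"
proof -
  let ?L = "PiM {..<N} (\<lambda>_. lborel :: real measure)"
  \<comment> \<open>The coordinates from m on carry the constant 1, written as
    \<open>cpoly 0\<close> because \<open>legp 0 = 1\<close>. All coordinates then have the same
    shape, and orthogonality is the triple integral with q = 0.\<close>
  define e where "e j s = (if j < m then cpoly d (C j) s else cpoly 0 (\<lambda>_. 1) s)" for j s
  have e: "(\<Prod>j<m. cpoly d (C j) (x j)) = (\<Prod>j<N. e j (x j))" for x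
    unfolding e_def using m by (intro prod.mono_neutral_cong_left) (auto simp: cpoly_def)
  define D where "D j a b = (if j < m then B j a b else if a = b then 1 / of_nat (2 * a + 1) else 0)" for j a b
  let ?u = "\<lambda>\<tau> \<sigma> j s. indicator {0..1} s *\<^sub>R (e j s * of_real (poly (legp (\<tau> j) * legp (\<sigma> j)) s)) :: complex"
  have ui: "integrable lborel (?u \<tau> \<sigma> j)" for \<tau> \<sigma> j
    unfolding e_def by (cases "j < m") (simp_all only: if_True if_False cpoly_integral)
  have uD: "(LINT s|lborel. ?u \<tau> \<sigma> j s) = D j (\<tau> j) (\<sigma> j)" for \<tau> \<sigma> j
  proof (cases "j < m")
    case True
    then show ?thesis unfolding e_def D_def B_def by (simp only: if_True cpoly_integral legF_int01)
  next
    case False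
    have "(\<Sum>q\<le>0. (1 :: complex) * of_real (int01 (legp q * legp (\<tau> j) * legp (\<sigma> j)))) = (if \<tau> j = \<sigma> j then 1 / of_nat (2 * \<tau> j + 1) else 0)"
      by (simp add: int01_legp_legp)
    then show ?thesis using False unfolding e_def D_def by (simp only: if_False cpoly_integral)
  qed
  have int: "integrable ?L (\<lambda>x. \<Prod>j<N. ?u \<tau> \<sigma> j (x j))" for \<tau> \<sigma>
    by (intro lborel_prod.product_integrable_prod ui) auto
  have val: "(LINT x|?L. (\<Prod>j<N. ?u \<tau> \<sigma> j (x j))) = (\<Prod>j<N. D j (\<tau> j) (\<sigma> j))" for \<tau> \<sigma>
    by (subst lborel_prod.product_integral_prod[OF finite_lessThan ui]) (simp only: uD)
  have "(LINT x|?L. jdens N x *\<^sub>R (\<Prod>j<m. cpoly d (C j) (x j)))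
    = (LINT x|?L. (\<Sum>\<tau> | \<tau> permutes {..<N}. \<Sum>\<sigma> | \<sigma> permutes {..<N}.
        (of_int (sign \<tau>) * of_int (sign \<sigma>) / of_real (vnorm N)) * (\<Prod>j<N. ?u \<tau> \<sigma> j (x j))))"
  proof (intro Bochner_Integration.integral_cong refl)
    fix x
    have u: "(\<Prod>j<N. ?u \<tau> \<sigma> j (x j)) = of_real (\<Prod>j<N. indicator {0..1} (x j)) * (\<Prod>j<N. e j (x j)) * of_real (leg_prod N \<tau> x * leg_prod N \<sigma> x)" for \<tau> \<sigma>
      by (simp add: scaleR_conv_of_real prod.distrib leg_prod_def mult_ac)
    have "complex_of_real (vdm N x * vdm N x) = (\<Sum>\<tau> | \<tau> permutes {..<N}. \<Sum>\<sigma> | \<sigma> permutes {..<N}. of_int (sign \<tau>) * of_int (sign \<sigma>) * of_real (leg_prod N \<tau> x * leg_prod N \<sigma> x))"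
      by (simp add: vdm_expand sum_product mult_ac)
    then have "jdens N x *\<^sub>R (\<Prod>j<m. cpoly d (C j) (x j))
      = of_real (\<Prod>j<N. indicator {0..1} (x j)) * (\<Prod>j<N. e j (x j)) / of_real (vnorm N) *
         (\<Sum>\<tau> | \<tau> permutes {..<N}. \<Sum>\<sigma> | \<sigma> permutes {..<N}. of_int (sign \<tau>) * of_int (sign \<sigma>) * of_real (leg_prod N \<tau> x * leg_prod N \<sigma> x))"
      by (simp add: jdens_def cubemap_def scaleR_conv_of_real e mult_ac)
    also have "\<dots> = (\<Sum>\<tau> | \<tau> permutes {..<N}. \<Sum>\<sigma> | \<sigma> permutes {..<N}.
        (of_int (sign \<tau>) * of_int (sign \<sigma>) / of_real (vnorm N)) * (\<Prod>j<N. ?u \<tau> \<sigma> j (x j)))"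
      unfolding u sum_distrib_left by (intro sum.cong refl) (simp add: mult_ac)
    finally show "jdens N x *\<^sub>R (\<Prod>j<m. cpoly d (C j) (x j)) = (\<Sum>\<tau> | \<tau> permutes {..<N}. \<Sum>\<sigma> | \<sigma> permutes {..<N}.
        (of_int (sign \<tau>) * of_int (sign \<sigma>) / of_real (vnorm N)) * (\<Prod>j<N. ?u \<tau> \<sigma> j (x j)))" .
  qed
  also have "\<dots> = (\<Sum>\<tau> | \<tau> permutes {..<N}. \<Sum>\<sigma> | \<sigma> permutes {..<N}.
        (of_int (sign \<tau>) * of_int (sign \<sigma>) / of_real (vnorm N)) * (\<Prod>j<N. D j (\<tau> j) (\<sigma> j)))"
    using int by (simp only: Bochner_Integration.integral_sum Bochner_Integration.integrable_sum integrable_mult_right integral_mult_right_zero val)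
  also have "\<dots> = (\<Sum>\<tau> | \<tau> permutes {..<N}. (1 / of_nat (fact N)) * Theta m B \<tau>)"
  proof (intro sum.cong refl)
    fix \<tau> assume "\<tau> \<in> {\<tau>. \<tau> permutes {..<N}}"
    then have t: "\<tau> permutes {..<N}" by simp
    have nz: "(\<Prod>j<N. of_nat (2 * j + 1) :: complex) \<noteq> 0" by (auto simp del: of_nat_add of_nat_mult of_nat_Suc)
    \<comment> \<open>The inverse norm supplies a factor 2 j + 1 for each j; reindexed by \<tau>
      these become the weights of the index tuple, and 1 / N! remains.\<close>
    have vt: "1 / complex_of_real (vnorm N) = (1 / of_nat (fact N)) * (\<Prod>j<N. of_nat (2 * \<tau> j + 1))"
    proof -
      have "(\<Prod>j<N. of_nat (2 * \<tau> j + 1)) = (\<Prod>j<N. of_nat (2 * j + 1) :: complex)"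
        using prod.permute[OF t, of "\<lambda>j. of_nat (2 * j + 1) :: complex"] by (simp add: o_def)
      moreover have "complex_of_real (vnorm N) = of_nat (fact N) / (\<Prod>j<N. of_nat (2 * j + 1))"
        by (simp add: vnorm_eq prod_dividef add.commute)
      ultimately show ?thesis using nz by (simp only: divide_divide_eq_right mult_1 times_divide_eq_left)
    qed
    have "(\<Sum>\<sigma> | \<sigma> permutes {..<N}. (of_int (sign \<tau>) * of_int (sign \<sigma>) / of_real (vnorm N)) * (\<Prod>j<N. D j (\<tau> j) (\<sigma> j)))
      = (\<Sum>\<sigma> | \<sigma> permutes {..<N}. (1 / of_nat (fact N)) * (of_int (sign \<tau>) * of_int (sign \<sigma>) * (\<Prod>j<N. of_nat (2 * \<tau> j + 1) * D j (\<tau> j) (\<sigma> j))))"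
    proof (intro sum.cong refl)
      fix \<sigma>
      have "(of_int (sign \<tau>) * of_int (sign \<sigma>) / of_real (vnorm N)) * (\<Prod>j<N. D j (\<tau> j) (\<sigma> j))
        = (of_int (sign \<tau>) * of_int (sign \<sigma>)) * (1 / of_real (vnorm N)) * (\<Prod>j<N. D j (\<tau> j) (\<sigma> j))" by simp
      also have "\<dots> = (1 / of_nat (fact N)) * (of_int (sign \<tau>) * of_int (sign \<sigma>) * (\<Prod>j<N. of_nat (2 * \<tau> j + 1) * D j (\<tau> j) (\<sigma> j)))"
        unfolding vt prod.distrib by (simp only: mult_ac)
      finally show "(of_int (sign \<tau>) * of_int (sign \<sigma>) / of_real (vnorm N)) * (\<Prod>j<N. D j (\<tau> j) (\<sigma> j))
        = (1 / of_nat (fact N)) * (of_int (sign \<tau>) * of_int (sign \<sigma>) * (\<Prod>j<N. of_nat (2 * \<tau> j + 1) * D j (\<tau> j) (\<sigma> j)))" .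
    qed
    also have "\<dots> = (1 / of_nat (fact N)) * Theta m B \<tau>"
      unfolding sum_distrib_left[symmetric] D_def inner_perm_sum[OF m t] ..
    finally show "(\<Sum>\<sigma> | \<sigma> permutes {..<N}. (of_int (sign \<tau>) * of_int (sign \<sigma>) / of_real (vnorm N)) * (\<Prod>j<N. D j (\<tau> j) (\<sigma> j)))
      = (1 / of_nat (fact N)) * Theta m B \<tau>" .
  qed
  also have "\<dots> = of_nat (fact (N - m)) / of_nat (fact N) * (\<Sum>k\<in>{..<m} \<rightarrow>\<^sub>E {..<N}. Theta m B k)"
    unfolding sum_distrib_left[symmetric] Theta_sum[OF m] by simp
  finally show ?thesis .
qed

theorem mainTheorem5:
  fixes n d l :: nat and c :: "nat \<Rightarrow> complex" and f :: "real \<Rightarrow> complex"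
    and t :: "'n::finite itself"
  assumes "n \<ge> 1" and "CARD('n) = 2 ^ n"
    and "c d \<noteq> 0"
    and "\<And>x. f x = (\<Sum>q\<le>d. c q * complex_of_real (legendreP q (2 * x - 1)))"
    and "1 \<le> l" and "2 * l \<le> CARD('n)"
  shows "(LINT x : PiE {..<2*l} (\<lambda>_. {0..1}) | PiM {..<2*l} (\<lambda>_. lborel).
            enn2real (eig_density t (2*l) x) *\<^sub>R
              ((\<Prod>j<l. f (x j)) * (\<Prod>j<l. cnj (f (x (l + j))))))
       = (of_nat (fact (CARD('n) - 2*l)) / of_nat (fact (CARD('n))) *
          (\<Sum>k\<in>{..<2*l} \<rightarrow>\<^sub>E {..<CARD('n)}. \<Sum>\<sigma> | \<sigma> permutes {..<2*l}.
             of_int (sign \<sigma>) *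
             (\<Prod>j<2*l. of_nat (2 * k j + 1) *
                (\<Sum>q\<le>d. (if j < l then c q else cnj (c q)) *
                    complex_of_real (legF q (k j) (k (inv \<sigma> j)))))))
     \<and> (\<forall>i j k s. i + j + k = 2 * s \<and> \<bar>int i - int j\<bar> \<le> int k \<and> k \<le> i + j \<longrightarrow>
          legF i j k = fact (2 * s - 2 * i) * fact (2 * s - 2 * j) * fact (2 * s - 2 * k) / fact (2 * s + 1)
               * (fact s / (fact (s - i) * fact (s - j) * fact (s - k))) ^ 2)
     \<and> (\<forall>i j k. \<not> (even (i + j + k) \<and> \<bar>int i - int j\<bar> \<le> int k \<and> k \<le> i + j) \<longrightarrow>
          legF i j k = 0)"
proof (intro conjI allI impI)
  let ?N = "CARD('n)"
  let ?C = "\<lambda>j q. if j < l then c q else cnj (c q)"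
  let ?B = "\<lambda>j a b. \<Sum>q\<le>d. ?C j q * complex_of_real (legF q a b)"
  \<comment> \<open>Legendre polynomials are real, so conjugating f conjugates its coefficients
    only; both products then merge into one over 2 l coordinates.\<close>
  have fc: "f s = cpoly d c s" "cnj (f s) = cpoly d (\<lambda>q. cnj (c q)) s" for s
    by (simp_all add: assms(4) cpoly_def poly_legp)
  have g: "(\<Prod>j<l. f (x j)) * (\<Prod>j<l. cnj (f (x (l + j)))) = (\<Prod>j<2*l. cpoly d (?C j) (x j))" for x
  proof -
    have "(\<Prod>j<2*l. cpoly d (?C j) (x j)) = (\<Prod>j<l. cpoly d (?C j) (x j)) * (\<Prod>j\<in>{l..<2*l}. cpoly d (?C j) (x j))"
      by (subst prod.union_disjoint[symmetric]) (auto intro!: prod.cong)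
    also have "(\<Prod>j\<in>{l..<2*l}. cpoly d (?C j) (x j)) = (\<Prod>j<l. cpoly d (?C (l + j)) (x (l + j)))"
      by (rule prod.reindex_bij_witness[where i = "\<lambda>j. l + j" and j = "\<lambda>j. j - l"]) auto
    finally show ?thesis unfolding fc(2) by (simp add: fc(1))
  qed
  have gm: "(\<lambda>x. \<Prod>j<2*l. cpoly d (?C j) (x j)) \<in> borel_measurable (PiM {..<2*l} (\<lambda>_. lborel :: real measure))"
  proof (intro borel_measurable_prod)
    fix j assume j: "j \<in> {..<2*l}"
    have "cpoly d (?C j) \<in> borel_measurable lborel"
      by (rule borel_cpoly)
    then show "(\<lambda>x. cpoly d (?C j) (x j)) \<in> borel_measurable (PiM {..<2*l} (\<lambda>_. lborel :: real measure))"
      by (rule measurable_compose[OF measurable_component_singleton[OF j]])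
  qed
  have "(LINT x : PiE {..<2*l} (\<lambda>_. {0..1}) | PiM {..<2*l} (\<lambda>_. lborel).
            enn2real (eig_density t (2*l) x) *\<^sub>R ((\<Prod>j<l. f (x j)) * (\<Prod>j<l. cnj (f (x (l + j))))))
    = (LINT x|PiM {..<?N} (\<lambda>_. lborel). jdens ?N x *\<^sub>R (\<Prod>j<2*l. cpoly d (?C j) (restrict x {..<2*l} j)))"
    unfolding g by (rule marginal_integral[OF assms(6) gm])
  also have "\<dots> = (LINT x|PiM {..<?N} (\<lambda>_. lborel). jdens ?N x *\<^sub>R (\<Prod>j<2*l. cpoly d (?C j) (x j)))"
    by (intro Bochner_Integration.integral_cong refl arg_cong2[where f = scaleR] prod.cong) simp
  also have "\<dots> = of_nat (fact (?N - 2*l)) / of_nat (fact ?N) * (\<Sum>k\<in>{..<2*l} \<rightarrow>\<^sub>E {..<?N}. Theta (2*l) ?B k)"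
    by (rule jdens_integral[OF assms(6)])
  also have "(\<Sum>k\<in>{..<2*l} \<rightarrow>\<^sub>E {..<?N}. Theta (2*l) ?B k)
     = (\<Sum>k\<in>{..<2*l} \<rightarrow>\<^sub>E {..<?N}. \<Sum>\<sigma> | \<sigma> permutes {..<2*l}. of_int (sign \<sigma>) *
             (\<Prod>j<2*l. of_nat (2 * k j + 1) * ?B j (k j) (k (inv \<sigma> j))))"
  proof (intro sum.cong refl)
    fix k
    \<comment> \<open>Inversion reindexes the permutations and preserves the sign, which gives the
      form with the inverse permutation.\<close>
    have "Theta (2*l) ?B k = (\<Sum>\<sigma> | \<sigma> permutes {..<2*l}. of_int (sign (inv \<sigma>)) *
             (\<Prod>j<2*l. of_nat (2 * k j + 1) * ?B j (k j) (k (inv \<sigma> j))))"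
      unfolding Theta_def by (rule sum_permutations_inverse)
    also have "\<dots> = (\<Sum>\<sigma> | \<sigma> permutes {..<2*l}. of_int (sign \<sigma>) *
             (\<Prod>j<2*l. of_nat (2 * k j + 1) * ?B j (k j) (k (inv \<sigma> j))))"
    proof (intro sum.cong refl)
      fix \<sigma> assume "\<sigma> \<in> {\<sigma>. \<sigma> permutes {..<2*l}}"
      then have "permutation \<sigma>" by (auto simp: permutation_permutes)
      then show "of_int (sign (inv \<sigma>)) * (\<Prod>j<2*l. of_nat (2 * k j + 1) * ?B j (k j) (k (inv \<sigma> j)))
        = of_int (sign \<sigma>) * (\<Prod>j<2*l. of_nat (2 * k j + 1) * ?B j (k j) (k (inv \<sigma> j)))"
        by (simp only: sign_inverse)
    qed
    finally show "Theta (2*l) ?B k = (\<Sum>\<sigma> | \<sigma> permutes {..<2*l}. of_int (sign \<sigma>) *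
             (\<Prod>j<2*l. of_nat (2 * k j + 1) * ?B j (k j) (k (inv \<sigma> j))))" .
  qed
  finally show "(LINT x : PiE {..<2*l} (\<lambda>_. {0..1}) | PiM {..<2*l} (\<lambda>_. lborel).
            enn2real (eig_density t (2*l) x) *\<^sub>R
              ((\<Prod>j<l. f (x j)) * (\<Prod>j<l. cnj (f (x (l + j))))))
       = (of_nat (fact (CARD('n) - 2*l)) / of_nat (fact (CARD('n))) *
          (\<Sum>k\<in>{..<2*l} \<rightarrow>\<^sub>E {..<CARD('n)}. \<Sum>\<sigma> | \<sigma> permutes {..<2*l}.
             of_int (sign \<sigma>) *
             (\<Prod>j<2*l. of_nat (2 * k j + 1) *
                (\<Sum>q\<le>d. (if j < l then c q else cnj (c q)) *
                    complex_of_real (legF q (k j) (k (inv \<sigma> j)))))))" .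
next
  fix i j k s
  assume "i + j + k = 2 * s \<and> \<bar>int i - int j\<bar> \<le> int k \<and> k \<le> i + j"
  then show "legF i j k = fact (2 * s - 2 * i) * fact (2 * s - 2 * j) * fact (2 * s - 2 * k) / fact (2 * s + 1)
               * (fact s / (fact (s - i) * fact (s - j) * fact (s - k))) ^ 2"
    by (intro legF_formula) auto
next
  fix i j k
  assume "\<not> (even (i + j + k) \<and> \<bar>int i - int j\<bar> \<le> int k \<and> k \<le> i + j)"
  then show "legF i j k = 0" by (rule legF_zero)
qed

end
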